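(* Let $T \in \overline{\mathcal{AN}(H)}$ be such that $T^*$ is hyponormal. Then there exist subspaces $H_0, H_1, H_2$ such that $H = H_0 \oplus H_1 \oplus H_2$ and, with respect to this decomposition, $$T = \begin{pmatrix} S_0 & 0 & 0 \\ 0 & \alpha S_1 & 0 \\ 0 & A_1 & B_1 \end{pmatrix},$$ where $\sigma_{ess}(|T^*|) = \{\alpha\}$, $\alpha \geq 0$, and (i) if $(\alpha, \|T\|] \cap \sigma(|T^*|) = \{\alpha_i\}_{i=1}^{n}$ for some $n \in \mathbb{N} \cup \{\infty\}$, then $S_0 = \bigoplus_{i=1}^{n} \alpha_i U_i$, where $U_i$ is unitary on $N(|T^*| - \alpha_i I)$; if $\alpha = \|T\|$, then $H_0 = \{0\}$; (ii) if $H_1 \neq \{0\}$, then $S_1$ is a co-isometry on $H_1$; otherwise $S_1 = 0$; (iii) $A_1 \in \mathcal{B}(H_1, H_2)$ and $B_1 \in \mathcal{B}(H_2)$ are such that $S_1 A_1^* = 0$, $A_1 A_1^* + B_1 B_1^* = \bigoplus_{j=1}^{m} \beta_j^2 I_j$ and $B_1^* B_1 \leq \bigoplus_{j=1}^{m} \beta_j^2 I_j$, where $[m(T^* ), \alpha) \cap \sigma(|T^*|) = \{\beta_j\}_{j=1}^{m}$ for some $m \in \mathbb{N} \cup \{\infty\}$ and $I_j$ is the identity on $N(|T^*| - \beta_j I)$; if $\alpha = m(T^* )$, then $H_2 = \{0\}$; and $T = \|T\| S_1$ if $\|T\| = \alpha = m(T^* )$.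
   Context: $H$ is an infinite-dimensional complex Hilbert space; $\mathcal{B}(H_1,H_2)$ denotes the bounded linear operators from $H_1$ to $H_2$, $\mathcal{B}(H) = \mathcal{B}(H,H)$. $N(\cdot)$ denotes the null space, $\sigma(\cdot)$ the spectrum, $|S| = (S^*S)^{1/2}$, $m(S) = \inf\{\|Sx\| : \|x\| = 1\}$. A co-isometry is an operator whose adjoint is an isometry. For self-adjoint $X, Y$, $X \le Y$ means $Y - X$ is positive. An operator $T$ is norm attaining if $\|Tx\| = \|T\|$ for some unit vector $x$; $\mathcal{AN}(H)$ is the set of $T \in \mathcal{B}(H)$ such that $T|_M : M \to H$ is norm attaining for every nonzero closed subspace $M$ of $H$; $\overline{\mathcal{AN}(H)}$ is its closure in the operator norm. An operator $S$ is hyponormal if $S^*S - SS^* \geq 0$. $S$ is Fredholm if $R(S)$ is closed and $N(S)$, $N(S^* )$ are finite dimensional; $\sigma_{ess}(S) = \{\lambda \in \mathbb{C} : S - \lambda I \text{ is not Fredholm}\}$. Subspaces are closed and $\oplus$ is the orthogonal direct sum. The direct sum operators $\bigoplus_i \alpha_i U_i$ and $\bigoplus_j \beta_j^2 I_j$ act on $H_0 = \bigoplus_i N(|T^*|-\alpha_i I)$ and $H_2 = \bigoplus_j N(|T^*|-\beta_j I)$ respectively. The $\alpha_i$ are distinct and the $\beta_j$ are distinct; either family may be empty ($n=0$ or $m=0$), in which case the corresponding subspace is $\{0\}$ and the corresponding blocks are absent. *)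

theory Defs
  imports "HOL-Analysis.Analysis" "HOL-Library.Extended_Nat"
begin

section \<open>Complex Hilbert spaces\<close>

(* The inner product is linear in its first argument.  The real structure inherited from
   banach is the restriction of the complex one, and the norm is the inner product norm. *)
class complex_hilbert = banach +
  fixes scaleC :: "complex \<Rightarrow> 'a \<Rightarrow> 'a" (infixr "*\<^sub>C" 75)
    and cinner :: "'a \<Rightarrow> 'a \<Rightarrow> complex"
  assumes scaleC_add_right: "c *\<^sub>C (x + y) = c *\<^sub>C x + c *\<^sub>C y"
    and scaleC_add_left: "(c + d) *\<^sub>C x = c *\<^sub>C x + d *\<^sub>C x"
    and scaleC_scaleC: "c *\<^sub>C d *\<^sub>C x = (c * d) *\<^sub>C x"
    and scaleC_of_real: "complex_of_real r *\<^sub>C x = r *\<^sub>R x"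
    and cinner_commute: "cinner x y = cnj (cinner y x)"
    and cinner_add_left: "cinner (x + y) z = cinner x z + cinner y z"
    and cinner_scaleC_left: "cinner (c *\<^sub>C x) y = c * cinner x y"
    and cinner_self: "cinner x x = complex_of_real ((norm x)\<^sup>2)"

lemma scaleC_one: "1 *\<^sub>C (x :: 'a :: complex_hilbert) = x"
  using scaleC_of_real[of 1 x] by simp

global_interpretation complex_vector:
  vector_space "scaleC :: complex \<Rightarrow> 'a \<Rightarrow> 'a :: complex_hilbert"
  defines csubspace = complex_vector.subspace
    and cspan = complex_vector.span
  by unfold_locales
    (simp_all add: scaleC_add_right scaleC_add_left scaleC_scaleC scaleC_one)

definition finite_dim :: "'a :: complex_hilbert set \<Rightarrow> bool" where
  "finite_dim M \<longleftrightarrow> (\<exists>B. finite B \<and> cspan B = M)"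

definition closed_subspace :: "'a :: complex_hilbert set \<Rightarrow> bool" where
  "closed_subspace M \<longleftrightarrow> csubspace M \<and> closed M"

definition orthogonal_sets :: "'a :: complex_hilbert set \<Rightarrow> 'a set \<Rightarrow> bool" where
  "orthogonal_sets M N \<longleftrightarrow> (\<forall>x\<in>M. \<forall>y\<in>N. cinner x y = 0)"

definition proj :: "'a :: complex_hilbert set \<Rightarrow> 'a \<Rightarrow> 'a" where
  "proj M x = (THE y. y \<in> M \<and> (\<forall>z\<in>M. cinner (x - y) z = 0))"

section \<open>Operators between closed subspaces\<close>

(* An operator from a subspace M to a subspace N is a function on the whole space of which
   only the values on M matter.  Operators on the whole space are the case M = N = UNIV. *)

definition bounded_op :: "'a :: complex_hilbert set \<Rightarrow> 'a set \<Rightarrow> ('a \<Rightarrow> 'a) \<Rightarrow> bool" where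
  "bounded_op M N A \<longleftrightarrow>
     (\<forall>x\<in>M. A x \<in> N) \<and>
     (\<forall>x\<in>M. \<forall>y\<in>M. A (x + y) = A x + A y) \<and>
     (\<forall>c. \<forall>x\<in>M. A (c *\<^sub>C x) = c *\<^sub>C A x) \<and>
     (\<exists>K. \<forall>x\<in>M. norm (A x) \<le> K * norm x)"

(* The adjoint of an operator A from M to N, as an operator from N to M: it depends on A only
   through the values on M, and the codomain N need not be mentioned. *)
definition adj :: "'a :: complex_hilbert set \<Rightarrow> ('a \<Rightarrow> 'a) \<Rightarrow> 'a \<Rightarrow> 'a" where
  "adj M A y = (THE z. z \<in> M \<and> (\<forall>x\<in>M. cinner (A x) y = cinner x z))"

definition isometry_on :: "'a :: complex_hilbert set \<Rightarrow> ('a \<Rightarrow> 'a) \<Rightarrow> bool" where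
  "isometry_on M V \<longleftrightarrow> bounded_op M M V \<and> (\<forall>x\<in>M. norm (V x) = norm x)"

definition co_isometry_on :: "'a :: complex_hilbert set \<Rightarrow> ('a \<Rightarrow> 'a) \<Rightarrow> bool" where
  "co_isometry_on M V \<longleftrightarrow> bounded_op M M V \<and> isometry_on M (adj M V)"

definition unitary_on :: "'a :: complex_hilbert set \<Rightarrow> ('a \<Rightarrow> 'a) \<Rightarrow> bool" where
  "unitary_on M U \<longleftrightarrow>
     bounded_op M M U \<and> (\<forall>x\<in>M. adj M U (U x) = x) \<and> (\<forall>x\<in>M. U (adj M U x) = x)"

(* On a complex space a positive quadratic form forces self-adjointness. *)
definition positive_on :: "'a :: complex_hilbert set \<Rightarrow> ('a \<Rightarrow> 'a) \<Rightarrow> bool" where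
  "positive_on M A \<longleftrightarrow>
     bounded_op M M A \<and> (\<forall>x\<in>M. cinner (A x) x \<in> \<real> \<and> 0 \<le> Re (cinner (A x) x))"

definition op_le_on :: "'a :: complex_hilbert set \<Rightarrow> ('a \<Rightarrow> 'a) \<Rightarrow> ('a \<Rightarrow> 'a) \<Rightarrow> bool" where
  "op_le_on M A B \<longleftrightarrow> positive_on M (\<lambda>x. B x - A x)"

definition null_space :: "('a :: complex_hilbert \<Rightarrow> 'a) \<Rightarrow> 'a set" where
  "null_space S = {x. S x = 0}"

definition sqrt_op :: "('a :: complex_hilbert \<Rightarrow> 'a) \<Rightarrow> 'a \<Rightarrow> 'a" where
  "sqrt_op P = (THE R. positive_on UNIV R \<and> R \<circ> R = P)"

definition abs_op :: "('a :: complex_hilbert \<Rightarrow> 'a) \<Rightarrow> 'a \<Rightarrow> 'a" where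
  "abs_op S = sqrt_op (adj UNIV S \<circ> S)"

definition min_modulus :: "('a :: complex_hilbert \<Rightarrow> 'a) \<Rightarrow> real" where
  "min_modulus S = (INF x\<in>{x. norm x = 1}. norm (S x))"

definition hyponormal :: "('a :: complex_hilbert \<Rightarrow> 'a) \<Rightarrow> bool" where
  "hyponormal S \<longleftrightarrow> positive_on UNIV (\<lambda>x. adj UNIV S (S x) - S (adj UNIV S x))"

definition spectrum :: "('a :: complex_hilbert \<Rightarrow> 'a) \<Rightarrow> complex set" where
  "spectrum S = {l. \<not> (\<exists>R. bounded_op UNIV UNIV R \<and>
     (\<forall>x. R (S x - l *\<^sub>C x) = x) \<and> (\<forall>x. S (R x) - l *\<^sub>C R x = x))}"

definition fredholm :: "('a :: complex_hilbert \<Rightarrow> 'a) \<Rightarrow> bool" where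
  "fredholm S \<longleftrightarrow>
     closed (range S) \<and> finite_dim (null_space S) \<and> finite_dim (null_space (adj UNIV S))"

definition ess_spectrum :: "('a :: complex_hilbert \<Rightarrow> 'a) \<Rightarrow> complex set" where
  "ess_spectrum S = {l. \<not> fredholm (\<lambda>x. S x - l *\<^sub>C x)}"

definition eigenspace :: "('a :: complex_hilbert \<Rightarrow> 'a) \<Rightarrow> real \<Rightarrow> 'a set" where
  "eigenspace S r = null_space (\<lambda>x. S x - r *\<^sub>R x)"

section \<open>Absolutely norm attaining operators\<close>

definition norm_attaining_on :: "'a :: complex_hilbert set \<Rightarrow> ('a \<Rightarrow> 'a) \<Rightarrow> bool" where
  "norm_attaining_on M A \<longleftrightarrow>
     (\<exists>x\<in>M. norm x = 1 \<and> norm (A x) = (SUP y\<in>{y\<in>M. norm y = 1}. norm (A y)))"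

(* Library bounded linear functions are only real linear; complex linearity is what
   bounded_op adds.  The norm, and hence the topology, is the usual operator norm. *)
definition AN :: "('a :: complex_hilbert \<Rightarrow>\<^sub>L 'a) set" where
  "AN = {T. bounded_op UNIV UNIV (blinfun_apply T) \<and>
     (\<forall>M. closed_subspace M \<and> M \<noteq> {0} \<longrightarrow> norm_attaining_on M (blinfun_apply T))}"

section \<open>Orthogonal direct sums\<close>

definition orth_decomp3 :: "'a :: complex_hilbert set \<Rightarrow> 'a set \<Rightarrow> 'a set \<Rightarrow> bool" where
  "orth_decomp3 M0 M1 M2 \<longleftrightarrow>
     closed_subspace M0 \<and> closed_subspace M1 \<and> closed_subspace M2 \<and>
     orthogonal_sets M0 M1 \<and> orthogonal_sets M0 M2 \<and> orthogonal_sets M1 M2 \<and>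
     (\<forall>x. \<exists>x0\<in>M0. \<exists>x1\<in>M1. \<exists>x2\<in>M2. x = x0 + x1 + x2)"

(* M is the Hilbert space direct sum of the E i; it is {0} if I is empty. *)
definition orth_direct_sum :: "'i set \<Rightarrow> ('i \<Rightarrow> 'a :: complex_hilbert set) \<Rightarrow> 'a set \<Rightarrow> bool" where
  "orth_direct_sum I E M \<longleftrightarrow>
     (\<forall>i\<in>I. closed_subspace (E i)) \<and>
     (\<forall>i\<in>I. \<forall>j\<in>I. i \<noteq> j \<longrightarrow> orthogonal_sets (E i) (E j)) \<and>
     M = closure (cspan (\<Union>i\<in>I. E i))"

(* The direct sum of operators A i on E i.  For mutually orthogonal closed E i and uniformly
   bounded A i the series converges unconditionally. *)
definition direct_sum_op ::
    "'i set \<Rightarrow> ('i \<Rightarrow> 'a :: complex_hilbert set) \<Rightarrow> ('i \<Rightarrow> 'a \<Rightarrow> 'a) \<Rightarrow> 'a \<Rightarrow> 'a" where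
  "direct_sum_op I E A x = (\<Sum>\<^sub>\<infinity>i\<in>I. A i (proj (E i) x))"

(* The indices 1, ..., n; all positive naturals if n is infinite, none if n = 0. *)
definition indices :: "enat \<Rightarrow> nat set" where
  "indices n = {i. 1 \<le> i \<and> enat i \<le> n}"

(* The set L consists of the distinct real numbers a 1, ..., a n, where n may be infinite. *)
definition enumerates :: "enat \<Rightarrow> (nat \<Rightarrow> real) \<Rightarrow> complex set \<Rightarrow> bool" where
  "enumerates n a L \<longleftrightarrow> inj_on a (indices n) \<and> (\<lambda>i. complex_of_real (a i)) ` indices n = L"

end

theory Submission
  imports Defs
begin

text \<open>
  If \<open>T\<close> is a limit of absolutely norm attaining operators, then up to finite codimension
  \<open>norm (T x)\<close> is arbitrarily close to \<open>\<alpha> * norm x\<close> for a single \<open>\<alpha>\<close>; otherwise two essential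
  values of \<open>norm (T x)\<close> could be mixed to a closed subspace on which the norm is not attained.
  Hyponormality, \<open>T\<^sup>* T \<le> T T\<^sup>*\<close>, carries this over to \<open>T\<^sup>*\<close>, so \<open>P = T T\<^sup>*\<close> and \<open>|T\<^sup>*|\<close> are compact
  perturbations of \<open>\<alpha>\<^sup>2\<close> and \<open>\<alpha>\<close>, hence diagonalizable, and \<open>H0\<close>, \<open>H1\<close>, \<open>H2\<close> are the
  spectral subspaces of \<open>|T\<^sup>*|\<close> above, at and below \<open>\<alpha>\<close>.

  Going down from the top, \<open>T\<^sup>* T \<le> P\<close> places the eigenspace of \<open>T\<^sup>* T\<close> for the largest eigenvalue
  inside that of \<open>P\<close>, and both have the same finite dimension because \<open>T\<^sup>*\<close> maps the second
  injectively into the first. So the eigenspaces above \<open>\<alpha>\<close> reduce \<open>T\<close>, on the complement \<open>P\<close> is at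
  most \<open>\<alpha>\<^sup>2\<close>, and there the same comparison shows that \<open>H1\<close> is invariant under \<open>T\<^sup>*\<close>, on which
  \<open>norm (T\<^sup>* x) = \<alpha> * norm x\<close>. The remaining relations are read off the blocks of \<open>T T\<^sup>*\<close>.
\<close>

text \<open>What forces a triangular rather than diagonal form is that the dimension count stops at
  \<alpha>. The eigenspace of \<open>P\<close> for the square of \<alpha> may be infinite
  dimensional, and there \<open>T\<^sup>*\<close> may be \<alpha> times a unilateral shift:
  injective, but not onto. So only invariance of \<open>H1\<close> under the adjoint survives, not
  invariance under \<open>T\<close>; this is where the co-isometry \<open>S1\<close> and the corner
  \<open>A1\<close> come from. Below \<alpha> no agreement of eigenspaces is obtained.

  Compactness is expressed without weak convergence: an operator is small on the orthogonal
  complement of a finite set. Arguments therefore consist in choosing finitely many vectors to be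
  orthogonal to, usually some \<open>C\<close> together with its image under an operator, so that
  both a vector and its image are controlled. Closed range, Fredholmness, eigenvectors and inverses
  all rest on one fact: an injective operator that is bounded below up to finite codimension is
  bounded below.\<close>

section \<open>Complex inner products\<close>

lemma cinner_scaleR_left: "cinner (r *\<^sub>R x) y = complex_of_real r * cinner x y"
  by (metis scaleC_of_real cinner_scaleC_left)

lemma cinner_zero_left [simp]: "cinner 0 y = 0"
  using cinner_scaleR_left[of 0 0 y] by simp

lemma cinner_minus_left: "cinner (- x) y = - cinner x y"
  using cinner_scaleR_left[of "-1" x y] by simp

lemma cinner_diff_left: "cinner (x - y) z = cinner x z - cinner y z"
  using cinner_add_left[of x "- y" z] by (simp add: cinner_minus_left)

lemma cinner_add_right: "cinner x (y + z) = cinner x y + cinner x z"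
  by (metis cinner_add_left cinner_commute complex_cnj_add)

lemma cinner_scaleC_right: "cinner x (c *\<^sub>C y) = cnj c * cinner x y"
  by (metis cinner_scaleC_left cinner_commute complex_cnj_mult)

lemma cinner_scaleR_right: "cinner x (r *\<^sub>R y) = complex_of_real r * cinner x y"
  by (metis scaleC_of_real cinner_scaleC_right complex_cnj_complex_of_real)

lemma cinner_zero_right [simp]: "cinner x 0 = 0"
  using cinner_scaleR_right[of x 0 0] by simp

lemma cinner_minus_right: "cinner x (- y) = - cinner x y"
  using cinner_scaleR_right[of x "-1" y] by simp

lemma cinner_diff_right: "cinner x (y - z) = cinner x y - cinner x z"
  using cinner_add_right[of x y "- z"] by (simp add: cinner_minus_right)

lemma cinner_sum_left: "cinner (\<Sum>i\<in>I. f i) y = (\<Sum>i\<in>I. cinner (f i) y)"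
  by (induction I rule: infinite_finite_induct) (simp_all add: cinner_add_left)

lemma cinner_sum_right: "cinner x (\<Sum>i\<in>I. f i) = (\<Sum>i\<in>I. cinner x (f i))"
  by (induction I rule: infinite_finite_induct) (simp_all add: cinner_add_right)

lemmas cinner_simps = cinner_add_left cinner_add_right cinner_diff_left cinner_diff_right
  cinner_scaleC_left cinner_scaleC_right cinner_scaleR_left cinner_scaleR_right
  cinner_minus_left cinner_minus_right

lemma Re_cinner_self: "Re (cinner x x) = (norm x)\<^sup>2"
  by (simp add: cinner_self)

lemma cinner_self_eq_0 [simp]: "cinner x x = 0 \<longleftrightarrow> x = 0"
  by (simp add: cinner_self)

lemma Re_cinner_commute: "Re (cinner x y) = Re (cinner y x)"
  by (metis cinner_commute complex_cnj(1) complex.sel(1) complex_surj)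

lemma cinner_eq_0_commute: "cinner x y = 0 \<longleftrightarrow> cinner y x = 0"
  by (metis cinner_commute complex_cnj_zero)

lemma cinner_ext_right: "(\<And>z. cinner z x = cinner z y) \<Longrightarrow> x = y"
  by (metis cinner_diff_right cinner_self_eq_0 eq_iff_diff_eq_0)

lemma norm_add_squared: "(norm (x + y))\<^sup>2 = (norm x)\<^sup>2 + (norm y)\<^sup>2 + 2 * Re
    (cinner x y)"
  using Re_cinner_commute[of x y] by (simp add: Re_cinner_self[symmetric] cinner_simps)

lemma norm_diff_squared: "(norm (x - y))\<^sup>2 = (norm x)\<^sup>2 + (norm y)\<^sup>2 - 2 * Re
    (cinner x y)"
  using Re_cinner_commute[of x y] by (simp add: Re_cinner_self[symmetric] cinner_simps)

lemma norm_parallelogram: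
  fixes x y :: "'a :: complex_hilbert"
  shows "(norm (x + y))\<^sup>2 + (norm (x - y))\<^sup>2 = 2 * (norm x)\<^sup>2 + 2 * (norm
      y)\<^sup>2"
  by (simp add: norm_add_squared norm_diff_squared)

lemma norm_add_orthogonal: "cinner x y = 0 \<Longrightarrow> (norm (x + y))\<^sup>2 = (norm
    x)\<^sup>2 + (norm y)\<^sup>2"
  by (simp add: norm_add_squared)

lemma norm_scaleC: "norm (c *\<^sub>C x) = cmod c * norm x"
proof -
  have "cinner (c *\<^sub>C x) (c *\<^sub>C x) = complex_of_real ((cmod c * norm x)\<^sup>2)"
    unfolding power_mult_distrib of_real_mult complex_norm_square
    by (subst cinner_scaleC_left, subst cinner_scaleC_right, subst cinner_self) (simp only:
        mult.assoc)
  then have "(norm (c *\<^sub>C x))\<^sup>2 = (cmod c * norm x)\<^sup>2"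
    unfolding cinner_self of_real_eq_iff .
  then show ?thesis
    by (metis norm_ge_zero power2_eq_iff_nonneg mult_nonneg_nonneg)
qed

lemma norm_sum_orthogonal:
  assumes "finite I" and "\<And>i j. i \<in> I \<Longrightarrow> j \<in> I
      \<Longrightarrow> i \<noteq> j \<Longrightarrow> cinner (f i) (f j) = 0"
  shows "(norm (\<Sum>i\<in>I. f i))\<^sup>2 = (\<Sum>i\<in>I. (norm (f i))\<^sup>2)"
  using assms
proof (induction I)
  case (insert i I)
  have "cinner (f i) (\<Sum>j\<in>I. f j) = 0"
    using insert by (auto simp: cinner_sum_right intro!: sum.neutral)
  then show ?case
    using insert by (simp add: norm_add_orthogonal)
qed simp

lemmas csubspace_0 = complex_vector.subspace_0
lemmas csubspace_add = complex_vector.subspace_add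
lemmas csubspace_scale = complex_vector.subspace_scale

section \<open>Bounded complex linear operators\<close>

lemma bounded_op_UNIV_iff:
  "bounded_op UNIV UNIV A \<longleftrightarrow>
    (\<forall>x y. A (x + y) = A x + A y) \<and> (\<forall>c x. A (c *\<^sub>C x) = c *\<^sub>C A
        x) \<and>
    (\<exists>K. \<forall>x. norm (A x) \<le> K * norm x)"
  by (simp add: bounded_op_def)

lemma bounded_op_linear: "bounded_op UNIV UNIV A \<Longrightarrow> Vector_Spaces.linear scaleC
    scaleC A"
  by (simp add: Vector_Spaces.linear_iff bounded_op_UNIV_iff complex_vector.vector_space_axioms)

context
  fixes A :: "'a :: complex_hilbert \<Rightarrow> 'a"
  assumes A: "bounded_op UNIV UNIV A"
begin

lemma bounded_op_add: "A (x + y) = A x + A y"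
  and bounded_op_scaleC: "A (c *\<^sub>C x) = c *\<^sub>C A x"
  using A by (simp_all add: bounded_op_UNIV_iff)

lemma bounded_op_scaleR: "A (r *\<^sub>R x) = r *\<^sub>R A x"
  using bounded_op_scaleC[of "complex_of_real r"] by (simp add: scaleC_of_real)

lemma bounded_op_bounded_linear: "bounded_linear A"
proof -
  obtain K where "\<forall>x. norm (A x) \<le> K * norm x"
    using A by (auto simp: bounded_op_UNIV_iff)
  then show ?thesis
    by (intro bounded_linear_intro[of A K])
       (simp_all add: bounded_op_add bounded_op_scaleR mult.commute)
qed

lemma bounded_op_zero: "A 0 = 0"
  and bounded_op_diff: "A (x - y) = A x - A y"
  and bounded_op_sum: "A (\<Sum>i\<in>I. f i) = (\<Sum>i\<in>I. A (f i))"
  using bounded_op_bounded_linear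
  by (simp_all add: linear_0 linear_diff linear_sum bounded_linear.linear)

end

lemma bounded_op_blinfunI:
  assumes "\<And>c x. blinfun_apply A (c *\<^sub>C x) = c *\<^sub>C A x"
  shows "bounded_op UNIV UNIV (blinfun_apply A)"
  using assms norm_blinfun[of A] by (auto simp: bounded_op_UNIV_iff blinfun.add_right)

lemma scaleC_diff_right: "c *\<^sub>C (x - y) = c *\<^sub>C x - c *\<^sub>C y"
  by (rule complex_vector.scale_right_diff_distrib)

lemma scaleC_scaleR_commute: "c *\<^sub>C r *\<^sub>R x = r *\<^sub>R c *\<^sub>C x"
  by (metis scaleC_of_real scaleC_scaleC mult.commute)

lemma bounded_op_scaleC_self: "bounded_op UNIV UNIV (\<lambda>x. c *\<^sub>C x)"
  by (auto simp: bounded_op_UNIV_iff scaleC_add_right scaleC_scaleC norm_scaleC mult.commute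
      intro!: exI[of _ "cmod c"])

lemma bounded_op_diff_scaleC:
  assumes "bounded_op UNIV UNIV A"
  shows "bounded_op UNIV UNIV (\<lambda>x. A x - c *\<^sub>C x)"
proof -
  obtain K where K: "\<And>x. norm (A x) \<le> K * norm x"
    using assms by (auto simp: bounded_op_UNIV_iff)
  have "norm (A x - c *\<^sub>C x) \<le> (K + cmod c) * norm x" for x
    using norm_triangle_ineq4[of "A x" "c *\<^sub>C x"] K[of x]
        by (simp add: norm_scaleC algebra_simps)
  then have "\<exists>K. \<forall>x. norm (A x - c *\<^sub>C x) \<le> K * norm x"
    by blast
  then show ?thesis
    using assms
    by (simp add: bounded_op_UNIV_iff scaleC_add_right scaleC_diff_right scaleC_scaleC mult.commute)
qed

lemma bounded_op_diff_scaleR: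
  "bounded_op UNIV UNIV A \<Longrightarrow> bounded_op UNIV UNIV (\<lambda>x. A x - r *\<^sub>R x)"
  using bounded_op_diff_scaleC[of A "complex_of_real r"] by (simp add: scaleC_of_real)

lemma bounded_op_compose:
  assumes "bounded_op UNIV UNIV A" "bounded_op UNIV UNIV B"
  shows "bounded_op UNIV UNIV (\<lambda>x. A (B x))"
proof -
  have "bounded_linear (\<lambda>x. A (B x))"
    by (intro bounded_linear_compose[of A B] bounded_op_bounded_linear assms)
  then have "\<exists>K. \<forall>x. norm (A (B x)) \<le> K * norm x"
    using bounded_linear.bounded by (simp add: mult.commute[of _ "norm _"])
  then show ?thesis
    by (simp add: bounded_op_UNIV_iff bounded_op_add[OF assms(1)] bounded_op_add[OF assms(2)]
        bounded_op_scaleC[OF assms(1)] bounded_op_scaleC[OF assms(2)])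
qed

lemma bounded_op_scaleR_fun:
  assumes "bounded_op UNIV UNIV A"
  shows "bounded_op UNIV UNIV (\<lambda>x. r *\<^sub>R A x)"
proof -
  obtain K where K: "\<And>x. norm (A x) \<le> K * norm x"
    using assms by (auto simp: bounded_op_UNIV_iff)
  have "norm (r *\<^sub>R A x) \<le> (\<bar>r\<bar> * K) * norm x" for x
    using mult_left_mono[OF K[of x], of "\<bar>r\<bar>"] by (simp add: mult.assoc)
  then show ?thesis
    using assms by (auto simp: bounded_op_UNIV_iff scaleR_add_right scaleC_scaleR_commute)
qed

section \<open>Self-adjoint operators and the Cauchy-Schwarz inequality for positive forms\<close>

definition selfadjoint :: "('a :: complex_hilbert \<Rightarrow> 'a) \<Rightarrow> bool" where
  "selfadjoint A \<longleftrightarrow> bounded_op UNIV UNIV A \<and> (\<forall>x y. cinner (A x) y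
      = cinner x (A y))"

lemma selfadjoint_bounded_op: "selfadjoint A \<Longrightarrow> bounded_op UNIV UNIV A"
  and selfadjoint_cinner: "selfadjoint A \<Longrightarrow> cinner (A x) y = cinner x (A y)"
  by (simp_all add: selfadjoint_def)

lemma selfadjoint_diff_scaleR: "selfadjoint A \<Longrightarrow> selfadjoint (\<lambda>x. A x - r
    *\<^sub>R x)"
  by (auto simp: selfadjoint_def bounded_op_diff_scaleR cinner_simps)

lemma selfadjoint_scaleR: "selfadjoint A \<Longrightarrow> selfadjoint (\<lambda>x. r *\<^sub>R A
    x)"
  by (auto simp: selfadjoint_def bounded_op_scaleR_fun cinner_simps)

lemma selfadjoint_id: "selfadjoint (\<lambda>x. x)"
  by (auto simp: selfadjoint_def bounded_op_UNIV_iff intro: exI[of _ 1])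

text \<open>Positivity is relative to a subspace \<open>M\<close> that \<open>G\<close> may leave:
  in the applications \<open>G\<close> is a bound minus an operator, and the bound holds only on
  \<open>M\<close>. The discriminant argument is run over real \<open>t\<close>, after turning
  \<open>y\<close> by the phase of \<open>b\<close>.\<close>

lemma cauchy_schwarz_form:
  assumes G: "selfadjoint G" and M: "csubspace M"
    and pos: "\<And>w. w \<in> M \<Longrightarrow> 0 \<le> Re (cinner (G w) w)" and x: "x \<in> M"
        and y: "y \<in> M"
  shows "(cmod (cinner (G x) y))\<^sup>2 \<le> Re (cinner (G x) x) * Re (cinner (G y) y)"
proof -
  note G' = selfadjoint_bounded_op[OF G]
  define b where "b = cinner (G x) y"
  define p where "p = Re (cinner (G x) x)"
  define q where "q = Re (cinner (G y) y)"
  define m where "m = (cmod b)\<^sup>2"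
  have quad: "0 \<le> p + 2 * t * m + t\<^sup>2 * m * q" for t
  proof -
    \<comment> \<open>The factor \<open>b\<close> makes both cross terms equal to the real number
      \<open>t * m\<close>.\<close>
    define c where "c = complex_of_real t * b"
    have b': "cinner (G y) x = cnj b"
      by (metis G b_def cinner_commute selfadjoint_cinner)
    have bb: "b * cnj b = complex_of_real m"
      unfolding m_def complex_norm_square ..
    have "cnj c * b = complex_of_real t * (b * cnj b)" "c * cnj b = complex_of_real t * (b * cnj b)"
      "c * cnj c = complex_of_real t * complex_of_real t * (b * cnj b)"
      by (simp_all add: c_def)
    then have c1: "cnj c * b = complex_of_real (t * m)" and c2: "c * cnj b = complex_of_real (t *
        m)"
      and c3: "c * cnj c = complex_of_real (t\<^sup>2 * m)"
      by (simp_all only: bb of_real_mult power2_eq_square)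
    have "0 \<le> Re (cinner (G (x + c *\<^sub>C y)) (x + c *\<^sub>C y))"
      by (intro pos csubspace_add[OF M] csubspace_scale[OF M] x y)
    also have "\<dots> = p + Re (cnj c * b) + Re (c * cnj b) + Re (c * cnj c * cinner (G y) y)"
      by (simp add: bounded_op_add[OF G'] bounded_op_scaleC[OF G'] cinner_simps b' b_def p_def
          algebra_simps)
    also have "\<dots> = p + 2 * t * m + t\<^sup>2 * m * q"
      by (simp add: c1 c2 c3 q_def)
    finally show ?thesis .
  qed
  have "m \<le> p * q"
  proof (cases "m = 0")
    case True
    then show ?thesis
      using pos[OF x] pos[OF y] by (simp add: p_def q_def)
  next
    case False
    then have m: "m > 0"
      by (simp add: m_def)
    have "q \<ge> 0"
      using pos[OF y] by (simp add: q_def)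
    show ?thesis
    proof (cases "q = 0")
      case True
      \<comment> \<open>For \<open>q = 0\<close> the quadratic is affine in \<open>t\<close>; this
        \<open>t\<close> gives it the value -1.\<close>
      have "0 \<le> p + 2 * (- (p + 1) / (2 * m)) * m"
        using quad[of "- (p + 1) / (2 * m)"] True by simp
      with m show ?thesis
        by (simp add: field_simps)
    next
      case False
      with \<open>q \<ge> 0\<close> have q: "q > 0" by simp
      \<comment> \<open>\<open>- 1 / q\<close> is the minimiser of the quadratic.\<close>
      have "p + 2 * (- 1 / q) * m + (- 1 / q)\<^sup>2 * m * q = p - m / q"
        using q by (simp add: field_simps power2_eq_square)
      with quad[of "- 1 / q"] have "m / q \<le> p"
        by simp
      with q show ?thesis
        by (simp add: field_simps)
    qed
  qed
  then show ?thesis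
    by (simp add: m_def b_def p_def q_def)
qed

lemma cinner_cauchy_schwarz: "cmod (cinner x y) \<le> norm x * norm y"
proof -
  have "(cmod (cinner x y))\<^sup>2 \<le> (norm x * norm y)\<^sup>2"
    using cauchy_schwarz_form[OF selfadjoint_id complex_vector.subspace_UNIV, of x y]
    by (simp add: Re_cinner_self power_mult_distrib)
  then show ?thesis
    by (rule power2_le_imp_le) simp
qed

interpretation cinner: bounded_bilinear "cinner :: 'a :: complex_hilbert \<Rightarrow> 'a
    \<Rightarrow> complex"
proof
  show "\<exists>K. \<forall>a b :: 'a. norm (cinner a b) \<le> norm a * norm b * K"
    by (intro exI[of _ 1]) (simp add: cinner_cauchy_schwarz)
qed (simp_all add: cinner_simps scaleR_conv_of_real)

section \<open>Closed subspaces and orthogonal projections\<close>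

definition orthogonal_complement :: "'a :: complex_hilbert set \<Rightarrow> 'a set" where
  "orthogonal_complement B = {x. \<forall>b\<in>B. cinner x b = 0}"

lemma orthogonal_complementI: "(\<And>b. b \<in> B
    \<Longrightarrow> cinner x b = 0) \<Longrightarrow> x \<in> orthogonal_complement B"
  and orthogonal_complementD: "x \<in> orthogonal_complement B
      \<Longrightarrow> b \<in> B \<Longrightarrow> cinner x b = 0"
  by (simp_all add: orthogonal_complement_def)

lemma orthogonal_complement_Un:
  "orthogonal_complement (A \<union> B) = orthogonal_complement A \<inter> orthogonal_complement B"
  by (auto simp: orthogonal_complement_def)

lemma closed_subspace_orthogonal_complement: "closed_subspace (orthogonal_complement B)"
proof -
  have "orthogonal_complement B = (\<Inter>b\<in>B. {x. cinner x b = 0})"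
    by (auto simp: orthogonal_complement_def)
  moreover have "closed {x. cinner x b = 0}" for b :: 'a
    by (intro closed_Collect_eq continuous_on_const cinner.continuous_on continuous_on_id)
  ultimately have "closed (orthogonal_complement B)"
    by auto
  then show ?thesis
    by (auto simp: closed_subspace_def orthogonal_complement_def complex_vector.subspace_def
        cinner_simps)
qed

lemma closed_subspace_csubspace: "closed_subspace M \<Longrightarrow> csubspace M"
  and closed_subspace_closed: "closed_subspace M \<Longrightarrow> closed M"
  by (simp_all add: closed_subspace_def)

lemma closed_subspace_UNIV: "closed_subspace UNIV"
  by (simp add: closed_subspace_def)

lemma closed_subspace_Int:
  "closed_subspace M \<Longrightarrow> closed_subspace N
      \<Longrightarrow> closed_subspace (M \<inter> N)"
  by (auto simp: closed_subspace_def complex_vector.subspace_inter)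

lemma closed_subspace_closure_cspan: "closed_subspace (closure (cspan B))"
proof -
  have add: "x + y \<in> closure (cspan B)" if "x \<in> closure (cspan B)" "y \<in> closure (cspan
      B)" for x y
  proof -
    from that obtain f g where "\<And>n. f n \<in> cspan B" "f \<longlonglongrightarrow> x"
        "\<And>n. g n \<in> cspan B" "g \<longlonglongrightarrow> y"
      by (auto simp: closure_sequential)
    then show ?thesis
      by (auto simp: closure_sequential intro!: exI[of _ "\<lambda>n. f n + g n"] tendsto_add
          complex_vector.span_add)
  qed
  have scale: "c *\<^sub>C x \<in> closure (cspan B)" if x: "x \<in> closure (cspan B)" for c x
  proof -
    from x obtain f where f: "\<And>n. f n \<in> cspan B" "f \<longlonglongrightarrow> x"
      by (auto simp: closure_sequential)
    from bounded_linear.tendsto[OF bounded_op_bounded_linear[OF bounded_op_scaleC_self[of c]] f(2)]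
    show ?thesis
      using f(1) by (auto simp: closure_sequential intro!: exI[of _ "\<lambda>n. c *\<^sub>C f n"]
          complex_vector.span_scale)
  qed
  show ?thesis
    using add scale closure_subset[of "cspan B"] complex_vector.span_zero[of B]
    by (auto simp: closed_subspace_def complex_vector.subspace_def)
qed

lemma closure_cspan_superset: "B \<subseteq> closure (cspan B)"
  using closure_subset complex_vector.span_superset by blast

lemma closure_cspan_minimal: "closed_subspace M \<Longrightarrow> B \<subseteq> M
    \<Longrightarrow> closure (cspan B) \<subseteq> M"
  by (metis closed_subspace_def closure_minimal complex_vector.span_minimal)

lemma cinner_closure_cspan_right:
  assumes "\<And>b. b \<in> B \<Longrightarrow> cinner x b = 0" "y \<in> closure (cspan B)"
  shows "cinner x y = 0"
proof -
  have "B \<subseteq> orthogonal_complement {x}"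
    using assms(1) by (auto simp: orthogonal_complement_def cinner_eq_0_commute)
  from closure_cspan_minimal[OF closed_subspace_orthogonal_complement this] assms(2)
  show ?thesis
    by (auto simp: orthogonal_complement_def cinner_eq_0_commute)
qed

lemma csubspace_diff: "csubspace M \<Longrightarrow> x \<in> M
    \<Longrightarrow> y \<in> M \<Longrightarrow> x - y \<in> M"
  by (rule complex_vector.subspace_diff)

lemma csubspace_scaleR: "csubspace M \<Longrightarrow> x \<in> M
    \<Longrightarrow> r *\<^sub>R x \<in> M"
  by (metis csubspace_scale scaleC_of_real)

lemma csubspace_sum: "csubspace M \<Longrightarrow> (\<And>i. i \<in> I
    \<Longrightarrow> f i \<in> M) \<Longrightarrow> (\<Sum>i\<in>I. f i) \<in> M"
  by (rule complex_vector.subspace_sum)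

text \<open>A minimising sequence for the distance to \<open>M\<close> is Cauchy: midpoints stay in
  \<open>M\<close>, so the parallelogram law bounds the mutual distances by the excess over the
  minimum.\<close>

lemma projection_exists:
  assumes M: "closed_subspace M"
  shows "\<exists>y\<in>M. \<forall>z\<in>M. cinner (x - y) z = 0"
proof -
  note sub = closed_subspace_csubspace[OF M]
  define d where "d = (INF y\<in>M. (norm (x - y))\<^sup>2)"
  have bdd: "bdd_below ((\<lambda>y. (norm (x - y))\<^sup>2) ` M)"
    by (rule bdd_belowI2[of _ 0]) simp
  have ne: "M \<noteq> {}"
    using csubspace_0[OF sub] by auto
  have d_le: "d \<le> (norm (x - y))\<^sup>2" if "y \<in> M" for y
    unfolding d_def by (intro cINF_lower bdd that)
  have "\<exists>y\<in>M. (norm (x - y))\<^sup>2 < d + 1 / real (Suc n)" for n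
    using cINF_less_iff[OF ne bdd, of "d + 1 / real (Suc n)"] by (simp add: d_def)
  then obtain f where f: "\<And>n. f n \<in> M" "\<And>n. (norm (x - f n))\<^sup>2 < d + 1 / real
      (Suc n)"
    by metis
  have close: "(norm (f m - f n))\<^sup>2 \<le> 2 * (1 / real (Suc m)) + 2 * (1 / real (Suc n))"
      for m n
  proof -
    have mid: "(1/2) *\<^sub>R (f m + f n) \<in> M"
      by (intro csubspace_scaleR csubspace_add sub f)
    have "(x - f m) + (x - f n) = 2 *\<^sub>R (x - (1/2) *\<^sub>R (f m + f n))"
      by (simp add: algebra_simps scaleR_2)
    then have "(norm ((x - f m) + (x - f n)))\<^sup>2 = 4 * (norm (x - (1/2) *\<^sub>R (f m + f
        n)))\<^sup>2"
      by (simp add: power_mult_distrib)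
    also have "\<dots> \<ge> 4 * d"
      using d_le[OF mid] by simp
    finally have "4 * d \<le> (norm ((x - f m) + (x - f n)))\<^sup>2" .
    moreover have "norm ((x - f m) - (x - f n)) = norm (f m - f n)"
      by (simp add: norm_minus_commute)
    ultimately show ?thesis
      using norm_parallelogram[of "x - f m" "x - f n"] f(2)[of m] f(2)[of n]
      by simp
  qed
  have "Cauchy f"
  proof (rule CauchyI)
    fix e :: real assume e: "0 < e"
    obtain N where N: "4 / e\<^sup>2 < real N"
      using reals_Archimedean2 by blast
    have "norm (f m - f n) < e" if "m \<ge> N" "n \<ge> N" for m n
    proof -
      have inv: "2 * (1 / real (Suc k)) < e\<^sup>2 / 2" if "k \<ge> N" for k
      proof -
        have "4 / e\<^sup>2 < real (Suc k)"
          using N that by linarith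
        then show ?thesis
          using e by (simp add: field_simps)
      qed
      have "(norm (f m - f n))\<^sup>2 < e\<^sup>2"
        using close[of m n] inv[OF that(1)] inv[OF that(2)] by linarith
      then show ?thesis
        using e by (simp add: power2_less_imp_less)
    qed
    then show "\<exists>N. \<forall>m\<ge>N. \<forall>n\<ge>N. norm (f m - f n) < e"
      by blast
  qed
  then obtain y where y: "f \<longlonglongrightarrow> y"
    using Cauchy_convergent convergent_def by blast
  have yM: "y \<in> M"
    using closed_sequentially[OF closed_subspace_closed[OF M]] f(1) y by blast
  have "(\<lambda>n. (norm (x - f n))\<^sup>2) \<longlonglongrightarrow> (norm (x - y))\<^sup>2"
    by (intro tendsto_intros y)
  moreover have "(\<lambda>n. d + 1 / real (Suc n)) \<longlonglongrightarrow> d + 0"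
    by (intro tendsto_intros LIMSEQ_inverse_real_of_nat[unfolded inverse_eq_divide])
  ultimately have yd: "(norm (x - y))\<^sup>2 \<le> d"
    using f(2) by (intro LIMSEQ_le[of "\<lambda>n. (norm (x - f n))\<^sup>2" _ "\<lambda>n. d + 1
        / real (Suc n)"])
      (auto intro: less_imp_le)
  have "cinner (x - y) z = 0" if z: "z \<in> M" for z
  proof (rule ccontr)
    assume nz: "cinner (x - y) z \<noteq> 0"
    then have "z \<noteq> 0" by auto
    define w where "w = x - y"
    define b where "b = cinner w z"
    define s where "s = (norm z)\<^sup>2"
    have s: "s > 0"
      using \<open>z \<noteq> 0\<close> by (simp add: s_def)
    \<comment> \<open>\<open>c\<close> is the coefficient of the component of \<open>w\<close> along
      \<open>z\<close>; removing that component would bring \<open>x\<close> closer to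
      \<open>M\<close> than the minimal distance.\<close>
    define c where "c = b / complex_of_real s"
    have "cmod c ^ 2 * s = (cmod b)\<^sup>2 / s"
      using s by (simp add: c_def norm_divide power_divide field_simps power2_eq_square)
    moreover have "Re (cnj c * b) = (cmod b)\<^sup>2 / s"
    proof -
      have "cnj c * b = (b * cnj b) / complex_of_real s"
        by (simp add: c_def)
      also have "\<dots> = complex_of_real ((cmod b)\<^sup>2 / s)"
        by (simp only: complex_norm_square of_real_divide)
      finally show ?thesis
        by (simp only: Re_complex_of_real)
    qed
    ultimately have "(norm (w - c *\<^sub>C z))\<^sup>2 = (norm w)\<^sup>2 - (cmod b)\<^sup>2 / s"
      by (simp add: norm_diff_squared cinner_scaleC_right norm_scaleC power_mult_distrib
          flip: s_def b_def)
    also have "\<dots> < (norm w)\<^sup>2"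
      using nz s by (simp add: b_def w_def)
    finally have "(norm (x - (y + c *\<^sub>C z)))\<^sup>2 < d"
      using yd by (simp add: w_def algebra_simps)
    moreover have "y + c *\<^sub>C z \<in> M"
      by (intro csubspace_add csubspace_scale sub yM z)
    ultimately show False
      using d_le by fastforce
  qed
  with yM show ?thesis by blast
qed

lemma proj_eqI:
  assumes M: "closed_subspace M" and y: "y \<in> M" "\<And>z. z \<in> M
      \<Longrightarrow> cinner (x - y) z = 0"
  shows "proj M x = y"
  unfolding proj_def
proof (rule the_equality)
  fix y' assume y': "y' \<in> M \<and> (\<forall>z\<in>M. cinner (x - y') z = 0)"
  then have d: "y' - y \<in> M"
    using csubspace_diff closed_subspace_csubspace M y(1) by blast
  have "cinner (y' - y) (y' - y) = cinner (x - y) (y' - y) - cinner (x - y') (y' - y)"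
    by (simp add: cinner_diff_left)
  also have "\<dots> = 0"
    using y(2)[OF d] y' d by auto
  finally show "y' = y" by simp
qed (use y in auto)

lemma proj_in: "closed_subspace M \<Longrightarrow> proj M x \<in> M"
  and cinner_diff_proj: "closed_subspace M \<Longrightarrow> z \<in> M
      \<Longrightarrow> cinner (x - proj M x) z = 0"
  by (metis projection_exists proj_eqI)+

lemma cinner_proj_left: "closed_subspace M \<Longrightarrow> z \<in> M
    \<Longrightarrow> cinner (proj M x) z = cinner x z"
  by (metis cinner_diff_proj cinner_diff_left eq_iff_diff_eq_0)

lemma cinner_proj_right: "closed_subspace M \<Longrightarrow> z \<in> M
    \<Longrightarrow> cinner z (proj M x) = cinner z x"
  by (metis cinner_proj_left cinner_commute)

lemma proj_ident: "closed_subspace M \<Longrightarrow> x \<in> M \<Longrightarrow> proj M x = x"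
  by (rule proj_eqI) auto

lemma proj_orthogonal: "closed_subspace M \<Longrightarrow> x \<in> orthogonal_complement M
    \<Longrightarrow> proj M x = 0"
  by (rule proj_eqI) (auto simp: orthogonal_complementD csubspace_0 closed_subspace_csubspace)

lemma proj_add: "closed_subspace M \<Longrightarrow> proj M (x + y) = proj M x + proj M y"
  by (rule proj_eqI)
     (auto simp: proj_in csubspace_add closed_subspace_csubspace cinner_simps cinner_proj_left)

lemma proj_scaleC: "closed_subspace M \<Longrightarrow> proj M (c *\<^sub>C x) = c *\<^sub>C proj
    M x"
  by (rule proj_eqI)
     (auto simp: proj_in csubspace_scale closed_subspace_csubspace cinner_simps cinner_proj_left)

lemma norm_proj_le: "closed_subspace M \<Longrightarrow> norm (proj M x) \<le> norm x"
proof -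
  assume M: "closed_subspace M"
  have "(norm (proj M x + (x - proj M x)))\<^sup>2 = (norm (proj M x))\<^sup>2 + (norm (x - proj M
      x))\<^sup>2"
    by (intro norm_add_orthogonal) (simp add: M cinner_diff_proj proj_in cinner_eq_0_commute[of
        "proj M x"])
  then have "(norm (proj M x))\<^sup>2 \<le> (norm x)\<^sup>2"
    by simp
  then show ?thesis
    by (rule power2_le_imp_le) simp
qed

lemma bounded_op_proj: "closed_subspace M \<Longrightarrow> bounded_op UNIV UNIV (proj M)"
  by (auto simp: bounded_op_UNIV_iff proj_add proj_scaleC norm_proj_le intro!: exI[of _ 1])

section \<open>Adjoints\<close>

text \<open>The representing vector is a multiple of \<open>u\<close>, the part of some
  \<open>x0\<close> outside the kernel \<open>N\<close> that is orthogonal to \<open>N\<close>. The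
  formula follows because the combination of \<open>u\<close> and \<open>x\<close> with coefficients
  \<open>f x\<close> and \<open>- f u\<close> lies in \<open>N\<close>.\<close>

lemma riesz_representation:
  assumes add: "\<And>x y. f (x + y) = f x + f y" and scale:
      "\<And>c x. f (c *\<^sub>C x) = c * f x"
    and bound: "\<And>x. cmod (f x) \<le> K * norm x"
  shows "\<exists>z :: 'a :: complex_hilbert. \<forall>x. f x = cinner x z"
proof (cases "\<forall>x. f x = 0")
  case True
  then show ?thesis by (intro exI[of _ 0]) simp
next
  case False
  have bl: "bounded_linear f"
    using add bound scale[of "complex_of_real _"]
    by (intro bounded_linear_intro[of f K]) (simp_all add: scaleC_of_real scaleR_conv_of_real
        mult.commute)
  define N where "N = {x. f x = 0}"
  have N: "closed_subspace N"
    unfolding N_def closed_subspace_def complex_vector.subspace_def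
    using add scale linear_0[OF bounded_linear.linear[OF bl]]
    by (auto intro!: closed_Collect_eq bounded_linear.continuous_on[OF bl])
  from False obtain x0 where x0: "f x0 \<noteq> 0" by blast
  define u where "u = x0 - proj N x0"
  have "f (proj N x0) = 0"
    using proj_in[OF N, of x0] by (simp add: N_def)
  then have fu: "f u \<noteq> 0"
    using x0 by (simp add: u_def linear_diff[OF bounded_linear.linear[OF bl]])
  then have "u \<noteq> 0"
    using linear_0[OF bounded_linear.linear[OF bl]] by auto
  then have uu: "cinner u u \<noteq> 0"
    by simp
  have "f x = cinner x (cnj (f u / cinner u u) *\<^sub>C u)" for x
  proof -
    have "f (f x *\<^sub>C u - f u *\<^sub>C x) = 0"
      by (simp add: linear_diff[OF bounded_linear.linear[OF bl]] scale)
    then have "cinner u (f x *\<^sub>C u - f u *\<^sub>C x) = 0"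
      unfolding u_def by (intro cinner_diff_proj[OF N]) (simp add: N_def u_def)
    then have "cinner (f x *\<^sub>C u - f u *\<^sub>C x) u = 0"
      by (simp add: cinner_eq_0_commute)
    then have "f x * cinner u u = f u * cinner x u"
      by (simp add: cinner_simps)
    then show ?thesis
      using uu by (simp add: cinner_simps field_simps)
  qed
  then show ?thesis by blast
qed

lemma adj_eqI:
  assumes "csubspace M" "z \<in> M" "\<And>x. x \<in> M
      \<Longrightarrow> cinner (A x) y = cinner x z"
  shows "adj M A y = z"
  unfolding adj_def
proof (rule the_equality)
  fix z' assume z': "z' \<in> M \<and> (\<forall>x\<in>M. cinner (A x) y = cinner x z')"
  have "z' - z \<in> M"
    using csubspace_diff assms(1,2) z' by blast
  then have "cinner (z' - z) (z' - z) = 0"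
    using z' assms(3) by (simp add: cinner_diff_right)
  then show "z' = z" by simp
qed (use assms in auto)

lemma cinner_adj_right:
  assumes A: "bounded_op UNIV UNIV A"
  shows "cinner x (adj UNIV A y) = cinner (A x) y"
proof -
  obtain K where K: "\<And>x. norm (A x) \<le> K * norm x"
    using A by (auto simp: bounded_op_UNIV_iff)
  have "\<exists>z. \<forall>x. cinner (A x) y = cinner x z"
  proof (rule riesz_representation)
    show "cmod (cinner (A x) y) \<le> (K * norm y) * norm x" for x
      using cinner_cauchy_schwarz[of "A x" y] mult_right_mono[OF K[of x], of "norm y"]
      by (simp add: mult_ac)
  qed (simp_all add: bounded_op_add[OF A] bounded_op_scaleC[OF A] cinner_simps)
  then obtain z where "\<And>x. cinner (A x) y = cinner x z" by blast
  moreover from this have "adj UNIV A y = z"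
    by (intro adj_eqI) simp_all
  ultimately show ?thesis by simp
qed

lemma cinner_adj_left: "bounded_op UNIV UNIV A \<Longrightarrow> cinner (adj UNIV A x) y = cinner
    x (A y)"
  by (metis cinner_adj_right cinner_commute)

lemma norm_adj_le:
  assumes A: "bounded_op UNIV UNIV A" and K: "\<And>x. norm (A x) \<le> K * norm x"
  shows "norm (adj UNIV A y) \<le> K * norm y"
proof (cases "adj UNIV A y = 0")
  case True
  have "0 \<le> K * norm y"
    by (metis K norm_ge_zero order_trans)
  then show ?thesis using True by simp
next
  case False
  define z where "z = adj UNIV A y"
  have "(norm z)\<^sup>2 = cmod (cinner (A z) y)"
    using arg_cong[OF cinner_adj_right[OF A, of z y], of cmod]
    by (simp add: z_def[symmetric] cinner_self del: of_real_power)
  also have "\<dots> \<le> norm (A z) * norm y"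
    by (rule cinner_cauchy_schwarz)
  also have "\<dots> \<le> K * norm z * norm y"
    by (intro mult_right_mono K) simp
  finally show ?thesis
    using False by (simp add: z_def[symmetric] power2_eq_square mult_ac)
qed

lemma bounded_op_adj:
  assumes A: "bounded_op UNIV UNIV A"
  shows "bounded_op UNIV UNIV (adj UNIV A)"
proof -
  obtain K where K: "\<And>x. norm (A x) \<le> K * norm x"
    using A by (auto simp: bounded_op_UNIV_iff)
  have "adj UNIV A (x + y) = adj UNIV A x + adj UNIV A y" for x y
    by (rule cinner_ext_right) (simp add: cinner_adj_right[OF A] cinner_simps)
  moreover have "adj UNIV A (c *\<^sub>C x) = c *\<^sub>C adj UNIV A x" for c x
    by (rule cinner_ext_right) (simp add: cinner_adj_right[OF A] cinner_simps)
  ultimately show ?thesis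
    using norm_adj_le[OF A K] by (auto simp: bounded_op_UNIV_iff)
qed

lemma adj_adj: "bounded_op UNIV UNIV A \<Longrightarrow> adj UNIV (adj UNIV A) = A"
  by (intro ext adj_eqI) (simp_all add: cinner_adj_left)

lemma selfadjoint_adj_compose:
  assumes A: "bounded_op UNIV UNIV A"
  shows "selfadjoint (\<lambda>x. adj UNIV A (A x))" "selfadjoint (\<lambda>x. A (adj UNIV A x))"
  using bounded_op_compose[OF A bounded_op_adj[OF A]] bounded_op_compose[OF bounded_op_adj[OF A] A]
  by (simp_all add: selfadjoint_def cinner_adj_left[OF A] cinner_adj_right[OF A, symmetric])

section \<open>Limits of absolutely norm attaining operators\<close>

text \<open>Recursive choice in which every chosen vector \<open>v\<close> imposes a finite set
  \<open>F v\<close> of orthogonality conditions on all later ones. The state carries the conditions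
  accumulated so far next to the current vector.\<close>

lemma orthogonal_sequence_exists:
  assumes ex: "\<And>n C. finite C \<Longrightarrow> \<exists>v \<in> orthogonal_complement C. R n
      v" and F: "\<And>v. finite (F v)"
  shows "\<exists>v :: nat \<Rightarrow> _. (\<forall>n. R n (v n)) \<and> (\<forall>n.
      \<forall>i<n. v n \<in> orthogonal_complement (F (v i)))"
proof -
  define P where "P n s \<longleftrightarrow> finite (fst s) \<and> snd s \<in>
      orthogonal_complement (fst s) \<and> R n (snd s)"
    for n s
  have "\<exists>s. P 0 s"
    using ex[of "{}" 0] by (auto simp: P_def intro!: exI[of _ "({}, _)"])
  moreover have "\<exists>t. P (Suc n) t \<and> fst t = fst s \<union> F (snd s)" if s: "P n s"
      for n s
  proof -
    obtain v where "v \<in> orthogonal_complement (fst s \<union> F (snd s))" "R (Suc n) v"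
      using ex[of "fst s \<union> F (snd s)" "Suc n"] s F by (auto simp: P_def)
    then show ?thesis
      using s F by (intro exI[of _ "(fst s \<union> F (snd s), v)"]) (auto simp: P_def)
  qed
  ultimately obtain f where f: "\<And>n. P n (f n)"
      "\<And>n. fst (f (Suc n)) = fst (f n) \<union> F (snd (f n))"
    using dependent_nat_choice[of P "\<lambda>n s t. fst t = fst s \<union> F (snd s)"] by blast
  have "F (snd (f i)) \<subseteq> fst (f n)" if "i < n" for i n
    using that f(2) by (induction n) (auto simp: less_Suc_eq)
  then have "snd (f n) \<in> orthogonal_complement (F (snd (f i)))" if "i < n" for i n
    using f(1)[of n] that by (fastforce simp: P_def orthogonal_complement_def)
  then show ?thesis
    using f(1) by (intro exI[of _ "\<lambda>n. snd (f n)"]) (auto simp: P_def)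
qed

lemma AN_bounded_op: "T \<in> AN \<Longrightarrow> bounded_op UNIV UNIV (blinfun_apply T)"
  by (simp add: AN_def)

text \<open>Taking \<open>y\<close> orthogonal to both \<open>x\<close> and
  \<open>adj UNIV T (T x)\<close> makes \<open>x\<close>, \<open>y\<close> orthogonal with
  orthogonal images. On unit combinations with weights \<open>sqrt (1 - s)\<close> and
  \<open>sqrt s\<close> the squared norm of the image is then affine in \<open>s\<close>, so every
  intermediate value is hit exactly.\<close>

lemma norm_apply_intermediate:
  fixes T :: "'a :: complex_hilbert \<Rightarrow> 'a"
  assumes T: "bounded_op UNIV UNIV T" and C: "finite C" and d: "p \<le> d" "d \<le> r" "p < r"
    and hi: "\<And>C. finite C \<Longrightarrow> \<exists>x\<in>orthogonal_complement C. norm x =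
        1 \<and> r \<le> (norm (T x))\<^sup>2"
    and lo: "\<And>C. finite C \<Longrightarrow> \<exists>x\<in>orthogonal_complement C. norm x =
        1 \<and> (norm (T x))\<^sup>2 \<le> p"
  shows "\<exists>z\<in>orthogonal_complement C. norm z = 1 \<and> (norm (T z))\<^sup>2 = d"
proof -
  obtain x where x: "x \<in> orthogonal_complement C" "norm x = 1" "r \<le> (norm (T x))\<^sup>2"
    using hi[OF C] by blast
  obtain y where y: "y \<in> orthogonal_complement (C \<union> {x, adj UNIV T (T x)})" "norm y = 1"
    "(norm (T y))\<^sup>2 \<le> p"
    using lo[of "C \<union> {x, adj UNIV T (T x)}"] C by auto
  have yx: "cinner y x = 0" "cinner (T y) (T x) = 0"
    using y(1) cinner_adj_right[OF T, of y "T x"] by (auto simp: orthogonal_complement_def)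
  define u v where "u = (norm (T x))\<^sup>2" and "v = (norm (T y))\<^sup>2"
  define s where "s = (d - v) / (u - v)"
  have uv: "v < u" "v \<le> d" "d \<le> u"
    using x(3) y(3) d by (auto simp: u_def v_def)
  then have s: "0 \<le> s" "s \<le> 1" and "s * (u - v) = d - v"
    by (auto simp: s_def field_simps)
  then have su: "s * u + (1 - s) * v = d"
    by (simp add: algebra_simps)
  define z where "z = sqrt (1 - s) *\<^sub>R y + sqrt s *\<^sub>R x"
  have "(norm z)\<^sup>2 = 1"
    unfolding z_def using s yx x(2) y(2)
    by (subst norm_add_orthogonal) (simp_all add: cinner_simps)
  then have "norm z = 1"
    by (simp add: power2_eq_1_iff) (metis norm_ge_zero not_one_le_zero neg_0_le_iff_le)
  moreover have "(norm (T z))\<^sup>2 = d"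
    unfolding z_def bounded_op_add[OF T] bounded_op_scaleR[OF T] using s yx su
    by (subst norm_add_orthogonal) (simp_all add: cinner_simps power_mult_distrib u_def v_def
        add.commute)
  moreover have "z \<in> orthogonal_complement C"
    unfolding z_def using x(1) y(1)
    by (auto simp: orthogonal_complement_def cinner_simps)
  ultimately show ?thesis by blast
qed

text \<open>By Cauchy-Schwarz a vector on which a positive form vanishes is in the radical of the
  form. Applied to a bound minus an operator, this turns a vector attaining the bound into an
  eigenvector, as far as pairing with \<open>M\<close> can see.\<close>

lemma csubspace_form_null:
  assumes G: "selfadjoint G" and M: "csubspace M"
    and pos: "\<And>w. w \<in> M \<Longrightarrow> 0 \<le> Re (cinner (G w) w)"
    and x: "x \<in> M" "Re (cinner (G x) x) \<le> 0" and y: "y \<in> M"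
  shows "cinner (G x) y = 0"
proof -
  have "Re (cinner (G x) x) = 0"
    using x pos by force
  then show ?thesis
    using cauchy_schwarz_form[OF G M pos x(1) y] by simp
qed

text \<open>Choose orthonormal \<open>z n\<close> with orthogonal images and \<open>(norm (T (z
    n)))\<^sup>2\<close> increasing strictly to
  \<open>r\<^sup>2\<close>: then \<open>T\<close> does not attain its norm \<open>r\<close> on the
      closed span of the \<open>z n\<close>.\<close>

lemma AN_no_gap:
  fixes T :: "'a :: complex_hilbert \<Rightarrow>\<^sub>L 'a"
  assumes T: "T \<in> AN" and pr: "0 \<le> p" "p < r"
    and hi: "\<And>C. finite C \<Longrightarrow> \<exists>x\<in>orthogonal_complement C. norm x =
        1 \<and> r \<le> norm (T x)"
    and lo: "\<And>C. finite C \<Longrightarrow> \<exists>x\<in>orthogonal_complement C. norm x =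
        1 \<and> norm (T x) \<le> p"
  shows False
proof -
  note T' = AN_bounded_op[OF T]
  define Q where "Q = (\<lambda>x. adj UNIV (blinfun_apply T) (T x))"
  have Q: "selfadjoint Q"
    unfolding Q_def by (rule selfadjoint_adj_compose[OF T'])
  have cQ: "cinner (Q x) y = cinner (T x) (T y)" for x y
    by (simp add: Q_def cinner_adj_left[OF T'])
  have pr2: "p\<^sup>2 < r\<^sup>2"
    using pr by (simp add: power_strict_mono)
  \<comment> \<open>\<open>d\<close> starts at the square of \<open>p\<close> and increases strictly
    to the square of \<open>r\<close>.\<close>
  define d where "d n = r\<^sup>2 - (r\<^sup>2 - p\<^sup>2) / real (Suc n)" for n
  have d: "p\<^sup>2 \<le> d n" "d n < r\<^sup>2" for n
  proof -
    have "(r\<^sup>2 - p\<^sup>2) / real (Suc n) \<le> (r\<^sup>2 - p\<^sup>2) / 1"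
      using pr2 by (intro divide_left_mono) auto
    then show "p\<^sup>2 \<le> d n"
      by (simp add: d_def)
    show "d n < r\<^sup>2"
      using pr2 by (simp add: d_def)
  qed
  have hi2: "\<exists>x\<in>orthogonal_complement C. norm x = 1 \<and> r\<^sup>2 \<le> (norm (T
      x))\<^sup>2" if "finite C" for C
    using hi[OF that] pr by (meson order.strict_implies_order order.trans power_mono)
  have lo2: "\<exists>x\<in>orthogonal_complement C. norm x = 1 \<and> (norm (T x))\<^sup>2 \<le>
      p\<^sup>2" if "finite C" for C
    using lo[OF that] by (meson norm_ge_zero power_mono)
  have "\<exists>z \<in> orthogonal_complement C. norm z = 1 \<and> (norm (T z))\<^sup>2 = d n" if
      "finite C" for n C
    by (rule norm_apply_intermediate[OF T' that d(1) less_imp_le[OF d(2)] pr2 hi2 lo2])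
  \<comment> \<open>Orthogonality to \<open>z\<close> gives an orthogonal system; orthogonality to
    \<open>Q z\<close> makes the images under \<open>T\<close> orthogonal as well.\<close>
  from orthogonal_sequence_exists[where R = "\<lambda>n z. norm z = 1 \<and> (norm (T z))\<^sup>2
      = d n" and F = "\<lambda>z. {z, Q z}", OF this]
  obtain z where z: "\<And>n. norm (z n) = 1" "\<And>n. (norm (T (z n)))\<^sup>2 = d n"
    "\<And>n i. i < n \<Longrightarrow> z n \<in> orthogonal_complement {z i, Q (z i)}"
    by auto
  have orth: "cinner (z m) (z n) = 0" "cinner (T (z m)) (T (z n)) = 0" if "m \<noteq> n" for m n
  proof -
    have *: "cinner (z m) (z n) = 0 \<and> cinner (T (z m)) (T (z n)) = 0" if "n < m" for m n
      using z(3)[OF that] selfadjoint_cinner[OF Q, of "z m" "z n"] cQ[of "z m" "z n"]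
      by (auto simp: orthogonal_complement_def)
    show "cinner (z m) (z n) = 0" "cinner (T (z m)) (T (z n)) = 0"
      using *[of n m] *[of m n] that by (metis cinner_eq_0_commute linorder_neqE_nat)+
  qed
  define M where "M = closure (cspan (range z))"
  have M: "closed_subspace M"
    unfolding M_def by (rule closed_subspace_closure_cspan)
  have zM: "z n \<in> M" for n
    using closure_cspan_superset[of "range z"] by (auto simp: M_def)
  \<comment> \<open>\<open>G\<close> is the square of \<open>r\<close> minus \<open>Q\<close>. It is
    positive on \<open>M\<close>, and a vector attaining the norm of \<open>T\<close> on
    \<open>M\<close> annihilates its form.\<close>
  define G where "G = (\<lambda>x. (- 1) *\<^sub>R (Q x - r\<^sup>2 *\<^sub>R x))"
  have G: "selfadjoint G"
    unfolding G_def by (intro selfadjoint_scaleR selfadjoint_diff_scaleR Q)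
  have ReG: "Re (cinner (G x) x) = r\<^sup>2 * (norm x)\<^sup>2 - (norm (T x))\<^sup>2" for x
    by (simp add: G_def cinner_simps cQ Re_cinner_self)
  have span_pos: "norm (T x) \<le> r * norm x" if "x \<in> cspan (range z)" for x
  proof -
    obtain t c where t: "finite t" "t \<subseteq> range z" and x: "x = (\<Sum>a\<in>t. c a
        *\<^sub>C a)"
      using \<open>x \<in> cspan (range z)\<close> unfolding complex_vector.span_explicit by auto
    have orth_t: "cinner a b = 0" "cinner (T a) (T b) = 0" if ab: "a \<in> t" "b \<in> t" "a
        \<noteq> b" for a b
    proof -
      obtain m n where "a = z m" "b = z n"
        using ab t by blast
      with ab(3) orth[of m n] show "cinner a b = 0" "cinner (T a) (T b) = 0"
        by auto
    qed
    have "(norm (T x))\<^sup>2 = (\<Sum>a\<in>t. (norm (c a *\<^sub>C T a))\<^sup>2)"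
      unfolding x bounded_op_sum[OF T'] bounded_op_scaleC[OF T']
      by (intro norm_sum_orthogonal t(1)) (simp add: cinner_simps orth_t)
    also have "\<dots> \<le> (\<Sum>a\<in>t. r\<^sup>2 * (norm (c a *\<^sub>C a))\<^sup>2)"
    proof (rule sum_mono)
      fix a assume "a \<in> t"
      then obtain n where "a = z n" using t by auto
      then show "(norm (c a *\<^sub>C T a))\<^sup>2 \<le> r\<^sup>2 * (norm (c a *\<^sub>C
          a))\<^sup>2"
        using z(1,2)[of n] d(2)[of n]
        by (simp add: norm_scaleC power_mult_distrib mult.commute mult_right_mono)
    qed
    also have "\<dots> = r\<^sup>2 * (norm x)\<^sup>2"
      unfolding x sum_distrib_left[symmetric]
      by (subst norm_sum_orthogonal[OF t(1)]) (simp_all add: cinner_simps orth_t)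
    finally show ?thesis
      using pr by (metis power_mult_distrib power2_le_imp_le mult_nonneg_nonneg norm_ge_zero
          less_imp_le order_trans)
  qed
  have "closed {x. norm (T x) \<le> r * norm x}"
    by (intro closed_Collect_le continuous_intros)
  then have "M \<subseteq> {x. norm (T x) \<le> r * norm x}"
    unfolding M_def using span_pos by (intro closure_minimal) auto
  then have pos: "norm (T x) \<le> r * norm x" if "x \<in> M" for x
    using that by auto
  have Gpos: "0 \<le> Re (cinner (G x) x)" if "x \<in> M" for x
    using power_mono[OF pos[OF that], of 2] by (simp add: ReG power_mult_distrib)
  have "z 0 \<noteq> 0"
    using z(1)[of 0] by auto
  then have "M \<noteq> {0}"
    using zM[of 0] by auto
  then obtain x where x: "x \<in> M" "norm x = 1" "norm (T x) = (SUP y\<in>{y\<in>M. norm y = 1}.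
      norm (T y))"
    using T M by (auto simp: AN_def norm_attaining_on_def)
  have bdd: "bdd_above ((\<lambda>y. norm (T y)) ` {y\<in>M. norm y = 1})"
    using pos by (intro bdd_aboveI2[of _ _ r]) force
  have "norm (T (z n)) \<le> norm (T x)" for n
    unfolding x(3) by (intro cSUP_upper bdd) (simp add: zM z)
  then have "d n \<le> (norm (T x))\<^sup>2" for n
    using power_mono[of "norm (T (z n))" "norm (T x)" 2] by (simp add: z(2))
  moreover have "d \<longlonglongrightarrow> r\<^sup>2 - 0"
    unfolding d_def 
    by (intro tendsto_diff tendsto_const real_tendsto_divide_at_top[OF tendsto_const]
        filterlim_compose[OF filterlim_real_sequentially filterlim_Suc])
  ultimately have "r\<^sup>2 \<le> (norm (T x))\<^sup>2"
    by (metis LIMSEQ_le_const2 diff_zero)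
  then have Gx: "Re (cinner (G x) x) \<le> 0"
    by (simp add: ReG x(2))
  have "cinner x (z n) = 0" for n
  proof -
    have "cinner (G x) (z n) = 0"
      by (rule csubspace_form_null[OF G closed_subspace_csubspace[OF M] Gpos x(1) Gx zM])
    \<comment> \<open>\<open>Q (z n)\<close> may leave \<open>M\<close>, but its component in
      \<open>M\<close> is \<open>d n\<close> times \<open>z n\<close>. Combined with the vanishing
      of \<open>cinner (G x) (z n)\<close>, this leaves a nonzero multiple of
      \<open>cinner x (z n)\<close> equal to 0, so \<open>x\<close> is orthogonal to the system
      spanning \<open>M\<close>.\<close>
    moreover have "cinner (Q (z n) - d n *\<^sub>R z n) x = 0"
    proof (rule cinner_closure_cspan_right[OF _ x(1)[unfolded M_def]])
      fix b assume "b \<in> range z"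
      then obtain m where b: "b = z m" by auto
      show "cinner (Q (z n) - d n *\<^sub>R z n) b = 0"
        by (cases "m = n")
           (simp_all add: b cinner_simps cQ orth cinner_self z flip: z(2) of_real_power)
    qed
    then have "cinner x (Q (z n) - d n *\<^sub>R z n) = 0"
      by (simp add: cinner_eq_0_commute)
    ultimately have "complex_of_real (r\<^sup>2 - d n) * cinner x (z n) = 0"
      by (simp add: G_def cinner_simps selfadjoint_cinner[OF Q] algebra_simps)
    then show ?thesis
      using d(2)[of n] by (simp del: of_real_diff)
  qed
  then have "cinner x x = 0"
    by (intro cinner_closure_cspan_right[OF _ x(1)[unfolded M_def]]) auto
  then show False
    using x(2) by simp
qed

text \<open>An approximation within a third of the gap still leaves a gap of a third, so
  \<open>AN_no_gap\<close> applies to the approximating operator.\<close>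

lemma closure_AN_no_gap:
  fixes T :: "'a :: complex_hilbert \<Rightarrow>\<^sub>L 'a"
  assumes T: "T \<in> closure AN" and pr: "p < r"
    and hi: "\<And>C. finite C \<Longrightarrow> \<exists>x\<in>orthogonal_complement C. norm x =
        1 \<and> r \<le> norm (T x)"
    and lo: "\<And>C. finite C \<Longrightarrow> \<exists>x\<in>orthogonal_complement C. norm x =
        1 \<and> norm (T x) \<le> p"
  shows False
proof -
  define e where "e = (r - p) / 3"
  have e: "0 < e" using pr by (simp add: e_def)
  obtain T' where T': "T' \<in> AN" "dist T' T < e"
    using T e by (auto simp: closure_approachable)
  have close: "norm (T x) \<le> norm (T' x) + e" "norm (T' x) \<le> norm (T x) + e"
      if "norm x = 1" for x
  proof -
    have "norm (T' x - T x) \<le> e"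
      using norm_blinfun[of "T' - T" x] T'(2) that by (simp add: dist_norm blinfun.diff_left)
    then show "norm (T x) \<le> norm (T' x) + e" "norm (T' x) \<le> norm (T x) + e"
      using norm_triangle_ineq2[of "T' x" "T x"] norm_triangle_ineq3[of "T' x" "T x"] by linarith+
  qed
  have "0 \<le> p"
    using lo[of "{}"] norm_ge_zero order_trans by blast
  show False
  proof (rule AN_no_gap[OF T'(1)])
    show "0 \<le> p + e" "p + e < r - e"
      using e \<open>0 \<le> p\<close> by (auto simp: e_def field_simps)
    show "\<exists>x\<in>orthogonal_complement C. norm x = 1 \<and> r - e \<le> norm (T' x)"
        if "finite C" for C
      using hi[OF that] close by fastforce
    show "\<exists>x\<in>orthogonal_complement C. norm x = 1 \<and> norm (T' x) \<le> p + e"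
        if "finite C" for C
      using lo[OF that] close by fastforce
  qed
qed

lemma bounded_op_closure_AN:
  fixes T :: "'a :: complex_hilbert \<Rightarrow>\<^sub>L 'a"
  assumes "T \<in> closure AN"
  shows "bounded_op UNIV UNIV (blinfun_apply T)"
proof (rule bounded_op_blinfunI)
  fix c and x :: 'a
  obtain f where f: "\<And>n. f n \<in> AN" "f \<longlonglongrightarrow> T"
    using assms by (auto simp: closure_sequential)
  have lim: "(\<lambda>n. f n y) \<longlonglongrightarrow> T y" for y
    by (intro tendsto_intros f(2))
  from bounded_linear.tendsto[OF bounded_op_bounded_linear[OF bounded_op_scaleC_self[of c]] lim[of x]]
  have "(\<lambda>n. f n (c *\<^sub>C x)) \<longlonglongrightarrow> c *\<^sub>C T x"
    by (simp add: bounded_op_scaleC[OF AN_bounded_op[OF f(1)]])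
  then show "T (c *\<^sub>C x) = c *\<^sub>C T x"
    using lim LIMSEQ_unique by blast
qed

lemma norm_le_of_unit:
  fixes T :: "'a :: complex_hilbert \<Rightarrow> 'a"
  assumes T: "bounded_op UNIV UNIV T" and M: "csubspace M" and x: "x \<in> M"
  shows "(\<And>y. y \<in> M \<Longrightarrow> norm y = 1
      \<Longrightarrow> norm (T y) \<le> k) \<Longrightarrow> norm (T x) \<le> k * norm x"
    and "(\<And>y. y \<in> M \<Longrightarrow> norm y = 1
        \<Longrightarrow> k \<le> norm (T y)) \<Longrightarrow> k * norm x \<le> norm (T x)"
proof -
  define y where "y = (1 / norm x) *\<^sub>R x"
  have y: "y \<in> M" "x \<noteq> 0 \<Longrightarrow> norm y = 1" "norm (T y) = norm (T x) / norm x"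
    using x M by (auto simp: y_def csubspace_scaleR bounded_op_scaleR[OF T])
  show "norm (T x) \<le> k * norm x" if "\<And>y. y \<in> M
      \<Longrightarrow> norm y = 1 \<Longrightarrow> norm (T y) \<le> k"
    using y that[of y] mult_left_mono[of "norm (T y)" k "norm x"]
    by (cases "x = 0") (simp_all add: bounded_op_zero[OF T] mult.commute)
  show "k * norm x \<le> norm (T x)" if "\<And>y. y \<in> M
      \<Longrightarrow> norm y = 1 \<Longrightarrow> k \<le> norm (T y)"
    using y that[of y] mult_left_mono[of k "norm (T y)" "norm x"]
    by (cases "x = 0") (simp_all add: bounded_op_zero[OF T] mult.commute)
qed

text \<open>\<alpha> is the infimum of the upper bounds valid up to finite codimension. A matching
  lower bound must then exist up to finite codimension, since otherwise small values would coexist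
  with values near \<alpha> on every orthogonal complement of a finite set.\<close>

lemma closure_AN_essential_norm:
  fixes T :: "'a :: complex_hilbert \<Rightarrow>\<^sub>L 'a"
  assumes T: "T \<in> closure AN"
  shows "\<exists>\<alpha>\<ge>0. \<forall>e>0. \<exists>C. finite C \<and>
      (\<forall>x\<in>orthogonal_complement C.
    (\<alpha> - e) * norm x \<le> norm (T x) \<and> norm (T x) \<le> (\<alpha> + e) * norm x)"
proof -
  note T' = bounded_op_closure_AN[OF T]
  define X where "X = {r. 0 \<le> r \<and> (\<exists>C. finite C \<and>
      (\<forall>x\<in>orthogonal_complement C. norm x = 1 \<longrightarrow> norm (T x) \<le> r))}"
  define \<alpha> where "\<alpha> = Inf X"
  have "norm T \<in> X"
  proof -
    have "norm (T x) \<le> norm T" if "norm x = 1" for x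
      using norm_blinfun[of T x] that by simp
    then show ?thesis
      by (auto simp: X_def intro!: exI[of _ "{}"])
  qed
  then have ne: "X \<noteq> {}" by auto
  have bdd: "bdd_below X"
    by (rule bdd_belowI[of _ 0]) (simp add: X_def)
  have "0 \<le> \<alpha>"
    unfolding \<alpha>_def using ne by (intro cInf_greatest) (auto simp: X_def)
  moreover have "\<exists>C. finite C \<and> (\<forall>x\<in>orthogonal_complement C.
    (\<alpha> - e) * norm x \<le> norm (T x) \<and> norm (T x) \<le> (\<alpha> + e) * norm x)" if
        e: "0 < e" for e
  proof -
    have "\<exists>r\<in>X. r < \<alpha> + e"
      using cInf_less_iff[OF ne bdd, of "\<alpha> + e"] e by (simp add: \<alpha>_def)
    then obtain C where C: "finite C" "\<And>x. x \<in> orthogonal_complement C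
        \<Longrightarrow> norm x = 1 \<Longrightarrow> norm (T x) \<le> \<alpha> + e"
      by (fastforce simp: X_def)
    have "\<exists>D. finite D \<and> (\<forall>x\<in>orthogonal_complement D. norm x = 1
        \<longrightarrow> \<alpha> - e \<le> norm (T x))"
    proof (rule ccontr)
      assume neg: "\<not> ?thesis"
      have "False"
      proof (rule closure_AN_no_gap[OF T])
        show "\<alpha> - e < \<alpha> - e / 2" using e by simp
        show "\<exists>x\<in>orthogonal_complement C. norm x = 1 \<and> norm (T x) \<le> \<alpha>
            - e" if "finite C" for C
          using neg that by (meson linear)
        \<comment> \<open>If this failed, \<open>\<alpha> - e / 2\<close> would be an element of
          \<open>X\<close> below its infimum; halving \<open>e\<close> keeps it strictly above the
          small values.\<close>
        show "\<exists>x\<in>orthogonal_complement C. norm x = 1 \<and> \<alpha> - e / 2 \<le>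
            norm (T x)" if fin: "finite C" for C
        proof (rule ccontr)
          assume c: "\<not> ?thesis"
          obtain x where "x\<in>orthogonal_complement C" "norm x = 1" "norm (T x) \<le> \<alpha> -
              e"
            using neg fin by (meson linear)
          \<comment> \<open>Membership in \<open>X\<close> includes nonnegativity, which is
            inherited here from the norm of a concrete vector.\<close>
          then have "0 \<le> \<alpha> - e / 2"
            using e norm_ge_zero[of "T x"] by linarith
          with c fin have "\<alpha> - e / 2 \<in> X"
            by (auto simp: X_def intro!: exI[of _ C])
          from cInf_lower[OF this bdd] show False
            using e by (simp add: \<alpha>_def)
        qed
      qed
      then show False .
    qed
    then obtain D where D: "finite D" "\<And>x. x \<in> orthogonal_complement D
        \<Longrightarrow> norm x = 1 \<Longrightarrow> \<alpha> - e \<le> norm (T x)"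
      by blast
    note sub = closed_subspace_csubspace[OF closed_subspace_orthogonal_complement]
    show ?thesis
    proof (intro exI[of _ "C \<union> D"] conjI ballI)
      fix x assume "x \<in> orthogonal_complement (C \<union> D)"
      then have x: "x \<in> orthogonal_complement C" "x \<in> orthogonal_complement D"
        by (auto simp: orthogonal_complement_Un)
      show "norm (T x) \<le> (\<alpha> + e) * norm x"
        by (rule norm_le_of_unit(1)[OF T' sub x(1) C(2)])
      show "(\<alpha> - e) * norm x \<le> norm (T x)"
        by (rule norm_le_of_unit(2)[OF T' sub x(2) D(2)])
    qed (use C D in auto)
  qed
  ultimately show ?thesis by blast
qed

section \<open>Compact operators\<close>

text \<open>On a Hilbert space this is equivalent to compactness.\<close>

definition compact_op :: "('a :: complex_hilbert \<Rightarrow> 'a) \<Rightarrow> bool" where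
  "compact_op K \<longleftrightarrow>
    (\<forall>e>0. \<exists>C. finite C \<and> (\<forall>x\<in>orthogonal_complement C. norm (K x)
        \<le> e * norm x))"

lemma compact_opD:
  assumes "compact_op K" "0 < e"
  obtains C where "finite C" "\<And>x. x \<in> orthogonal_complement C
      \<Longrightarrow> norm (K x) \<le> e * norm x"
proof -
  from assms obtain C where "finite C" "\<forall>x\<in>orthogonal_complement C. norm (K x) \<le> e
      * norm x"
    unfolding compact_op_def by auto
  then show ?thesis
    using that by auto
qed

lemma compact_op_uminus: "compact_op K \<Longrightarrow> compact_op (\<lambda>x. (-1) *\<^sub>R K
    x)"
  by (simp add: compact_op_def)

lemma csubspace_orthogonal_complement: "csubspace (orthogonal_complement C)"
  by (rule closed_subspace_csubspace[OF closed_subspace_orthogonal_complement])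

text \<open>The numerical radius bounds the norm of a self-adjoint operator, by polarisation at
  \<open>x\<close> and \<open>K x\<close>. Only these two vectors have to lie in
  \<open>M\<close>.\<close>

lemma selfadjoint_norm_le_of_form:
  assumes K: "selfadjoint K" and M: "csubspace M" and x: "x \<in> M" "K x \<in> M"
    and form: "\<And>w. w \<in> M \<Longrightarrow> \<bar>Re (cinner (K w) w)\<bar> \<le> e *
        (norm w)\<^sup>2"
  shows "norm (K x) \<le> e * norm x"
proof (cases "K x = 0")
  case True
  show ?thesis
  proof (cases "x = 0")
    case False
    have "0 \<le> e * (norm x)\<^sup>2"
      using form[OF x(1)] by linarith
    then show ?thesis
      using True False by (simp add: zero_le_mult_iff)
  qed (use True in simp)
next
  case False
  note K' = selfadjoint_bounded_op[OF K]
  define y where "y = K x"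
  have "x \<noteq> 0"
    using False bounded_op_zero[OF K'] by auto
  \<comment> \<open>With this \<open>s\<close> the vectors \<open>s *\<^sub>R x\<close> and
    \<open>y\<close> have equal length, which balances the two terms from the parallelogram law and
    yields exactly \<open>s \<le> e\<close>.\<close>
  define s where "s = norm y / norm x"
  have s: "s > 0"
    using False \<open>x \<noteq> 0\<close> by (simp add: s_def y_def)
  have Kyx: "Re (cinner (K y) x) = (norm y)\<^sup>2"
    by (simp add: selfadjoint_cinner[OF K] Re_cinner_self flip: y_def)
  have yM: "y \<in> M"
    using x by (simp add: y_def)
  have polar: "Re (cinner (K (u + v)) (u + v)) - Re (cinner (K (u - v)) (u - v)) =
      2 * Re (cinner (K u) v) + 2 * Re (cinner (K v) u)" for u v
    by (simp add: bounded_op_add[OF K'] bounded_op_diff[OF K'] cinner_simps)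
  have "4 * s * (norm y)\<^sup>2 = Re (cinner (K (s *\<^sub>R x + y)) (s *\<^sub>R x + y)) - Re
      (cinner (K (s *\<^sub>R x - y)) (s *\<^sub>R x - y))"
    unfolding polar
    by (simp add: bounded_op_scaleR[OF K'] cinner_scaleR_left cinner_scaleR_right Kyx Re_cinner_self
        flip: y_def)
  also have "\<dots> \<le> e * (norm (s *\<^sub>R x + y))\<^sup>2 + e * (norm (s *\<^sub>R x -
      y))\<^sup>2"
    using form[of "s *\<^sub>R x + y"] form[of "s *\<^sub>R x - y"] M x(1) yM
    by (simp add: csubspace_add csubspace_diff csubspace_scaleR)
  also have "\<dots> = e * (2 * (norm (s *\<^sub>R x))\<^sup>2 + 2 * (norm y)\<^sup>2)"
    by (simp only: norm_parallelogram flip: distrib_left)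
  also have "\<dots> = 2 * e * ((s * norm x)\<^sup>2 + (norm y)\<^sup>2)"
    using s by (simp add: algebra_simps)
  also have "s * norm x = norm y"
    using \<open>x \<noteq> 0\<close> by (simp add: s_def)
  finally have "s * (norm y)\<^sup>2 \<le> e * (norm y)\<^sup>2"
    by simp
  then have "s \<le> e"
    using False by (simp add: y_def)
  then show ?thesis
    using \<open>x \<noteq> 0\<close> by (simp add: s_def y_def field_simps)
qed

lemma compact_op_of_form:
  assumes K: "selfadjoint K"
    and form: "\<And>e. 0 < e \<Longrightarrow> \<exists>C. finite C \<and>
      (\<forall>x\<in>orthogonal_complement C. \<bar>Re (cinner (K x) x)\<bar> \<le> e * (norm
          x)\<^sup>2)"
  shows "compact_op K"
  unfolding compact_op_def
proof (intro allI impI)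
  fix e :: real assume "0 < e"
  from form[OF this] obtain C where C: "finite C"
    "\<And>x. x \<in> orthogonal_complement C \<Longrightarrow> \<bar>Re (cinner (K x) x)\<bar>
        \<le> e * (norm x)\<^sup>2"
    by auto
  show "\<exists>C. finite C \<and> (\<forall>x\<in>orthogonal_complement C. norm (K x) \<le> e *
      norm x)"
  proof (intro exI[of _ "C \<union> K ` C"] conjI ballI)
    fix x assume x: "x \<in> orthogonal_complement (C \<union> K ` C)"
    then have "K x \<in> orthogonal_complement C"
      by (auto simp: orthogonal_complement_def selfadjoint_cinner[OF K])
    with x show "norm (K x) \<le> e * norm x"
      by (intro selfadjoint_norm_le_of_form[OF K csubspace_orthogonal_complement _ _ C(2)])
         (auto simp: orthogonal_complement_Un)
  qed (use C in auto)
qed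

lemma closure_AN_hyponormal_compact:
  fixes T :: "'a :: complex_hilbert \<Rightarrow>\<^sub>L 'a"
  assumes T: "T \<in> closure AN" and hyp: "\<And>x. norm (T x) \<le> norm (adj UNIV
      (blinfun_apply T) x)"
  shows "\<exists>\<alpha>\<ge>0. compact_op (\<lambda>x. T (adj UNIV (blinfun_apply T) x) -
      \<alpha>\<^sup>2 *\<^sub>R x)"
proof -
  note T' = bounded_op_closure_AN[OF T]
  define Ta where "Ta = adj UNIV (blinfun_apply T)"
  have cT: "cinner (T x) y = cinner x (Ta y)" for x y
    by (simp add: Ta_def cinner_adj_right[OF T'])
  have nT: "Re (cinner (T (Ta x)) x) = (norm (Ta x))\<^sup>2" for x
    by (simp add: cT Re_cinner_self)
  obtain \<alpha> where \<alpha>: "\<alpha> \<ge> 0" "\<And>e. 0 < e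
      \<Longrightarrow> \<exists>C. finite C \<and> (\<forall>x\<in>orthogonal_complement C.
    (\<alpha> - e) * norm x \<le> norm (T x) \<and> norm (T x) \<le> (\<alpha> + e) * norm x)"
    using closure_AN_essential_norm[OF T] by auto
  have "compact_op (\<lambda>x. T (Ta x) - \<alpha>\<^sup>2 *\<^sub>R x)"
  proof (rule compact_op_of_form)
    show "selfadjoint (\<lambda>x. T (Ta x) - \<alpha>\<^sup>2 *\<^sub>R x)"
      unfolding Ta_def by (intro selfadjoint_diff_scaleR selfadjoint_adj_compose T')
    fix e :: real assume e: "0 < e"
    \<comment> \<open>Squaring the bounds with \<open>\<alpha> + d\<close> and
      \<open>\<alpha> - d\<close> costs at most \<open>d * (2 * \<alpha> + d)\<close>; the cap 1
      bounds this by \<open>d * (2 * \<alpha> + 1)\<close>, hence by \<open>e\<close>.\<close>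
    define d where "d = min 1 (e / (2 * \<alpha> + 1))"
    have "d \<le> e / (2 * \<alpha> + 1)"
      by (simp add: d_def)
    then have d: "d * (2 * \<alpha> + 1) \<le> e" "0 < d" "d \<le> 1"
      using e \<alpha>(1) by (simp add: pos_le_divide_eq, simp_all add: d_def)
    have de: "d * (2 * \<alpha> + d) \<le> e"
      using d mult_left_mono[of "2 * \<alpha> + d" "2 * \<alpha> + 1" d] by linarith
    obtain C where C: "finite C"
      "\<And>x. x \<in> orthogonal_complement C \<Longrightarrow> (\<alpha> - d) * norm x \<le>
          norm (T x)"
      "\<And>x. x \<in> orthogonal_complement C \<Longrightarrow> norm (T x) \<le> (\<alpha> + d)
          * norm x"
      using \<alpha>(2)[OF d(2)] by blast
    show "\<exists>C. finite C \<and> (\<forall>x\<in>orthogonal_complement C.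
      \<bar>Re (cinner (T (Ta x) - \<alpha>\<^sup>2 *\<^sub>R x) x)\<bar> \<le> e * (norm
          x)\<^sup>2)"
    proof (intro exI[of _ "C \<union> T ` C"] conjI ballI)
      fix x assume x: "x \<in> orthogonal_complement (C \<union> T ` C)"
      then have Tax: "Ta x \<in> orthogonal_complement C"
        by (auto simp: orthogonal_complement_def cinner_eq_0_commute[of "Ta x"]
            cinner_eq_0_commute[of x] simp flip: cT)
      have lower: "(\<alpha> - d) * norm x \<le> norm (Ta x)"
        using C(2)[of x] hyp[of x] x by (auto simp: orthogonal_complement_Un Ta_def)
      have upper: "norm (Ta x) \<le> (\<alpha> + d) * norm x"
      proof (cases "Ta x = 0")
        case False
        have "(norm (Ta x))\<^sup>2 \<le> cmod (cinner (T (Ta x)) x)"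
          using nT[of x] complex_Re_le_cmod[of "cinner (T (Ta x)) x"] by simp
        also have "\<dots> \<le> norm (T (Ta x)) * norm x"
          by (rule cinner_cauchy_schwarz)
        also have "\<dots> \<le> (\<alpha> + d) * norm (Ta x) * norm x"
          by (intro mult_right_mono C(3) Tax) simp
        finally show ?thesis
          using False by (simp add: power2_eq_square mult_ac)
      qed (use \<alpha>(1) d in simp)
      have "(norm (Ta x))\<^sup>2 \<le> ((\<alpha> + d) * norm x)\<^sup>2"
        using upper by (intro power_mono) auto
      also have "\<dots> = \<alpha>\<^sup>2 * (norm x)\<^sup>2 + (d * (2 * \<alpha> + d)) * (norm
          x)\<^sup>2"
        by (simp add: power2_eq_square algebra_simps)
      also have "\<dots> \<le> \<alpha>\<^sup>2 * (norm x)\<^sup>2 + e * (norm x)\<^sup>2"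
        using de by (intro add_left_mono mult_right_mono) auto
      finally have 1: "(norm (Ta x))\<^sup>2 \<le> \<alpha>\<^sup>2 * (norm x)\<^sup>2 + e * (norm
          x)\<^sup>2" .
      have 2: "\<alpha>\<^sup>2 * (norm x)\<^sup>2 - e * (norm x)\<^sup>2 \<le> (norm (Ta
          x))\<^sup>2"
      \<comment> \<open>For \<open>\<alpha> < d\<close> the lower bound has a negative factor and
        cannot be squared, but then the square of \<alpha> is itself at most
        \<open>e\<close>.\<close>
      proof (cases "\<alpha> \<ge> d")
        case True
        have "((\<alpha> - d) * norm x)\<^sup>2 \<le> (norm (Ta x))\<^sup>2"
          using lower True by (intro power_mono) auto
        moreover have "((\<alpha> - d) * norm x)\<^sup>2 = \<alpha>\<^sup>2 * (norm x)\<^sup>2 -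
            (d * (2 * \<alpha> - d)) * (norm x)\<^sup>2"
          by (simp add: power2_eq_square algebra_simps)
        moreover have "(d * (2 * \<alpha> - d)) * (norm x)\<^sup>2 \<le> e * (norm x)\<^sup>2"
          using de mult_pos_pos[OF d(2) d(2)]
          by (intro mult_right_mono zero_le_power2) (simp add: algebra_simps)
        ultimately show ?thesis by linarith
      next
        case False
        then have "\<alpha> * \<alpha> \<le> d * (2 * \<alpha> + d)"
          using \<alpha>(1) d(2) by (intro mult_mono) auto
        then have "\<alpha>\<^sup>2 * (norm x)\<^sup>2 \<le> e * (norm x)\<^sup>2"
          using de by (intro mult_right_mono) (auto simp: power2_eq_square)
        then show ?thesis
          by (smt (verit) zero_le_power2)
      qed
      from 1 2 show "\<bar>Re (cinner (T (Ta x) - \<alpha>\<^sup>2 *\<^sub>R x) x)\<bar> \<le> e *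
          (norm x)\<^sup>2"
        by (simp add: cinner_simps nT Re_cinner_self)
    qed (use C in auto)
  qed
  then show ?thesis
    using \<alpha>(1) by (auto simp: Ta_def)
qed

section \<open>Subspaces and operators up to finite codimension\<close>

text \<open>The pairings with \<open>B\<close> separate the points of \<open>G\<close>. The map
  \<open>f\<close> packs them into a vector of \<open>cspan B\<close>; it is injective on
  \<open>G\<close> because \<open>cinner (f x) x\<close> is the sum of their squared moduli.\<close>

lemma finite_dim_of_orthogonal_trivial:
  assumes G: "csubspace G" and B: "finite B" and triv: "\<And>x. x \<in> G
      \<Longrightarrow> x \<in> orthogonal_complement B \<Longrightarrow> x = 0"
  shows "finite_dim G"
    and "S \<subseteq> G \<Longrightarrow> \<not> complex_vector.dependent S
        \<Longrightarrow> finite S \<and> card S \<le> card B"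
proof -
  define f where "f x = (\<Sum>b\<in>B. cinner x b *\<^sub>C b)" for x
  have lin: "Vector_Spaces.linear scaleC scaleC f"
    by (simp add: Vector_Spaces.linear_iff complex_vector.vector_space_axioms f_def cinner_simps
        scaleC_add_left sum.distrib complex_vector.scale_sum_right scaleC_scaleC)
  have f0: "x = 0" if "x \<in> G" "f x = 0" for x
  proof (rule triv[OF that(1)])
    have "(\<Sum>b\<in>B. complex_of_real ((cmod (cinner x b))\<^sup>2)) = cinner (f x) x"
      unfolding f_def cinner_sum_left cinner_scaleC_left complex_norm_square
      by (simp flip: cinner_commute)
    also have "\<dots> = 0"
      by (simp add: that)
    finally have "(\<Sum>b\<in>B. (cmod (cinner x b))\<^sup>2) = 0"
      by (metis of_real_sum of_real_eq_0_iff)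
    then show "x \<in> orthogonal_complement B"
      using B by (simp add: sum_nonneg_eq_0_iff orthogonal_complement_def)
  qed
  have inj: "inj_on f G"
  proof (rule inj_onI)
    fix x y assume xy: "x \<in> G" "y \<in> G" "f x = f y"
    then have "f (x - y) = 0"
      by (simp add: f_def cinner_diff_left complex_vector.scale_left_diff_distrib sum_subtractf)
    then show "x = y"
      using f0[of "x - y"] csubspace_diff[OF G xy(1,2)] by simp
  qed
  have range: "f x \<in> cspan B" for x
    unfolding f_def
    by (intro complex_vector.span_sum complex_vector.span_scale complex_vector.span_base)
  have card: "finite S \<and> card S \<le> card B"
      if "S \<subseteq> G" "\<not> complex_vector.dependent S" for S
  proof -
    have "inj_on f (cspan S)"
      using inj complex_vector.span_minimal[OF that(1) G] inj_on_subset by blast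
    then have "\<not> complex_vector.dependent (f ` S)"
      using vector_space_pair.linear_independent_injective_image[OF _ lin that(2)]
      by (simp add: vector_space_pair_def complex_vector.vector_space_axioms cspan_def)
    from complex_vector.independent_span_bound[OF B this] have "finite (f ` S) \<and> card (f ` S)
        \<le> card B"
      using range by auto
    moreover have "inj_on f S"
      using inj that(1) inj_on_subset by blast
    ultimately show ?thesis
      by (simp add: card_image finite_image_iff)
  qed
  then show "S \<subseteq> G \<Longrightarrow> \<not> complex_vector.dependent S
      \<Longrightarrow> finite S \<and> card S \<le> card B"
    by blast
  obtain S where S: "S \<subseteq> G" "\<not> complex_vector.dependent S" "G \<subseteq> cspan S"
    by (rule complex_vector.maximal_independent_subset)
  then show "finite_dim G"
    unfolding finite_dim_def using card[OF S(1,2)] complex_vector.span_minimal[OF S(1) G] by blast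
qed

lemma finite_dim_surj_on:
  assumes lin: "bounded_op UNIV UNIV f" and G: "csubspace G" "finite_dim G"
    and f: "\<And>x. x \<in> G \<Longrightarrow> f x \<in> G" "\<And>x. x \<in> G
        \<Longrightarrow> f x = 0 \<Longrightarrow> x = 0"
  shows "f ` G = G"
proof -
  obtain B where B: "finite B" "cspan B = G"
    using G(2) by (auto simp: finite_dim_def)
  obtain S where S: "S \<subseteq> G" "\<not> complex_vector.dependent S" "G \<subseteq> cspan S"
    by (rule complex_vector.maximal_independent_subset)
  have spanS: "cspan S = G"
    using S complex_vector.span_minimal[OF S(1) G(1)] by blast
  have finS: "finite S"
    using complex_vector.independent_span_bound[OF B(1) S(2)] S(1) B(2) by blast
  have inj: "inj_on f G"
  proof (rule inj_onI)
    fix x y assume xy: "x \<in> G" "y \<in> G" "f x = f y"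
    then have "x - y = 0"
      using f(2)[OF csubspace_diff[OF G(1)], of x y] by (simp add: bounded_op_diff[OF lin])
    then show "x = y" by simp
  qed
  have ind: "\<not> complex_vector.dependent (f ` S)"
    using vector_space_pair.linear_independent_injective_image[OF _ bounded_op_linear[OF lin]
        S(2)] inj
    by (simp add: vector_space_pair_def complex_vector.vector_space_axioms spanS flip: cspan_def)
  have card: "card (f ` S) = card S"
    using inj S(1) by (simp add: card_image inj_on_subset)
  have "x \<in> cspan (f ` S)" if "x \<in> G" for x
  proof (rule ccontr)
    assume x: "x \<notin> cspan (f ` S)"
    have "card (insert x (f ` S)) \<le> card S"
      using complex_vector.independent_span_bound[OF finS complex_vector.independent_insertI[OF x
          ind]]
        that f(1) S(1) spanS by auto
    moreover have "x \<notin> f ` S"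
      using x complex_vector.span_base[of x "f ` S"] by metis
    ultimately show False
      using finS card by simp
  qed
  moreover have "cspan (f ` S) = f ` cspan S"
    using vector_space_pair.linear_span_image[OF _ bounded_op_linear[OF lin], of S]
    by (simp add: vector_space_pair_def complex_vector.vector_space_axioms flip: cspan_def)
  ultimately show ?thesis
    using f(1) spanS by blast
qed

text \<open>Induction over the finite set, restoring one dimension at a time. By induction
  \<open>W\<close> is bounded below on the hyperplane \<open>M'\<close> of \<open>M\<close>
  orthogonal to \<open>b\<close>; one more direction is harmless as long as its image keeps a
  positive distance from the image of \<open>M'\<close>.\<close>

lemma bounded_below_finite_codim:
  assumes W: "bounded_op UNIV UNIV W" and d: "0 < d"
  shows "finite B \<Longrightarrow> closed_subspace M \<Longrightarrow>
    (\<And>x. x \<in> M \<Longrightarrow> x \<in> orthogonal_complement B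
        \<Longrightarrow> d * norm x \<le> norm (W x)) \<Longrightarrow>
    (\<And>x. x \<in> M \<Longrightarrow> W x = 0 \<Longrightarrow> x = 0)
        \<Longrightarrow> \<exists>c>0. \<forall>x\<in>M. c * norm x \<le> norm (W x)"
proof (induction B arbitrary: M rule: finite_induct)
  case empty
  then show ?case
    using d by (auto simp: orthogonal_complement_def)
next
  case (insert b B)
  note M = insert.prems(1) and sub = closed_subspace_csubspace[OF insert.prems(1)]
  define M' where "M' = M \<inter> orthogonal_complement {b}"
  have M': "closed_subspace M'"
    unfolding M'_def by (intro closed_subspace_Int M closed_subspace_orthogonal_complement)
  have "\<exists>c>0. \<forall>x\<in>M'. c * norm x \<le> norm (W x)"
  proof (rule insert.IH[OF M'])
    show "d * norm x \<le> norm (W x)" if "x \<in> M'" "x \<in> orthogonal_complement B" for x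
      using insert.prems(2)[of x] that by (auto simp: M'_def orthogonal_complement_def)
    show "x = 0" if "x \<in> M'" "W x = 0" for x
      using insert.prems(3)[of x] that by (auto simp: M'_def)
  qed
  then obtain c where c: "c > 0" "\<And>x. x \<in> M'
      \<Longrightarrow> c * norm x \<le> norm (W x)" by blast
  \<comment> \<open>Within \<open>M\<close>, orthogonality to \<open>b\<close> is orthogonality to
    \<open>m\<close>, so \<open>M\<close> is \<open>M'\<close> plus the line through
    \<open>m\<close>.\<close>
  define m where "m = proj M b"
  have mM: "m \<in> M"
    unfolding m_def by (rule proj_in[OF M])
  have xm: "cinner x m = cinner x b" if "x \<in> M" for x
    unfolding m_def by (rule cinner_proj_right[OF M that])
  show ?case
  proof (cases "m = 0")
    case True
    then have "M = M'"
      using xm by (auto simp: M'_def orthogonal_complement_def)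
    then show ?thesis using c by blast
  next
    case False
    have "m \<notin> M'"
      using False xm[OF mM] by (auto simp: M'_def orthogonal_complement_def)
    \<comment> \<open>\<open>h\<close> bounds the distance from \<open>W m\<close> to the image of
      \<open>M'\<close>. Were that distance 0, the lower bound on \<open>M'\<close> would make the
      approximating sequence Cauchy, and its limit would place a vector of \<open>m + M'\<close> in
      the kernel.\<close>
    have "\<exists>h>0. \<forall>x\<in>M'. h \<le> norm (W (m + x))"
    proof (rule ccontr)
      assume neg: "\<not> ?thesis"
      have "\<exists>x\<in>M'. norm (W (m + x)) < inverse (real (Suc n))" for n
        using neg by (metis inverse_positive_iff_positive not_le of_nat_0_less_iff zero_less_Suc)
      then obtain f where f: "\<And>n. f n \<in> M'"
          "\<And>n. norm (W (m + f n)) < inverse (real (Suc n))"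
        by metis
      have lim0: "(\<lambda>n. W (m + f n)) \<longlonglongrightarrow> 0"
        by (rule Lim_null_comparison[OF _ LIMSEQ_inverse_real_of_nat])
           (intro always_eventually allI less_imp_le f(2))
      have "Cauchy f"
      proof (rule CauchyI)
        fix e :: real assume e: "0 < e"
        have "Cauchy (\<lambda>n. W (m + f n))"
          using lim0 LIMSEQ_imp_Cauchy by blast
        then obtain N where N: "\<And>k n. k \<ge> N \<Longrightarrow> n \<ge> N
            \<Longrightarrow> norm (W (m + f k) - W (m + f n)) < c * e"
          using CauchyD[of "\<lambda>n. W (m + f n)" "c * e"] c(1) e by auto
        have "norm (f k - f n) < e" if "k \<ge> N" "n \<ge> N" for k n
        proof -
          have "W (m + f k) - W (m + f n) = W (f k - f n)"
            by (simp add: bounded_op_add[OF W] bounded_op_diff[OF W])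
          moreover have "c * norm (f k - f n) \<le> norm (W (f k - f n))"
            by (intro c(2) csubspace_diff closed_subspace_csubspace[OF M'] f(1))
          ultimately have "c * norm (f k - f n) < c * e"
            using N[OF that] by simp
          then show ?thesis
            using c(1) by simp
        qed
        then show "\<exists>N. \<forall>k\<ge>N. \<forall>n\<ge>N. norm (f k - f n) < e"
          by blast
      qed
      then obtain y where y: "f \<longlonglongrightarrow> y"
        using Cauchy_convergent convergent_def by blast
      have yM': "y \<in> M'"
        using closed_sequentially[OF closed_subspace_closed[OF M']] f(1) y by blast
      have "(\<lambda>n. W (m + f n)) \<longlonglongrightarrow> W (m + y)"
        by (intro bounded_linear.tendsto[OF bounded_op_bounded_linear[OF W]] tendsto_intros y)
      then have "W (m + y) = 0"
        using lim0 LIMSEQ_unique by blast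
      moreover have "m + y \<in> M"
        using mM yM' by (auto simp: M'_def intro: csubspace_add[OF sub])
      ultimately have "m + y = 0"
        using insert.prems(3) by blast
      then have "m = 0 - y"
        by (simp add: eq_neg_iff_add_eq_0)
      then have "m \<in> M'"
        using csubspace_diff csubspace_0 closed_subspace_csubspace[OF M'] yM' by metis
      with \<open>m \<notin> M'\<close> show False ..
    qed
    then obtain h where h: "h > 0" "\<And>x. x \<in> M'
        \<Longrightarrow> h \<le> norm (W (m + x))" by blast
    \<comment> \<open>\<open>L\<close> collects two estimates for
      \<open>x = x' + t *\<^sub>C m\<close>: \<open>cmod t\<close> is at most
      \<open>norm (W x) / h\<close>, and \<open>norm x'\<close> is at most
      \<open>(norm (W x) + cmod t * norm (W m)) / c\<close>.\<close>
    define L where "L = (1 + norm (W m) / h) / c + norm m / h"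
    have L: "L > 0"
      unfolding L_def using h(1) c(1) by (intro add_pos_nonneg divide_pos_pos) (auto intro:
          add_pos_nonneg)
    have "norm x \<le> L * norm (W x)" if x: "x \<in> M" for x
    proof -
      define t where "t = cinner x m / cinner m m"
      define x' where "x' = x - t *\<^sub>C m"
      have "cinner x' m = 0"
        using False by (simp add: x'_def t_def cinner_simps)
      moreover have "x' \<in> M"
        unfolding x'_def by (intro csubspace_diff csubspace_scale sub x mM)
      ultimately have x': "x' \<in> M'"
        using xm by (simp add: M'_def orthogonal_complement_def)
      have th: "cmod t * h \<le> norm (W x)"
      proof (cases "t = 0")
        case False
        have "(1 / t) *\<^sub>C x' \<in> M'"
          by (intro csubspace_scale closed_subspace_csubspace M' x')
        from h(2)[OF this] have "h \<le> norm (W (m + (1 / t) *\<^sub>C x'))" .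
        also have "m + (1 / t) *\<^sub>C x' = (1 / t) *\<^sub>C x"
          using False by (simp add: x'_def scaleC_diff_right scaleC_scaleC scaleC_one)
        finally show ?thesis
          using False by (simp add: bounded_op_scaleC[OF W] norm_scaleC norm_divide field_simps)
      qed simp
      then have t: "cmod t \<le> norm (W x) / h"
        using h(1) by (simp add: field_simps)
      have "W x' = W x - t *\<^sub>C W m"
        by (simp add: x'_def bounded_op_diff[OF W] bounded_op_scaleC[OF W])
      then have "c * norm x' \<le> norm (W x) + cmod t * norm (W m)"
        using c(2)[OF x'] norm_triangle_ineq4[of "W x" "t *\<^sub>C W m"] by (simp add: norm_scaleC)
      also have "\<dots> \<le> norm (W x) + norm (W x) / h * norm (W m)"
        using t by (intro add_left_mono mult_right_mono) auto
      finally have nx': "norm x' \<le> (norm (W x) + norm (W x) / h * norm (W m)) / c"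
        using c(1) by (simp add: field_simps)
      have "x = x' + t *\<^sub>C m"
        by (simp add: x'_def)
      then have "norm x \<le> norm x' + cmod t * norm m"
        using norm_triangle_ineq[of x' "t *\<^sub>C m"] by (simp add: norm_scaleC)
      also have "\<dots> \<le> (norm (W x) + norm (W x) / h * norm (W m)) / c + norm (W x) / h *
          norm m"
        using nx' t by (intro add_mono mult_right_mono) auto
      also have "\<dots> = L * norm (W x)"
        by (simp add: L_def add_divide_distrib algebra_simps)
      finally show ?thesis .
    qed
    then show ?thesis
      using L by (intro exI[of _ "1 / L"]) (simp add: field_simps)
  qed
qed

lemma csubspace_subspace: "csubspace M \<Longrightarrow> subspace M"
  by (simp add: subspace_def csubspace_0 csubspace_add csubspace_scaleR)

lemma closed_image_bounded_below:
  assumes W: "bounded_op UNIV UNIV W" and M: "closed_subspace M" and c: "0 < c"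
    and below: "\<And>x. x \<in> M \<Longrightarrow> c * norm x \<le> norm (W x)"
  shows "closed (W ` M)"
  using below
  by (intro complete_imp_closed complete_isometric_image[OF c csubspace_subspace[OF
      closed_subspace_csubspace[OF M]]
      bounded_op_bounded_linear[OF W]])
     (auto simp: complete_eq_closed closed_subspace_closed[OF M])

lemma closed_subspace_null_space:
  assumes "bounded_op UNIV UNIV W"
  shows "closed_subspace (null_space W)"
  unfolding null_space_def closed_subspace_def complex_vector.subspace_def
  using bounded_op_add[OF assms] bounded_op_scaleC[OF assms] bounded_op_zero[OF assms]
  by (auto intro!: closed_Collect_eq continuous_intros linear_continuous_on
      bounded_op_bounded_linear[OF assms])

text \<open>The kernel meets the complement of \<open>B\<close> trivially, hence is finite
  dimensional. On the complement of the kernel \<open>W\<close> is injective, so it is bounded below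
  there, and the image of that complement is the whole range.\<close>

lemma fredholm_if_bounded_below:
  assumes W: "bounded_op UNIV UNIV W" and d: "0 < d" and B: "finite B"
    and below: "\<And>x. x \<in> orthogonal_complement B
        \<Longrightarrow> d * norm x \<le> norm (W x)"
  shows "closed (range W)" "finite_dim (null_space W)"
proof -
  note sub = closed_subspace_null_space[OF W]
  show "finite_dim (null_space W)"
  proof (rule finite_dim_of_orthogonal_trivial(1)[OF closed_subspace_csubspace[OF sub] B])
    fix x assume "x \<in> null_space W" "x \<in> orthogonal_complement B"
    then show "x = 0"
      using below[of x] d by (simp add: null_space_def mult_le_0_iff)
  qed
  define M where "M = orthogonal_complement (null_space W)"
  have M: "closed_subspace M"
    unfolding M_def by (rule closed_subspace_orthogonal_complement)
  have "x = 0" if "x \<in> M" "W x = 0" for x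
    using that orthogonal_complementD[of x "null_space W" x] by (simp add: M_def null_space_def)
  then obtain c where "c > 0" "\<And>x. x \<in> M \<Longrightarrow> c * norm x \<le> norm (W x)"
    using bounded_below_finite_codim[OF W d B M] below by blast
  then have "closed (W ` M)"
    by (rule closed_image_bounded_below[OF W M])
  moreover have "range W = W ` M"
  proof -
    have "W x \<in> W ` M" for x
    proof (rule image_eqI)
      show "W x = W (x - proj (null_space W) x)"
        using proj_in[OF sub, of x] by (simp add: bounded_op_diff[OF W] null_space_def)
      show "x - proj (null_space W) x \<in> M"
        unfolding M_def by (intro orthogonal_complementI cinner_diff_proj sub)
    qed
    then show ?thesis by auto
  qed
  ultimately show "closed (range W)" by simp
qed

text \<open>\<open>q\<close> is the supremum of the form on the unit sphere of \<open>M\<close>. If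
  \<open>q - K\<close> were injective on \<open>M\<close>, compactness of \<open>K\<close> would
  make it bounded below there, and positivity would push the form away from its own
  supremum.\<close>

lemma compact_selfadjoint_eigenvector:
  assumes K: "selfadjoint K" "compact_op K" and M: "closed_subspace M"
      "\<And>x. x \<in> M \<Longrightarrow> K x \<in> M"
    and x0: "x0 \<in> M" "0 < Re (cinner (K x0) x0)"
  shows "\<exists>q>0. (\<exists>e\<in>M. e \<noteq> 0 \<and> K e = q *\<^sub>R e) \<and>
      (\<forall>x\<in>M. Re (cinner (K x) x) \<le> q * (norm x)\<^sup>2)"
proof -
  note K' = selfadjoint_bounded_op[OF K(1)] and sub = closed_subspace_csubspace[OF M(1)]
  define F where "F x = Re (cinner (K x) x)" for x
  have F_scale: "F (r *\<^sub>R x) = r\<^sup>2 * F x" for r x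
    by (simp add: F_def bounded_op_scaleR[OF K'] cinner_simps power2_eq_square)
  define U where "U = {x\<in>M. norm x = 1}"
  define q where "q = (SUP x\<in>U. F x)"
  obtain k where k: "\<And>x. norm (K x) \<le> k * norm x"
    using K' by (auto simp: bounded_op_UNIV_iff)
  have "F x \<le> k" if "x \<in> U" for x
    using complex_Re_le_cmod[of "cinner (K x) x"] cinner_cauchy_schwarz[of "K x" x] k[of x] that
    by (simp add: F_def U_def)
  then have bdd: "bdd_above (F ` U)"
    by (rule bdd_aboveI2)
  have unit: "(1 / norm x) *\<^sub>R x \<in> U" if "x \<in> M" "x \<noteq> 0" for x
    using that by (simp add: U_def csubspace_scaleR[OF sub])
  have Fq: "F x \<le> q * (norm x)\<^sup>2" if "x \<in> M" for x
  proof (cases "x = 0")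
    case False
    have "F ((1 / norm x) *\<^sub>R x) \<le> q"
      unfolding q_def by (rule cSUP_upper[OF unit[OF that False] bdd])
    then show ?thesis
      using False by (simp add: F_scale field_simps)
  qed (simp add: F_def)
  have "x0 \<noteq> 0"
    using x0(2) by auto
  then have ne: "U \<noteq> {}"
    using unit[OF x0(1)] by blast
  have q: "q > 0"
    using Fq[OF x0(1)] x0(2) \<open>x0 \<noteq> 0\<close>
        by (simp add: F_def) (smt (verit) mult_nonpos_nonneg zero_le_power2)
  define G where "G = (\<lambda>x. (-1) *\<^sub>R (K x - q *\<^sub>R x))"
  have G: "selfadjoint G"
    unfolding G_def by (intro selfadjoint_scaleR selfadjoint_diff_scaleR K)
  note G' = selfadjoint_bounded_op[OF G]
  have ReG: "Re (cinner (G x) x) = q * (norm x)\<^sup>2 - F x" for x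
    by (simp add: G_def F_def cinner_simps Re_cinner_self)
  have GM: "G x \<in> M" if "x \<in> M" for x
    unfolding G_def by (intro csubspace_scaleR csubspace_diff sub M that)
  have "\<exists>e\<in>M. e \<noteq> 0 \<and> G e = 0"
  proof (rule ccontr)
    assume "\<not> ?thesis"
    then have inj: "\<And>x. x \<in> M \<Longrightarrow> G x = 0 \<Longrightarrow> x = 0" by blast
    obtain C where C: "finite C" "\<And>x. x \<in> orthogonal_complement C
        \<Longrightarrow> norm (K x) \<le> (q / 2) * norm x"
      using compact_opD[OF K(2), of "q / 2"] q by auto
    have "(q / 2) * norm x \<le> norm (G x)" if "x \<in> orthogonal_complement C" for x
      using C(2)[OF that] norm_triangle_ineq2[of "q *\<^sub>R x" "K x"] q by (simp add: G_def)
    then have "\<exists>c>0. \<forall>x\<in>M. c * norm x \<le> norm (G x)"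
      by (intro bounded_below_finite_codim[OF G' half_gt_zero[OF q] C(1) M(1) _ inj])
    then obtain c where c: "c > 0" "\<And>x. x \<in> M
        \<Longrightarrow> c * norm x \<le> norm (G x)"
      by auto
    obtain g where g: "\<And>x. norm (G x) \<le> g * norm x"
      using G' by (auto simp: bounded_op_UNIV_iff)
    define g' where "g' = max g 1"
    have g': "g' > 0" "norm (G x) \<le> g' * norm x" for x
      using g[of x] mult_right_mono[of g g' "norm x"] by (auto simp: g'_def)
    \<comment> \<open>Cauchy-Schwarz for the form of \<open>G\<close> at \<open>x\<close> and
      \<open>G x\<close> turns the lower bound on \<open>norm (G x)\<close> into a lower bound on
      \<open>cinner (G x) x\<close>, that is, on \<open>q - F x\<close>.\<close>
    have up: "F x \<le> q - c\<^sup>2 / g'" if "x \<in> U" for x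
    proof -
      have x: "x \<in> M" "norm x = 1"
        using that by (auto simp: U_def)
      have Gx: "G x \<noteq> 0"
        using c(2)[OF x(1)] c(1) x(2) by auto
      have pos: "0 \<le> Re (cinner (G w) w)" if "w \<in> M" for w
        using Fq[OF that] by (simp add: ReG)
      have "((norm (G x))\<^sup>2)\<^sup>2 = (cmod (cinner (G x) (G x)))\<^sup>2"
        by (simp add: cinner_self norm_power)
      also have "\<dots> \<le> Re (cinner (G x) x) * Re (cinner (G (G x)) (G x))"
        by (rule cauchy_schwarz_form[OF G sub pos x(1) GM[OF x(1)]])
      also have "\<dots> \<le> Re (cinner (G x) x) * (g' * (norm (G x))\<^sup>2)"
      proof (intro mult_left_mono pos x)
        have "Re (cinner (G (G x)) (G x)) \<le> norm (G (G x)) * norm (G x)"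
          using complex_Re_le_cmod cinner_cauchy_schwarz order_trans by blast
        also have "\<dots> \<le> g' * norm (G x) * norm (G x)"
          by (intro mult_right_mono g') simp
        finally show "Re (cinner (G (G x)) (G x)) \<le> g' * (norm (G x))\<^sup>2"
          by (simp add: power2_eq_square mult_ac)
      qed
      finally have "(norm (G x))\<^sup>2 * (norm (G x))\<^sup>2 \<le> (Re (cinner (G x) x) * g') *
          (norm (G x))\<^sup>2"
        by (simp add: power2_eq_square mult_ac)
      then have "(norm (G x))\<^sup>2 \<le> Re (cinner (G x) x) * g'"
        using Gx by (subst (asm) mult_le_cancel_right_pos) auto
      moreover have "c\<^sup>2 \<le> (norm (G x))\<^sup>2"
        using c(2)[OF x(1)] c(1) x(2) by (intro power_mono) auto
      ultimately have "c\<^sup>2 \<le> (q - F x) * g'"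
        by (simp add: ReG x(2))
      then show ?thesis
        using g'(1) by (simp add: field_simps)
    qed
    have "q \<le> q - c\<^sup>2 / g'"
      unfolding q_def[symmetric] by (subst (1) q_def) (intro cSUP_least ne up)
    moreover have "0 < c\<^sup>2 / g'"
      using c(1) g'(1) by simp
    ultimately show False
      by linarith
  qed
  then obtain e where e: "e \<in> M" "e \<noteq> 0" "K e = q *\<^sub>R e"
    by (auto simp: G_def)
  then show ?thesis
    using q Fq by (auto simp: F_def)
qed

section \<open>Square roots of positive operators\<close>

lemma selfadjoint_cinner_real:
  assumes "selfadjoint S"
  shows "cinner (S x) x \<in> \<real>"
  using cinner_commute[of "S x" x] selfadjoint_cinner[OF assms, of x x]
  by (simp add: Reals_cnj_iff)

text \<open>Symmetry comes from reality of the form at \<open>x + y\<close> and at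
  \<open>x + \<i> *\<^sub>C y\<close>: the first compares imaginary parts, the second real
  parts.\<close>

lemma positive_on_UNIV_iff:
  "positive_on UNIV S \<longleftrightarrow> selfadjoint S \<and> (\<forall>x. 0 \<le> Re (cinner
      (S x) x))"
proof
  assume S: "positive_on UNIV S"
  then have S': "bounded_op UNIV UNIV S"
    by (simp add: positive_on_def)
  have real: "Im (cinner (S x) x) = 0" for x
    using S by (simp add: positive_on_def complex_is_Real_iff)
  have "cinner (S x) y = cinner x (S y)" for x y
  proof -
    define a b where "a = cinner (S x) y" and "b = cinner (S y) x"
    have "Im a + Im b = 0"
      using real[of "x + y"] real[of x] real[of y]
      by (simp add: bounded_op_add[OF S'] cinner_simps a_def b_def)
    moreover have "Re b = Re a"
      using real[of "x + \<i> *\<^sub>C y"] real[of x] real[of y]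
      by (simp add: bounded_op_add[OF S'] bounded_op_scaleC[OF S'] cinner_simps a_def b_def)
    ultimately have "a = cnj b"
      by (simp add: complex_eq_iff)
    then show ?thesis
      by (metis a_def b_def cinner_commute)
  qed
  then show "selfadjoint S \<and> (\<forall>x. 0 \<le> Re (cinner (S x) x))"
    using S by (simp add: selfadjoint_def positive_on_def)
next
  assume "selfadjoint S \<and> (\<forall>x. 0 \<le> Re (cinner (S x) x))"
  then show "positive_on UNIV S"
    by (simp add: positive_on_def selfadjoint_bounded_op selfadjoint_cinner_real)
qed

lemma positive_form_null:
  assumes "selfadjoint S" "\<And>x. 0 \<le> Re (cinner (S x) x)" "Re (cinner (S x) x) \<le> 0"
  shows "S x = 0"
  using csubspace_form_null[OF assms(1) complex_vector.subspace_UNIV assms(2) UNIV_I assms(3)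
      UNIV_I, of "S x"]
  by simp

text \<open>Fixed-point iteration for \<open>Y = 1 - sqrt (1 - A)\<close>, that is \<open>2 * Y =
    A + Y * Y\<close>; its scalar
  version with \<open>A = 1\<close> dominates the increments.\<close>

primrec sqrt_iter :: "('a :: complex_hilbert \<Rightarrow> 'a) \<Rightarrow> nat \<Rightarrow> 'a
    \<Rightarrow> 'a" where
  "sqrt_iter A 0 = (\<lambda>x. 0)"
| "sqrt_iter A (Suc n) = (\<lambda>x. (1/2) *\<^sub>R (A x + sqrt_iter A n (sqrt_iter A n x)))"

primrec sqrt_iter_bound :: "nat \<Rightarrow> real" where
  "sqrt_iter_bound 0 = 0"
| "sqrt_iter_bound (Suc n) = (1 + (sqrt_iter_bound n)\<^sup>2) / 2"

lemma sqrt_iter_bound_range: "0 \<le> sqrt_iter_bound n \<and> sqrt_iter_bound n \<le> 1"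
  by (induction n) (auto simp: power2_eq_square mult_le_one)

lemma sqrt_iter_bound_Suc: "sqrt_iter_bound n \<le> sqrt_iter_bound (Suc n)"
proof -
  have "sqrt_iter_bound (Suc n) - sqrt_iter_bound n = (1 - sqrt_iter_bound n)\<^sup>2 / 2"
    by (simp add: power2_eq_square field_simps)
  then show ?thesis
    using zero_le_power2[of "1 - sqrt_iter_bound n"] by linarith
qed

context
  fixes A :: "'a :: complex_hilbert \<Rightarrow> 'a"
  assumes A: "selfadjoint A" and A_le: "\<And>x. norm (A x) \<le> norm x"
begin

lemma sqrt_iter_bounded:
  "bounded_op UNIV UNIV (sqrt_iter A n) \<and> (\<forall>x. norm (sqrt_iter A n x) \<le>
      sqrt_iter_bound n * norm x)"
proof (induction n)
  case 0
  show ?case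
    by (auto simp: bounded_op_UNIV_iff intro: exI[of _ 0])
next
  case (Suc n)
  note A' = selfadjoint_bounded_op[OF A] and IH = conjunct1[OF Suc.IH] spec[OF conjunct2[OF Suc.IH]]
  have bound: "norm (sqrt_iter A (Suc n) x) \<le> sqrt_iter_bound (Suc n) * norm x" for x
  proof -
    have "norm (sqrt_iter A n (sqrt_iter A n x)) \<le> sqrt_iter_bound n * (sqrt_iter_bound n *
        norm x)"
      using IH(2)[of "sqrt_iter A n x"] mult_left_mono[OF IH(2)[of x], of "sqrt_iter_bound n"]
        sqrt_iter_bound_range[of n] by linarith
    then have "norm (A x + sqrt_iter A n (sqrt_iter A n x)) \<le> (1 + (sqrt_iter_bound
        n)\<^sup>2) * norm x"
      using norm_triangle_ineq[of "A x" "sqrt_iter A n (sqrt_iter A n x)"] A_le[of x]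
      by (simp add: power2_eq_square algebra_simps)
    then show ?thesis by simp
  qed
  have "sqrt_iter A (Suc n) (x + y) = sqrt_iter A (Suc n) x + sqrt_iter A (Suc n) y" for x y
    by (simp add: bounded_op_add[OF A'] bounded_op_add[OF IH(1)] scaleR_add_right)
  moreover have "sqrt_iter A (Suc n) (c *\<^sub>C x) = c *\<^sub>C sqrt_iter A (Suc n) x" for c x
    by (simp add: bounded_op_scaleC[OF A'] bounded_op_scaleC[OF IH(1)] scaleC_scaleR_commute
        flip: scaleC_add_right)
  ultimately show ?case
    using bound unfolding bounded_op_UNIV_iff by blast
qed

lemmas bounded_op_sqrt_iter = conjunct1[OF sqrt_iter_bounded]
lemmas norm_sqrt_iter = spec[OF conjunct2[OF sqrt_iter_bounded]]

lemma sqrt_iter_cinner: "cinner (sqrt_iter A n x) y = cinner x (sqrt_iter A n y)"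
  by (induction n arbitrary: x y) (simp_all add: cinner_simps selfadjoint_cinner[OF A])

lemma sqrt_iter_commute:
  assumes C: "bounded_op UNIV UNIV C" and comm: "\<And>x. C (A x) = A (C x)"
  shows "C (sqrt_iter A n x) = sqrt_iter A n (C x)"
  by (induction n arbitrary: x)
     (simp_all add: bounded_op_zero[OF C] bounded_op_scaleR[OF C] bounded_op_add[OF C] comm)

lemma sqrt_iter_commute': "sqrt_iter A m (sqrt_iter A n x) = sqrt_iter A n (sqrt_iter A m x)"
  by (rule sqrt_iter_commute[OF bounded_op_sqrt_iter])
     (rule sqrt_iter_commute[OF selfadjoint_bounded_op[OF A] refl, symmetric])

text \<open>Consecutive iterates commute, so a difference of squares factors as sum times
  difference. The scalar recursion factors in the same way, so the bound reproduces itself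
  exactly.\<close>

lemma norm_sqrt_iter_diff:
  "norm (sqrt_iter A (Suc n) x - sqrt_iter A n x) \<le> (sqrt_iter_bound (Suc n) - sqrt_iter_bound
      n) * norm x"
proof (induction n arbitrary: x)
  case 0
  then show ?case using A_le[of x] by simp
next
  case (Suc n)
  define Y Z where "Y = sqrt_iter A (Suc n)" and "Z = sqrt_iter A n"
  define y z where "y = sqrt_iter_bound (Suc n)" and "z = sqrt_iter_bound n"
  have Y: "bounded_op UNIV UNIV Y" and Z: "bounded_op UNIV UNIV Z"
    unfolding Y_def Z_def by (rule bounded_op_sqrt_iter)+
  have bY: "norm (Y w) \<le> y * norm w" and bZ: "norm (Z w) \<le> z * norm w" for w
    unfolding Y_def Z_def y_def z_def by (rule norm_sqrt_iter)+
  define w where "w = Y x - Z x"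
  have w: "norm w \<le> (y - z) * norm x"
    unfolding w_def Y_def Z_def y_def z_def by (rule Suc.IH)
  have yz: "0 \<le> y + z"
    using sqrt_iter_bound_range[of n] sqrt_iter_bound_range[of "Suc n"] by (simp add: y_def z_def)
  have "Y (Z x) = Z (Y x)"
    unfolding Y_def Z_def by (rule sqrt_iter_commute')
  then have "Y w + Z w = Y (Y x) - Z (Z x)"
    by (simp add: w_def bounded_op_diff[OF Y] bounded_op_diff[OF Z])
  moreover have "sqrt_iter A (Suc (Suc n)) x - sqrt_iter A (Suc n) x = (1/2) *\<^sub>R (Y (Y x) -
      Z (Z x))"
    unfolding sqrt_iter.simps(2)[of A "Suc n"] Y_def[symmetric]
    by (subst (3) Y_def) (simp add: Z_def[symmetric] algebra_simps)
  ultimately have eq: "sqrt_iter A (Suc (Suc n)) x - sqrt_iter A (Suc n) x = (1/2) *\<^sub>R (Y w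
      + Z w)"
    by simp
  have "norm (Y w + Z w) \<le> (y + z) * norm w"
    using norm_triangle_ineq[of "Y w" "Z w"] bY[of w] bZ[of w] by (simp add: algebra_simps)
  also have "\<dots> \<le> (y + z) * ((y - z) * norm x)"
    by (intro mult_left_mono w yz)
  finally have "norm (sqrt_iter A (Suc (Suc n)) x - sqrt_iter A (Suc n) x) \<le> (1/2) * ((y + z)
      * ((y - z) * norm x))"
    unfolding eq by simp
  also have "\<dots> = (sqrt_iter_bound (Suc (Suc n)) - y) * norm x"
  proof -
    have "sqrt_iter_bound (Suc (Suc n)) - y = (1 + y\<^sup>2) / 2 - (1 + z\<^sup>2) / 2"
      by (simp add: y_def z_def)
    also have "\<dots> = (1/2) * ((y + z) * (y - z))"
      by (simp add: power2_eq_square field_simps)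
    finally show ?thesis by (simp only: mult.assoc)
  qed
  finally show ?case by (simp add: y_def)
qed

lemma norm_sqrt_iter_diff_le:
  "m \<le> n \<Longrightarrow> norm (sqrt_iter A n x - sqrt_iter A m x) \<le> (sqrt_iter_bound n -
      sqrt_iter_bound m) * norm x"
proof (induction n rule: dec_induct)
  case (step n)
  then show ?case
    using norm_sqrt_iter_diff[of n x]
      norm_triangle_ineq[of "sqrt_iter A (Suc n) x - sqrt_iter A n x" "sqrt_iter A n x - sqrt_iter
          A m x"]
    by (simp add: left_diff_distrib)
qed simp

definition sqrt_limit :: "'a \<Rightarrow> 'a" where
  "sqrt_limit x = lim (\<lambda>n. sqrt_iter A n x)"

lemma sqrt_limit: "(\<lambda>n. sqrt_iter A n x) \<longlonglongrightarrow> sqrt_limit x"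
proof -
  have "incseq sqrt_iter_bound"
    by (intro incseq_SucI sqrt_iter_bound_Suc)
  then obtain L where "sqrt_iter_bound \<longlonglongrightarrow> L"
    using incseq_convergent[of sqrt_iter_bound 1] sqrt_iter_bound_range by blast
  then have cau: "Cauchy sqrt_iter_bound"
    by (rule LIMSEQ_imp_Cauchy)
  have "Cauchy (\<lambda>n. sqrt_iter A n x)"
  proof (rule CauchyI)
    fix e :: real assume e: "0 < e"
    define e' where "e' = e / (norm x + 1)"
    have e': "e' > 0" using e by (simp add: e'_def add_nonneg_pos)
    obtain N where N: "\<And>m n. m \<ge> N \<Longrightarrow> n \<ge> N
        \<Longrightarrow> norm (sqrt_iter_bound m - sqrt_iter_bound n) < e'"
      using CauchyD[OF cau e'] by blast
    have *: "norm (sqrt_iter A n x - sqrt_iter A m x) < e" if mn: "N \<le> m" "m \<le> n" for m n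
    proof -
      have "(sqrt_iter_bound n - sqrt_iter_bound m) * norm x \<le> e' * norm x"
        using N[of n m] mn by (intro mult_right_mono) auto
      also have "\<dots> < e' * (norm x + 1)"
        using e' by simp
      also have "\<dots> = e"
        using norm_ge_zero[of x] by (simp add: e'_def add_nonneg_eq_0_iff)
      finally show ?thesis
        using norm_sqrt_iter_diff_le[OF mn(2), of x] by linarith
    qed
    show "\<exists>N. \<forall>m\<ge>N. \<forall>n\<ge>N. norm (sqrt_iter A m x - sqrt_iter A n x)
        < e"
    proof (intro exI[of _ N] allI impI)
      fix m n assume "N \<le> m" "N \<le> n"
      then show "norm (sqrt_iter A m x - sqrt_iter A n x) < e"
        using *[of m n] *[of n m] by (cases "m \<le> n") (auto simp: norm_minus_commute)
    qed
  qed
  then show ?thesis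
    unfolding sqrt_limit_def by (simp add: Cauchy_convergent convergent_LIMSEQ_iff[symmetric])
qed

lemma norm_sqrt_limit: "norm (sqrt_limit x) \<le> norm x"
proof (rule LIMSEQ_le_const2[OF tendsto_norm[OF sqrt_limit]])
  have "norm (sqrt_iter A n x) \<le> norm x" for n
    using norm_sqrt_iter[of n x] mult_right_mono[of "sqrt_iter_bound n" 1 "norm x"]
      sqrt_iter_bound_range[of n] by simp
  then show "\<exists>N. \<forall>n\<ge>N. norm (sqrt_iter A n x) \<le> norm x"
    by blast
qed

lemma selfadjoint_sqrt_limit: "selfadjoint sqrt_limit"
proof -
  have "sqrt_limit (x + y) = sqrt_limit x + sqrt_limit y" for x y
    using sqrt_limit[of "x + y"] tendsto_add[OF sqrt_limit[of x] sqrt_limit[of y]]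
    by (simp add: bounded_op_add[OF bounded_op_sqrt_iter] LIMSEQ_unique)
  moreover have "sqrt_limit (c *\<^sub>C x) = c *\<^sub>C sqrt_limit x" for c x
  proof -
    from bounded_linear.tendsto[OF bounded_op_bounded_linear[OF bounded_op_scaleC_self[of c]] sqrt_limit[of x]]
    show ?thesis
      using sqrt_limit[of "c *\<^sub>C x"]
      by (simp add: bounded_op_scaleC[OF bounded_op_sqrt_iter] LIMSEQ_unique)
  qed
  moreover have "cinner (sqrt_limit x) y = cinner x (sqrt_limit y)" for x y
    using cinner.tendsto[OF sqrt_limit[of x] tendsto_const[of y]]
      cinner.tendsto[OF tendsto_const[of x] sqrt_limit[of y]]
    by (simp add: sqrt_iter_cinner LIMSEQ_unique)
  ultimately show ?thesis
    using norm_sqrt_limit by (auto simp: selfadjoint_def bounded_op_UNIV_iff intro!: exI[of _ 1])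
qed

lemma sqrt_limit_commute:
  assumes "bounded_op UNIV UNIV C" "\<And>x. C (A x) = A (C x)"
  shows "C (sqrt_limit x) = sqrt_limit (C x)"
  using bounded_linear.tendsto[OF bounded_op_bounded_linear[OF assms(1)] sqrt_limit[of x]]
    sqrt_limit[of "C x"]
  by (simp add: sqrt_iter_commute[OF assms] LIMSEQ_unique)

lemma sqrt_limit_square: "2 *\<^sub>R sqrt_limit x = A x + sqrt_limit (sqrt_limit x)"
proof -
  \<comment> \<open>The iterates are contractions, so pointwise convergence passes to their
    composition with themselves.\<close>
  have "(\<lambda>n. sqrt_iter A n (sqrt_iter A n x - sqrt_limit x)) \<longlonglongrightarrow> 0"
  proof (rule Lim_null_comparison)
    show "\<forall>\<^sub>F n in sequentially. norm (sqrt_iter A n (sqrt_iter A n x - sqrt_limit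
        x)) \<le>
        norm (sqrt_iter A n x - sqrt_limit x)"
    proof (intro always_eventually allI)
      fix n
      show "norm (sqrt_iter A n (sqrt_iter A n x - sqrt_limit x)) \<le> norm (sqrt_iter A n x -
          sqrt_limit x)"
        using norm_sqrt_iter[of n "sqrt_iter A n x - sqrt_limit x"]
          mult_right_mono[of "sqrt_iter_bound n" 1 "norm (sqrt_iter A n x - sqrt_limit x)"]
          sqrt_iter_bound_range[of n] by simp
    qed
    show "(\<lambda>n. norm (sqrt_iter A n x - sqrt_limit x)) \<longlonglongrightarrow> 0"
      using tendsto_norm[OF tendsto_diff[OF sqrt_limit[of x] tendsto_const[of "sqrt_limit x"]]] by
          simp
  qed
  from tendsto_add[OF this sqrt_limit[of "sqrt_limit x"]]
  have "(\<lambda>n. sqrt_iter A n (sqrt_iter A n x)) \<longlonglongrightarrow> sqrt_limit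
      (sqrt_limit x)"
    by (simp add: bounded_op_diff[OF bounded_op_sqrt_iter])
  then have "(\<lambda>n. sqrt_iter A (Suc n) x) \<longlonglongrightarrow> (1/2) *\<^sub>R (A x +
      sqrt_limit (sqrt_limit x))"
    by (auto intro!: tendsto_intros)
  moreover have "(\<lambda>n. sqrt_iter A (Suc n) x) \<longlonglongrightarrow> sqrt_limit x"
    using sqrt_limit by (rule LIMSEQ_Suc)
  ultimately have "sqrt_limit x = (1/2) *\<^sub>R (A x + sqrt_limit (sqrt_limit x))"
    using LIMSEQ_unique by blast
  then show ?thesis
    by (metis scaleR_scaleR scaleR_one mult_numeral_1_right numeral_One times_divide_eq_right
        nonzero_mult_div_cancel_left zero_neq_numeral)
qed

end

text \<open>Dividing by a bound \<open>b\<close> makes \<open>A\<close>, the identity minus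
  \<open>P / b\<close>, a contraction; if \<open>Y\<close> is the limit of the iteration for
  \<open>A\<close>, then \<open>sqrt b\<close> times the identity minus \<open>Y\<close> is a root.
  Commuting with everything that commutes with \<open>P\<close> is recorded because uniqueness
  depends on it.\<close>

lemma positive_sqrt_exists:
  assumes P: "selfadjoint P" and pos: "\<And>x. 0 \<le> Re (cinner (P x) x)"
  shows "\<exists>S. selfadjoint S \<and> (\<forall>x. 0 \<le> Re (cinner (S x) x)) \<and>
      (\<forall>x. S (S x) = P x) \<and>
    (\<forall>C x. bounded_op UNIV UNIV C \<longrightarrow> (\<forall>x. C (P x) = P (C x))
        \<longrightarrow> C (S x) = S (C x))"
proof -
  note P' = selfadjoint_bounded_op[OF P]
  obtain k where k: "\<And>x. norm (P x) \<le> k * norm x"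
    using P' by (auto simp: bounded_op_UNIV_iff)
  define b where "b = max k 1"
  have b: "b > 0" "norm (P x) \<le> b * norm x" for x
    using k[of x] mult_right_mono[of k b "norm x"] by (auto simp: b_def)
  define A where "A = (\<lambda>x. (-1) *\<^sub>R ((1 / b) *\<^sub>R P x - 1 *\<^sub>R x))"
  have A: "selfadjoint A"
    unfolding A_def by (intro selfadjoint_scaleR selfadjoint_diff_scaleR P)
  have A_eq: "A x = x - (1 / b) *\<^sub>R P x" for x
    by (simp add: A_def)
  have "\<bar>Re (cinner (A w) w)\<bar> \<le> 1 * (norm w)\<^sup>2" for w
  proof -
    have "Re (cinner (P w) w) \<le> norm (P w) * norm w"
      using complex_Re_le_cmod cinner_cauchy_schwarz order_trans by blast
    also have "\<dots> \<le> b * norm w * norm w"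
      by (intro mult_right_mono b) simp
    finally have "Re (cinner (P w) w) / b \<le> (norm w)\<^sup>2"
      using b(1) by (simp add: field_simps power2_eq_square)
    moreover have "0 \<le> Re (cinner (P w) w) / b"
      using pos[of w] b(1) by simp
    ultimately show ?thesis
      by (simp add: A_eq cinner_simps Re_cinner_self)
  qed
  then have A_le: "norm (A x) \<le> norm x" for x
    using selfadjoint_norm_le_of_form[OF A complex_vector.subspace_UNIV, of x 1] by simp
  define Y where "Y = sqrt_limit A"
  have Y: "selfadjoint Y"
    unfolding Y_def by (rule selfadjoint_sqrt_limit[OF A A_le])
  note Y' = selfadjoint_bounded_op[OF Y]
  have Y2: "2 *\<^sub>R Y x = A x + Y (Y x)" for x
    unfolding Y_def by (rule sqrt_limit_square[OF A A_le])
  define S where "S = (\<lambda>x. (- sqrt b) *\<^sub>R (Y x - 1 *\<^sub>R x))"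
  have S: "selfadjoint S"
    unfolding S_def by (intro selfadjoint_scaleR selfadjoint_diff_scaleR Y)
  have S_eq: "S x = sqrt b *\<^sub>R (x - Y x)" for x
    by (simp add: S_def algebra_simps)
  have "0 \<le> Re (cinner (S x) x)" for x
  proof -
    have "Re (cinner (Y x) x) \<le> norm (Y x) * norm x"
      using complex_Re_le_cmod cinner_cauchy_schwarz order_trans by blast
    also have "\<dots> \<le> norm x * norm x"
      unfolding Y_def by (intro mult_right_mono norm_sqrt_limit A A_le) simp
    finally show ?thesis
      using b(1) by (simp add: S_eq cinner_simps Re_cinner_self power2_eq_square)
  qed
  moreover have "S (S x) = P x" for x
  proof -
    have "S (S x) = (sqrt b * sqrt b) *\<^sub>R (x - 2 *\<^sub>R Y x + Y (Y x))"
      by (simp add: S_eq bounded_op_scaleR[OF Y'] bounded_op_diff[OF Y'] scaleR_diff_right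
          scaleR_add_right scaleR_2)
    also have "\<dots> = b *\<^sub>R (x - A x)"
      using b(1) by (simp add: Y2)
    also have "\<dots> = P x"
      using b(1) by (simp add: A_eq)
    finally show ?thesis .
  qed
  moreover have "C (S x) = S (C x)" if C: "bounded_op UNIV UNIV C"
      "\<And>x. C (P x) = P (C x)" for C x
  proof -
    have "C (A x) = A (C x)" for x
      by (simp add: A_eq bounded_op_diff[OF C(1)] bounded_op_scaleR[OF C(1)] C(2))
    then have "C (Y x) = Y (C x)"
      unfolding Y_def by (intro sqrt_limit_commute[OF A A_le] C)
    then show ?thesis
      by (simp add: S_eq bounded_op_diff[OF C(1)] bounded_op_scaleR[OF C(1)])
  qed
  ultimately show ?thesis
    using S by blast
qed

text \<open>This makes the definite description in \<open>sqrt_op\<close> meaningful. A second root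
  \<open>R\<close> commutes with \<open>P\<close>, hence with \<open>S\<close>, so
  \<open>R + S\<close> kills \<open>y = R x - S x\<close>. Positivity splits this into
  \<open>R y = 0\<close> and \<open>S y = 0\<close>, and symmetry gives
  \<open>cinner y y = 0\<close>.\<close>

lemma sqrt_op_properties:
  assumes P: "selfadjoint P" and pos: "\<And>x. 0 \<le> Re (cinner (P x) x)"
  shows "positive_on UNIV (sqrt_op P) \<and> sqrt_op P \<circ> sqrt_op P = P"
proof -
  obtain S where S: "selfadjoint S" "\<And>x. 0 \<le> Re (cinner (S x) x)" "\<And>x. S (S x) = P x"
    and comm: "\<And>C x. bounded_op UNIV UNIV C \<Longrightarrow> (\<And>x. C (P x) = P (C x))
        \<Longrightarrow> C (S x) = S (C x)"
    using positive_sqrt_exists[OF P pos] by blast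
  have "R = S" if R: "positive_on UNIV R" "R \<circ> R = P" for R
  proof
    fix x
    have R1: "selfadjoint R" "\<And>x. 0 \<le> Re (cinner (R x) x)"
      using R(1) by (auto simp: positive_on_UNIV_iff)
    have RR: "R (R x) = P x" for x
      using R(2) by (metis comp_apply)
    note R' = selfadjoint_bounded_op[OF R1(1)] and S' = selfadjoint_bounded_op[OF S(1)]
    have RS: "R (S x) = S (R x)" for x
      by (rule comm[OF R']) (simp flip: RR)
    define y where "y = R x - S x"
    have "R y + S y = 0"
      by (simp add: y_def bounded_op_diff[OF R'] bounded_op_diff[OF S'] RR S(3) RS)
    then have "Re (cinner (R y) y) + Re (cinner (S y) y) = 0"
      by (metis cinner_add_left cinner_zero_left plus_complex.sel(1) zero_complex.sel(1))
    with R1(2)[of y] S(2)[of y] have "R y = 0" "S y = 0"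
      by (auto intro!: positive_form_null[OF R1] positive_form_null[OF S(1,2)])
    then have "cinner y y = 0"
      using selfadjoint_cinner[OF R1(1), of x y] selfadjoint_cinner[OF S(1), of x y]
      by (simp add: y_def cinner_simps)
    then show "R x = S x"
      by (simp add: y_def)
  qed
  then have "\<exists>!R. positive_on UNIV R \<and> R \<circ> R = P"
    using S by (intro ex1I[of _ S]) (auto simp: positive_on_UNIV_iff)
  then show ?thesis
    unfolding sqrt_op_def by (rule theI')
qed

context
  fixes A :: "'a :: complex_hilbert \<Rightarrow> 'a"
  assumes A: "bounded_op UNIV UNIV A"
begin

lemma abs_op_properties:
  "positive_on UNIV (abs_op A) \<and> abs_op A \<circ> abs_op A = adj UNIV A \<circ> A"
  unfolding abs_op_def
  using selfadjoint_adj_compose(1)[OF A]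
  by (intro sqrt_op_properties) (simp_all add: comp_def cinner_adj_left[OF A] Re_cinner_self)

lemma selfadjoint_abs_op: "selfadjoint (abs_op A)"
  and abs_op_nonneg: "0 \<le> Re (cinner (abs_op A x) x)"
  and abs_op_abs_op: "abs_op A (abs_op A x) = adj UNIV A (A x)"
  using abs_op_properties by (auto simp: positive_on_UNIV_iff fun_eq_iff)

lemma norm_abs_op: "norm (abs_op A x) = norm (A x)"
proof -
  have "cinner (abs_op A x) (abs_op A x) = cinner (A x) (A x)"
    by (simp flip: selfadjoint_cinner[OF selfadjoint_abs_op] add: abs_op_abs_op cinner_adj_left[OF
        A])
  then have "(norm (abs_op A x))\<^sup>2 = (norm (A x))\<^sup>2"
    by (metis Re_cinner_self)
  then show ?thesis
    by simp
qed

end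

text \<open>For positive \<alpha> one factors the hypothesis as \<open>S + \<alpha>\<close> applied
  to \<open>S - \<alpha>\<close>, the first factor being bounded below by \<alpha>. For \<alpha>
  equal to 0 the square of \<open>norm (S x)\<close> is at most
  \<open>norm (S (S x)) * norm x\<close>, hence the tolerance \<open>e\<^sup>2\<close>.\<close>

lemma compact_op_sqrt:
  assumes S: "selfadjoint S" "\<And>x. 0 \<le> Re (cinner (S x) x)" and \<alpha>: "0 \<le> \<alpha>"
    and K: "compact_op (\<lambda>x. S (S x) - \<alpha>\<^sup>2 *\<^sub>R x)"
  shows "compact_op (\<lambda>x. S x - \<alpha> *\<^sub>R x)"
  unfolding compact_op_def
proof (intro allI impI)
  fix e :: real assume e: "0 < e"
  note S' = selfadjoint_bounded_op[OF S(1)]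
  show "\<exists>C. finite C \<and> (\<forall>x\<in>orthogonal_complement C. norm (S x - \<alpha>
      *\<^sub>R x) \<le> e * norm x)"
  proof (cases "\<alpha> = 0")
    case True
    obtain C where C: "finite C" "\<And>x. x \<in> orthogonal_complement C
        \<Longrightarrow> norm (S (S x)) \<le> e\<^sup>2 * norm x"
      using compact_opD[OF K, of "e\<^sup>2"] e True by auto
    have "norm (S x) \<le> e * norm x" if "x \<in> orthogonal_complement C" for x
    proof -
      have "(norm (S x))\<^sup>2 = Re (cinner (S (S x)) x)"
        by (simp add: selfadjoint_cinner[OF S(1), of "S x"] Re_cinner_self)
      also have "\<dots> \<le> norm (S (S x)) * norm x"
        using complex_Re_le_cmod cinner_cauchy_schwarz order_trans by blast
      also have "\<dots> \<le> e\<^sup>2 * norm x * norm x"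
        by (intro mult_right_mono C(2) that) simp
      finally have "(norm (S x))\<^sup>2 \<le> (e * norm x)\<^sup>2"
        by (simp add: power2_eq_square mult_ac)
      then show ?thesis
        using e by (meson power2_le_imp_le less_imp_le mult_nonneg_nonneg norm_ge_zero)
    qed
    then show ?thesis
      using C(1) True by auto
  next
    case False
    then have \<alpha>0: "0 < \<alpha>" using \<alpha> by simp
    obtain C where C: "finite C"
      "\<And>x. x \<in> orthogonal_complement C \<Longrightarrow> norm (S (S x) - \<alpha>\<^sup>2
          *\<^sub>R x) \<le> (\<alpha> * e) * norm x"
      using compact_opD[OF K, of "\<alpha> * e"] e \<alpha>0 by auto
    have "norm (S x - \<alpha> *\<^sub>R x) \<le> e * norm x"
        if "x \<in> orthogonal_complement C" for x
    proof -
      define y where "y = S x - \<alpha> *\<^sub>R x"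
      have Sy: "S y + \<alpha> *\<^sub>R y = S (S x) - \<alpha>\<^sup>2 *\<^sub>R x"
        by (simp add: y_def bounded_op_diff[OF S'] bounded_op_scaleR[OF S'] power2_eq_square
            algebra_simps)
      have "(\<alpha> * norm y)\<^sup>2 \<le> (norm (S y + \<alpha> *\<^sub>R y))\<^sup>2"
        using S(2)[of y] \<alpha>0 by (simp add: norm_add_squared cinner_simps power_mult_distrib)
      then have "\<alpha> * norm y \<le> norm (S y + \<alpha> *\<^sub>R y)"
        by (rule power2_le_imp_le) simp_all
      also have "\<dots> \<le> \<alpha> * (e * norm x)"
        unfolding Sy using C(2)[OF that] by (simp add: mult.assoc)
      finally show ?thesis
        using \<alpha>0 by (simp add: y_def)
    qed
    then show ?thesis
      using C(1) by blast
  qed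
qed

section \<open>Compact perturbations of a multiple of the identity\<close>

lemma in_eigenspace_iff: "x \<in> eigenspace S r \<longleftrightarrow> S x = r *\<^sub>R x"
  by (simp add: eigenspace_def null_space_def)

lemma closed_subspace_eigenspace:
  "bounded_op UNIV UNIV S \<Longrightarrow> closed_subspace (eigenspace S r)"
  unfolding eigenspace_def by (intro closed_subspace_null_space bounded_op_diff_scaleR)

lemma zero_in_eigenspace: "bounded_op UNIV UNIV S \<Longrightarrow> 0 \<in> eigenspace S r"
  by (simp add: in_eigenspace_iff bounded_op_zero)

lemma selfadjoint_eigenspaces_orthogonal:
  assumes S: "selfadjoint S" and "r \<noteq> s" "x \<in> eigenspace S r" "y \<in> eigenspace S s"
  shows "cinner x y = 0"
proof -
  have "complex_of_real (r - s) * cinner x y = 0"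
    using selfadjoint_cinner[OF S, of x y] assms(3,4)
    by (simp add: in_eigenspace_iff cinner_simps algebra_simps)
  then show ?thesis
    using assms(2) by (simp del: of_real_diff)
qed

lemma orthogonal_imp_independent:
  assumes "\<And>x y. x \<in> B \<Longrightarrow> y \<in> B
      \<Longrightarrow> x \<noteq> y \<Longrightarrow> cinner x y = 0" "0 \<notin> B"
  shows "\<not> complex_vector.dependent B"
proof
  assume "complex_vector.dependent B"
  then obtain a where a: "a \<in> B" "a \<in> cspan (B - {a})"
    unfolding complex_vector.dependent_def by blast
  have "cinner a a = 0"
    by (rule cinner_closure_cspan_right[of "B - {a}"])
       (use a assms(1) in \<open>auto intro: closure_subset[THEN subsetD]\<close>)
  then show False
    using a(1) assms(2) by auto
qed

lemma selfadjoint_eigenvalue_real: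
  assumes S: "selfadjoint S" and x: "S x = l *\<^sub>C x" "x \<noteq> 0"
  shows "l = complex_of_real (Re l)" "x \<in> eigenspace S (Re l)"
proof -
  have "l * cinner x x \<in> \<real>"
    using selfadjoint_cinner_real[OF S, of x] by (simp add: x(1) cinner_scaleC_left)
  then have "Im l = 0"
    using x(2) by (simp add: cinner_self complex_is_Real_iff)
  then show l: "l = complex_of_real (Re l)"
    by (simp add: complex_eq_iff)
  show "x \<in> eigenspace S (Re l)"
    using x(1) l by (metis in_eigenspace_iff scaleC_of_real)
qed

lemma adj_diff_scaleC:
  assumes "selfadjoint S"
  shows "adj UNIV (\<lambda>x. S x - l *\<^sub>C x) = (\<lambda>x. S x - cnj l *\<^sub>C x)"
  by (intro ext adj_eqI) (simp_all add: cinner_simps selfadjoint_cinner[OF assms])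

lemma cnj_not_of_real: "l \<noteq> complex_of_real \<alpha>
    \<Longrightarrow> cnj l \<noteq> complex_of_real \<alpha>"
  by (metis complex_cnj_cnj complex_cnj_complex_of_real)

text \<open>With orthonormal \<open>v k\<close> in the range such that \<open>norm (K (v k)) \<le>
    (1/4) ^ k\<close>, the sum of the
  \<open>(1/2) ^ k *\<^sub>R v k\<close> is in the closure of the range but not in the
      range.\<close>

lemma compact_selfadjoint_not_fredholm:
  fixes K :: "'a :: complex_hilbert \<Rightarrow> 'a"
  assumes K: "selfadjoint K" "compact_op K" and inf: "\<not> finite_dim (UNIV :: 'a set)"
  shows "\<not> fredholm K"
proof
  assume "fredholm K"
  then obtain D where cl: "closed (range K)" and D: "finite D" "cspan D = null_space K"
    by (auto simp: fredholm_def finite_dim_def)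
  note K' = selfadjoint_bounded_op[OF K(1)]
  have "\<exists>v\<in>orthogonal_complement C. v \<in> range K \<and> norm v = 1 \<and> norm (K
      v) \<le> (1/4) ^ n"
    if "finite C" for C and n :: nat
  proof -
    obtain C0 where C0: "finite C0" "\<And>x. x \<in> orthogonal_complement C0
        \<Longrightarrow> norm (K x) \<le> (1/4) ^ n * norm x"
      using compact_opD[OF K(2), of "(1/4) ^ n"] by auto
    define C1 where "C1 = C \<union> C0"
    have "\<exists>x. K x \<in> orthogonal_complement C1 \<and> K x \<noteq> 0"
    proof (rule ccontr)
      assume neg: "\<not> ?thesis"
      have "finite_dim (UNIV :: 'a set)"
      proof (rule finite_dim_of_orthogonal_trivial(1)[OF complex_vector.subspace_UNIV])
        show "finite (K ` C1 \<union> D)"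
          using that C0 D by (simp add: C1_def)
        fix x assume x: "x \<in> orthogonal_complement (K ` C1 \<union> D)"
        then have "K x \<in> orthogonal_complement C1"
          by (auto simp: orthogonal_complement_def selfadjoint_cinner[OF K(1)])
        then have "x \<in> cspan D"
          using neg D(2) by (auto simp: null_space_def)
        then have "cinner x x = 0"
          using x closure_subset[THEN subsetD]
          by (metis UnCI cinner_closure_cspan_right orthogonal_complementD)
        then show "x = 0" by simp
      qed
      with inf show False ..
    qed
    then obtain x where x: "K x \<in> orthogonal_complement C1" "K x \<noteq> 0" by blast
    define v where "v = (1 / norm (K x)) *\<^sub>R K x"
    have "v = K ((1 / norm (K x)) *\<^sub>R x)"
      by (simp add: v_def bounded_op_scaleR[OF K'])
    then have "v \<in> range K" by blast
    moreover have nv: "norm v = 1"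
      using x(2) by (simp add: v_def)
    moreover have v: "v \<in> orthogonal_complement C1"
      unfolding v_def by (intro csubspace_scaleR csubspace_orthogonal_complement x)
    then have "norm (K v) \<le> (1/4) ^ n"
      using C0(2)[of v] nv by (simp add: C1_def orthogonal_complement_Un)
    ultimately show ?thesis
      using v by (auto simp: C1_def orthogonal_complement_Un)
  qed
  from orthogonal_sequence_exists[where F = "\<lambda>v. {v}"
      and R = "\<lambda>n v. v \<in> range K \<and> norm v = 1 \<and> norm (K v) \<le> (1/4) ^ n",
          OF this]
  obtain v where v: "\<And>n. v n \<in> range K" "\<And>n. norm (v n) = 1"
      "\<And>n. norm (K (v n)) \<le> (1/4) ^ n"
    "\<And>n i. i < n \<Longrightarrow> v n \<in> orthogonal_complement {v i}"
    by auto
  have orth: "cinner (v m) (v n) = 0" if "m \<noteq> n" for m n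
    using v(4)[of m n] v(4)[of n m] that
    by (metis cinner_eq_0_commute linorder_neqE_nat orthogonal_complementD singletonI)
  have sub: "csubspace (range K)"
    unfolding complex_vector.subspace_def
    by (auto simp: image_iff) (metis bounded_op_zero[OF K'], metis bounded_op_add[OF K'], metis
        bounded_op_scaleC[OF K'])
  have "summable (\<lambda>k. (1/2 :: real) ^ k)"
    by (rule summable_geometric) simp
  then have "summable (\<lambda>k. (1/2) ^ k *\<^sub>R v k)"
    by (rule summable_comparison_test[rotated]) (simp add: v(2))
  then obtain y where y: "(\<lambda>k. (1/2) ^ k *\<^sub>R v k) sums y"
    by (auto simp: summable_def)
  have "y \<in> range K"
  proof (rule closed_sequentially[OF cl])
    show "(\<lambda>n. \<Sum>k<n. (1/2) ^ k *\<^sub>R v k) \<longlonglongrightarrow> y"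
      using y by (simp add: sums_def)
    show "(\<Sum>k<n. (1/2) ^ k *\<^sub>R v k) \<in> range K" for n
      by (intro csubspace_sum csubspace_scaleR sub v)
  qed
  then obtain x where x: "y = K x" by blast
  \<comment> \<open>Pairing a preimage \<open>x\<close> of \<open>y\<close> with
    \<open>K (v n)\<close> isolates the coefficient \<open>(1/2) ^ n\<close>, while the pairing is
    at most \<open>norm x * (1/4) ^ n\<close>.\<close>
  have "2 ^ n \<le> norm x" for n :: nat
  proof -
    have "(\<lambda>k. cinner ((1/2) ^ k *\<^sub>R v k) (v n)) sums cinner y (v n)"
      by (rule bounded_linear.sums[OF cinner.bounded_linear_left y])
    moreover have "(\<lambda>k. cinner ((1/2) ^ k *\<^sub>R v k) (v n)) = (\<lambda>k. if k = n
        then complex_of_real ((1/2) ^ n) else 0)"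
      by (auto simp: fun_eq_iff orth cinner_scaleR_left cinner_self v(2))
    ultimately have "cinner y (v n) = complex_of_real ((1/2) ^ n)"
      using sums_single[of n "\<lambda>_. complex_of_real ((1/2) ^ n)"] sums_unique2 by metis
    then have "(1/2) ^ n = cmod (cinner x (K (v n)))"
      by (simp add: x selfadjoint_cinner[OF K(1)] norm_power norm_divide)
    also have "\<dots> \<le> norm x * norm (K (v n))"
      by (rule cinner_cauchy_schwarz)
    also have "\<dots> \<le> norm x * (1/4) ^ n"
      by (intro mult_left_mono v) simp
    finally have "(1/2) ^ n * 4 ^ n \<le> norm x"
      by (simp add: power_divide field_simps)
    then show ?thesis
      by (simp flip: power_mult_distrib)
  qed
  moreover obtain n where "norm x < 2 ^ n"
    using real_arch_pow[of 2 "norm x"] by auto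
  ultimately show False
    using not_le by blast
qed

context
  fixes S :: "'a :: complex_hilbert \<Rightarrow> 'a" and \<alpha> :: real
  assumes S: "selfadjoint S" and K: "compact_op (\<lambda>x. S x - \<alpha> *\<^sub>R x)"
begin

lemma essentially_bounded_below:
  assumes "l \<noteq> complex_of_real \<alpha>"
  shows "\<exists>d>0. \<exists>C. finite C \<and> (\<forall>x\<in>orthogonal_complement C. d *
      norm x \<le> norm (S x - l *\<^sub>C x))"
proof -
  \<comment> \<open>Half the distance from \<open>l\<close> to \<alpha>: on the complement of
    \<open>C\<close> the perturbation consumes at most one of the two halves.\<close>
  define d where "d = cmod (complex_of_real \<alpha> - l) / 2"
  have d: "d > 0"
    using assms by (simp add: d_def)
  obtain C where C: "finite C" "\<And>x. x \<in> orthogonal_complement C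
      \<Longrightarrow> norm (S x - \<alpha> *\<^sub>R x) \<le> d * norm x"
    using compact_opD[OF K d] by blast
  have "d * norm x \<le> norm (S x - l *\<^sub>C x)" if "x \<in> orthogonal_complement C" for x
  proof -
    have eq: "(complex_of_real \<alpha> - l) *\<^sub>C x = (S x - l *\<^sub>C x) - (S x - \<alpha>
        *\<^sub>R x)"
      by (simp add: complex_vector.scale_left_diff_distrib scaleC_of_real)
    have "2 * d * norm x = norm ((complex_of_real \<alpha> - l) *\<^sub>C x)"
      by (simp add: norm_scaleC d_def)
    also have "\<dots> \<le> norm (S x - l *\<^sub>C x) + norm (S x - \<alpha> *\<^sub>R x)"
      unfolding eq by (rule norm_triangle_ineq4)
    finally show ?thesis
      using C(2)[OF that] by simp
  qed
  then show ?thesis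
    using d C(1) by blast
qed

text \<open>The adjoint of \<open>S - l\<close> is \<open>S - cnj l\<close>, and
  \<open>cnj l\<close> also differs from the real number \<alpha>, so one estimate serves both
  kernels.\<close>

lemma fredholm_off_essential:
  assumes l: "l \<noteq> complex_of_real \<alpha>"
  shows "fredholm (\<lambda>x. S x - l *\<^sub>C x)"
proof -
  note W = bounded_op_diff_scaleC[OF selfadjoint_bounded_op[OF S]]
  obtain d C where "0 < d" "finite C" "\<And>x. x \<in> orthogonal_complement C
      \<Longrightarrow> d * norm x \<le> norm (S x - l *\<^sub>C x)"
    using essentially_bounded_below[OF l] by blast
  note 1 = fredholm_if_bounded_below[OF W this]
  obtain d C where "0 < d" "finite C" "\<And>x. x \<in> orthogonal_complement C
      \<Longrightarrow> d * norm x \<le> norm (S x - cnj l *\<^sub>C x)"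
    using essentially_bounded_below[OF cnj_not_of_real[OF l]] by blast
  note 2 = fredholm_if_bounded_below[OF W this]
  show ?thesis
    using 1 2(2) by (simp add: fredholm_def adj_diff_scaleC[OF S])
qed

lemma ess_spectrum_eq:
  assumes "\<not> finite_dim (UNIV :: 'a set)"
  shows "ess_spectrum S = {complex_of_real \<alpha>}"
proof -
  have "\<not> fredholm (\<lambda>x. S x - \<alpha> *\<^sub>R x)"
    by (rule compact_selfadjoint_not_fredholm[OF selfadjoint_diff_scaleR[OF S] K assms])
  then show ?thesis
    using fredholm_off_essential by (auto simp: ess_spectrum_def scaleC_of_real)
qed

text \<open>Fredholm alternative: if \<open>l\<close> is not an eigenvalue, \<open>V = S - l\<close>
  is bounded below and has closed range. A vector orthogonal to the range is an eigenvector for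
  \<open>cnj l\<close> unless it is 0; eigenvalues are real, so it would be one for
  \<open>l\<close>. Thus \<open>V\<close> is onto with bounded inverse.\<close>

lemma spectrum_off_essential:
  assumes l: "l \<noteq> complex_of_real \<alpha>" and spec: "l \<in> spectrum S"
  shows "\<exists>x. x \<noteq> 0 \<and> S x = l *\<^sub>C x"
proof (rule ccontr)
  assume "\<not> ?thesis"
  then have inj: "S x = l *\<^sub>C x \<Longrightarrow> x = 0" for x by blast
  note W = bounded_op_diff_scaleC[OF selfadjoint_bounded_op[OF S], of l]
  define V where "V = (\<lambda>x. S x - l *\<^sub>C x)"
  have V: "bounded_op UNIV UNIV V"
    unfolding V_def by (rule W)
  have V0: "V x = 0 \<Longrightarrow> x = 0" for x
    using inj by (simp add: V_def)
  obtain d C where "0 < d" "finite C" "\<And>x. x \<in> orthogonal_complement C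
      \<Longrightarrow> d * norm x \<le> norm (V x)"
    using essentially_bounded_below[OF l] by (auto simp: V_def)
  then have "\<exists>c>0. \<forall>x\<in>UNIV. c * norm x \<le> norm (V x)"
    by (intro bounded_below_finite_codim[OF V _ _ closed_subspace_UNIV _ V0])
  then obtain c where c: "c > 0" "\<And>x. c * norm x \<le> norm (V x)" by auto
  have cl: "closed (range V)"
    by (rule closed_image_bounded_below[OF V closed_subspace_UNIV c])
  have sub: "closed_subspace (range V)"
    using cl unfolding closed_subspace_def complex_vector.subspace_def
    by (auto simp: image_iff) (metis bounded_op_zero[OF V], metis bounded_op_add[OF V], metis
        bounded_op_scaleC[OF V])
  have "y \<in> range V" for y
  proof -
    define z where "z = y - proj (range V) y"
    have "cinner (V x) z = 0" for x
      using cinner_diff_proj[OF sub, of "V x" y] by (simp add: z_def cinner_eq_0_commute)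
    then have "cinner x (S z - cnj l *\<^sub>C z) = 0" for x
      by (simp add: V_def cinner_simps selfadjoint_cinner[OF S])
    then have Sz: "S z = cnj l *\<^sub>C z"
      by (metis cinner_self_eq_0 eq_iff_diff_eq_0)
    have "z = 0"
    proof (rule ccontr)
      assume "z \<noteq> 0"
      then have "cnj l = complex_of_real (Re l)"
        using selfadjoint_eigenvalue_real(1)[OF S Sz] by simp
      then have "cnj l = l"
        by (metis complex_cnj_cnj complex_cnj_complex_of_real)
      with Sz inj \<open>z \<noteq> 0\<close> show False by simp
    qed
    then show ?thesis
      using proj_in[OF sub, of y] by (simp add: z_def)
  qed
  then have "\<forall>y. \<exists>x. V x = y"
    by (metis imageE)
  then obtain R where R: "\<And>y. V (R y) = y"
    by metis
  have RV: "R (V x) = x" for x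
    using V0[of "R (V x) - x"] by (simp add: bounded_op_diff[OF V] R)
  have "bounded_op UNIV UNIV R"
    unfolding bounded_op_UNIV_iff
  proof (intro conjI allI exI)
    show "R (x + y) = R x + R y" for x y
      by (metis R RV bounded_op_add[OF V])
    show "R (c *\<^sub>C x) = c *\<^sub>C R x" for c x
      by (metis R RV bounded_op_scaleC[OF V])
    show "norm (R x) \<le> (1 / c) * norm x" for x
      using c(2)[of "R x"] c(1) by (simp add: R field_simps)
  qed
  with R RV have "l \<notin> spectrum S"
    by (auto simp: spectrum_def V_def)
  with spec show False by simp
qed

lemma eigenvalue_iff_spectrum:
  assumes "r \<noteq> \<alpha>"
  shows "complex_of_real r \<in> spectrum S \<longleftrightarrow> eigenspace S r \<noteq> {0}"
proof
  assume "complex_of_real r \<in> spectrum S"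
  then obtain x where x: "x \<noteq> 0" "S x = complex_of_real r *\<^sub>C x"
    using spectrum_off_essential[of "complex_of_real r"] assms of_real_eq_iff by metis
  then have "x \<in> eigenspace S r"
    by (simp add: in_eigenspace_iff scaleC_of_real)
  with x(1) show "eigenspace S r \<noteq> {0}"
    by (metis singletonD)
next
  assume "eigenspace S r \<noteq> {0}"
  then have "\<exists>x. x \<in> eigenspace S r \<and> x \<noteq> 0"
    using zero_in_eigenspace[OF selfadjoint_bounded_op[OF S], of r] by auto
  then obtain x where "x \<in> eigenspace S r" "x \<noteq> 0"
    by blast
  then have x: "x \<noteq> 0" "S x = r *\<^sub>R x"
    by (simp_all add: in_eigenspace_iff)
  show "complex_of_real r \<in> spectrum S"
    unfolding spectrum_def
  proof (clarify)
    fix R assume R: "bounded_op UNIV UNIV R" "\<forall>y. R (S y - complex_of_real r *\<^sub>C y)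
        = y"
    then have "R 0 = x"
      using x(2) by (metis diff_self scaleC_of_real)
    then show False
      using x(1) bounded_op_zero[OF R(1)] by simp
  qed
qed

text \<open>On the span of eigenvectors for such eigenvalues \<open>S - \<alpha>\<close> stretches
  by at least \<open>e\<close>, on the complement of some finite \<open>C\<close> by at most
  \<open>e / 2\<close>. The two meet only in 0, so there are at most \<open>card C\<close> such
  eigenvalues.\<close>

lemma finite_eigenvalues:
  assumes e: "0 < e"
  shows "finite {r. e \<le> \<bar>r - \<alpha>\<bar> \<and> eigenspace S r \<noteq> {0}}"
proof -
  note S' = selfadjoint_bounded_op[OF S]
  define X where "X = {r. e \<le> \<bar>r - \<alpha>\<bar> \<and> eigenspace S r \<noteq> {0}}"
  have "\<exists>x. x \<in> eigenspace S r \<and> x \<noteq> 0" if "r \<in> X" for r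
    using that zero_in_eigenspace[OF S', of r] by (auto simp: X_def)
  then obtain v where v: "\<And>r. r \<in> X \<Longrightarrow> v r \<in> eigenspace S r"
      "\<And>r. r \<in> X \<Longrightarrow> v r \<noteq> 0"
    by metis
  have orth: "cinner (v r) (v s) = 0" if "r \<in> X" "s \<in> X" "r \<noteq> s" for r s
    using selfadjoint_eigenspaces_orthogonal[OF S] v that by blast
  have inj: "inj_on v X"
    using orth v(2) by (metis cinner_self_eq_0 inj_onI)
  obtain C where C: "finite C" "\<And>x. x \<in> orthogonal_complement C
      \<Longrightarrow> norm (S x - \<alpha> *\<^sub>R x) \<le> (e / 2) * norm x"
    using compact_opD[OF K, of "e / 2"] e by auto
  have "finite Y \<longrightarrow> card Y \<le> card C" if Y: "Y \<subseteq> X" for Y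
  proof
    assume fin: "finite Y"
    have below: "e * norm x \<le> norm (S x - \<alpha> *\<^sub>R x)" if x: "x \<in> cspan (v ` Y)"
        for x
    proof -
      obtain u where u: "x = (\<Sum>a\<in>v ` Y. u a *\<^sub>C a)"
        using x fin by (auto simp: complex_vector.span_finite)
      have x_eq: "x = (\<Sum>r\<in>Y. u (v r) *\<^sub>C v r)"
        unfolding u using inj_on_subset[OF inj Y] by (simp add: sum.reindex)
      have "S x - \<alpha> *\<^sub>R x = (\<Sum>r\<in>Y. (r - \<alpha>) *\<^sub>R (u (v r)
          *\<^sub>C v r))"
        unfolding x_eq bounded_op_sum[OF S'] bounded_op_scaleC[OF S'] scaleR_sum_right
          sum_subtractf[symmetric]
        using v(1) Y by (intro sum.cong) (auto simp: in_eigenspace_iff scaleC_scaleR_commute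
            scaleR_diff_left)
      then have "(norm (S x - \<alpha> *\<^sub>R x))\<^sup>2 = (\<Sum>r\<in>Y. (norm ((r -
          \<alpha>) *\<^sub>R (u (v r) *\<^sub>C v r)))\<^sup>2)"
        using Y orth by (simp only:) (rule norm_sum_orthogonal[OF fin], auto simp: cinner_simps)
      also have "\<dots> \<ge> (\<Sum>r\<in>Y. e\<^sup>2 * (norm (u (v r) *\<^sub>C v r))\<^sup>2)"
      proof (rule sum_mono)
        fix r assume "r \<in> Y"
        then have "e\<^sup>2 \<le> \<bar>r - \<alpha>\<bar>\<^sup>2"
          using Y e by (intro power_mono) (auto simp: X_def)
        then show "e\<^sup>2 * (norm (u (v r) *\<^sub>C v r))\<^sup>2 \<le> (norm ((r - \<alpha>)
            *\<^sub>R (u (v r) *\<^sub>C v r)))\<^sup>2"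
          by (simp add: power_mult_distrib mult_right_mono)
      qed
      also have "(\<Sum>r\<in>Y. e\<^sup>2 * (norm (u (v r) *\<^sub>C v r))\<^sup>2) = (e * norm
          x)\<^sup>2"
        unfolding x_eq power_mult_distrib sum_distrib_left[symmetric]
        using Y orth fin by (subst norm_sum_orthogonal) (auto simp: cinner_simps)
      finally show ?thesis
        by (rule power2_le_imp_le) simp
    qed
    have "finite (v ` Y) \<and> card (v ` Y) \<le> card C"
    proof (rule finite_dim_of_orthogonal_trivial(2)[OF complex_vector.subspace_span[of "v ` Y"]
        C(1)])
      fix x assume "x \<in> cspan (v ` Y)" "x \<in> orthogonal_complement C"
      then have "e * norm x \<le> (e / 2) * norm x"
        using below[of x] C(2)[of x] by linarith
      then show "x = 0"
        using e by (simp add: mult_le_cancel_right)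
    next
      show "v ` Y \<subseteq> cspan (v ` Y)"
        by (rule complex_vector.span_superset)
      show "\<not> complex_vector.dependent (v ` Y)"
        using orth v(2) Y by (intro orthogonal_imp_independent) auto
    qed
    then show "card Y \<le> card C"
      using inj_on_subset[OF inj Y] by (simp add: card_image)
  qed
  then have "finite X"
    using finite_if_finite_subsets_card_bdd[of X "card C"] by blast
  then show ?thesis
    by (simp add: X_def)
qed

lemma countable_eigenvalues: "countable {r. r \<noteq> \<alpha> \<and> eigenspace S r \<noteq> {0}}"
proof -
  have "{r. r \<noteq> \<alpha> \<and> eigenspace S r \<noteq> {0}} \<subseteq>
      (\<Union>n. {r. inverse (real (Suc n)) \<le> \<bar>r - \<alpha>\<bar> \<and> eigenspace S r
          \<noteq> {0}})"
  proof
    fix r assume r: "r \<in> {r. r \<noteq> \<alpha> \<and> eigenspace S r \<noteq> {0}}"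
    then obtain n where "inverse (real (Suc n)) < \<bar>r - \<alpha>\<bar>"
      using reals_Archimedean[of "\<bar>r - \<alpha>\<bar>"] by auto
    then show "r \<in> (\<Union>n. {r. inverse (real (Suc n)) \<le> \<bar>r - \<alpha>\<bar>
        \<and> eigenspace S r \<noteq> {0}})"
      using r by (auto intro: less_imp_le)
  qed
  moreover have "countable (\<Union>n. {r. inverse (real (Suc n)) \<le> \<bar>r - \<alpha>\<bar>
      \<and> eigenspace S r \<noteq> {0}})"
    by (rule countable_UN) (auto intro!: countable_finite finite_eigenvalues)
  ultimately show ?thesis
    by (rule countable_subset)
qed

text \<open>The complement \<open>M\<close> of all eigenspaces is invariant under
  \<open>L = S - \<alpha>\<close> and contains no eigenvector. If \<open>M\<close> were nonzero,
  \<open>L\<close> would be nonzero there, so its form would be nonzero somewhere, and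
  \<open>L\<close> or \<open>- L\<close> would have an eigenvector in \<open>M\<close>.\<close>

lemma eigenspaces_complete:
  assumes x: "\<And>r. x \<in> orthogonal_complement (eigenspace S r)"
  shows "x = 0"
proof (rule ccontr)
  assume "x \<noteq> 0"
  note S' = selfadjoint_bounded_op[OF S]
  define L where "L = (\<lambda>x. S x - \<alpha> *\<^sub>R x)"
  have L: "selfadjoint L" "compact_op L"
    unfolding L_def using selfadjoint_diff_scaleR[OF S] K by auto
  define M where "M = orthogonal_complement (\<Union>r. eigenspace S r)"
  have M: "closed_subspace M"
    unfolding M_def by (rule closed_subspace_orthogonal_complement)
  have xM: "x \<in> M"
    using x by (auto simp: M_def orthogonal_complement_def)
  have LM: "L w \<in> M" if "w \<in> M" for w
    unfolding M_def
  proof (rule orthogonal_complementI)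
    fix b assume b: "b \<in> (\<Union>r. eigenspace S r)"
    then obtain r where "S b = r *\<^sub>R b"
      by (auto simp: in_eigenspace_iff)
    then have "L b = (r - \<alpha>) *\<^sub>R b"
      by (simp add: L_def scaleR_diff_left)
    then show "cinner (L w) b = 0"
      using that b by (simp add: selfadjoint_cinner[OF L(1)] cinner_scaleR_right M_def
          orthogonal_complementD)
  qed
  have no_eig: False if "w \<in> M" "w \<noteq> 0" "L w = q *\<^sub>R w" for w q
  proof -
    have "w \<in> eigenspace S (\<alpha> + q)"
      using that(3) by (simp add: L_def in_eigenspace_iff algebra_simps)
    then have "cinner w w = 0"
      using that(1) by (auto simp: M_def orthogonal_complement_def)
    then show False
      using that(2) by simp
  qed
  have "L x \<noteq> 0"
    using no_eig[OF xM \<open>x \<noteq> 0\<close>, of 0] by auto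
  then have "\<not> norm (L x) \<le> 0 * norm x"
    by simp
  then have "\<exists>w\<in>M. \<not> \<bar>Re (cinner (L w) w)\<bar> \<le> 0 * (norm w)\<^sup>2"
    using selfadjoint_norm_le_of_form[OF L(1) closed_subspace_csubspace[OF M] xM LM[OF xM], of 0]
        by blast
  then obtain w where w: "w \<in> M" "Re (cinner (L w) w) \<noteq> 0"
    by auto
  show False
  proof (cases "0 < Re (cinner (L w) w)")
    case True
    from compact_selfadjoint_eigenvector[OF L M LM w(1) this] show False
      using no_eig by blast
  next
    case False
    have nM: "(-1) *\<^sub>R L w \<in> M" if "w \<in> M" for w
      by (intro csubspace_scaleR closed_subspace_csubspace M LM that)
    have "0 < Re (cinner ((-1) *\<^sub>R L w) w)"
      using False w(2) by (simp add: cinner_simps)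
    from compact_selfadjoint_eigenvector[OF selfadjoint_scaleR[OF L(1)] compact_op_uminus[OF L(2)]
        M nM w(1) this]
    obtain q u where "u \<in> M" "u \<noteq> 0" "(-1) *\<^sub>R L u = q *\<^sub>R u" by blast
    then have "L u = (- q) *\<^sub>R u"
      by (metis scaleR_minus_left scaleR_one minus_minus)
    with \<open>u \<in> M\<close> \<open>u \<noteq> 0\<close> show False
      using no_eig by blast
  qed
qed

end

section \<open>Orthogonal direct sums\<close>

text \<open>Finite partial sums \<open>Q Y\<close> eventually reproduce each vector of the algebraic
  span, and \<open>w - Q Y w\<close> is never longer than \<open>w\<close>. Approximating
  \<open>x\<close> by a vector of the span therefore gives convergence along finite subsets.\<close>

lemma orth_direct_sum_has_sum:
  assumes M: "orth_direct_sum I E M" and x: "x \<in> M"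
  shows "((\<lambda>i. proj (E i) x) has_sum x) I"
proof -
  have E: "closed_subspace (E i)" if "i \<in> I" for i
    using M that by (simp add: orth_direct_sum_def)
  have orth: "cinner y z = 0" if "i \<in> I" "j \<in> I" "i \<noteq> j" "y \<in> E i" "z \<in> E
      j" for i j y z
    using M that by (auto simp: orth_direct_sum_def orthogonal_sets_def)
  have M_eq: "M = closure (cspan (\<Union>i\<in>I. E i))"
    using M by (simp add: orth_direct_sum_def)
  define Q where "Q Y w = (\<Sum>i\<in>Y. proj (E i) w)" for Y w
  have Q_add: "Q Y (v + w) = Q Y v + Q Y w" and Q_scale: "Q Y (c *\<^sub>C w) = c *\<^sub>C Q Y w"
    if "Y \<subseteq> I" for Y v w c
    using that E
    by (auto simp: Q_def proj_add proj_scaleC sum.distrib complex_vector.scale_sum_right subset_iff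
        intro!: sum.cong simp flip: sum.distrib)
  have norm_Q: "norm (w - Q Y w) \<le> norm w" if Y: "finite Y" "Y \<subseteq> I" for Y w
  proof -
    have "cinner (w - Q Y w) z = 0" if z: "i \<in> Y" "z \<in> E i" for i z
    proof -
      have "cinner (Q Y w) z = (\<Sum>j\<in>Y. if j = i then cinner (proj (E i) w) z else 0)"
        unfolding Q_def cinner_sum_left
      proof (rule sum.cong[OF refl])
        fix j assume "j \<in> Y"
        then show "cinner (proj (E j) w) z = (if j = i then cinner (proj (E i) w) z else 0)"
          using orth[of j i "proj (E j) w" z] z Y proj_in[OF E[of j], of w] by auto
      qed
      also have "\<dots> = cinner w z"
        using z Y E by (auto simp: cinner_proj_left subset_iff)
      finally show ?thesis
        by (simp add: cinner_diff_left)
    qed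
    then have "cinner (w - Q Y w) (Q Y w) = 0"
      unfolding Q_def[of Y w] cinner_sum_right using Y(2) proj_in[OF E]
      by (intro sum.neutral) (auto simp: Q_def)
    from norm_add_orthogonal[OF this] have "(norm (w - Q Y w))\<^sup>2 \<le> (norm w)\<^sup>2"
      by simp
    then show ?thesis
      by (rule power2_le_imp_le) simp
  qed
  \<comment> \<open>\<open>P s\<close>: all partial sums over large enough finite index sets equal
    \<open>s\<close>.\<close>
  define P where "P s \<longleftrightarrow> (\<exists>J. finite J \<and> J \<subseteq> I \<and>
      (\<forall>Y. finite Y \<and> J \<subseteq> Y \<and> Y \<subseteq> I \<longrightarrow> Q Y s
      = s))" for s
  have P_span: "P s" if "s \<in> cspan (\<Union>i\<in>I. E i)" for s
  proof (rule complex_vector.span_induct[OF that])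
    have "P 0"
      unfolding P_def Q_def using E
      by (intro exI[of _ "{}"]) (auto simp: proj_ident csubspace_0 closed_subspace_csubspace
          subset_iff
          intro!: sum.neutral)
    moreover have "P (u + w)" if "P u" "P w" for u w
    proof -
      from that obtain J J' where "finite J" "J \<subseteq> I" "\<And>Y. finite Y
          \<Longrightarrow> J \<subseteq> Y \<Longrightarrow> Y \<subseteq> I
          \<Longrightarrow> Q Y u = u"
        "finite J'" "J' \<subseteq> I" "\<And>Y. finite Y
            \<Longrightarrow> J' \<subseteq> Y \<Longrightarrow> Y \<subseteq> I
            \<Longrightarrow> Q Y w = w"
        unfolding P_def by metis
      then show ?thesis
        unfolding P_def by (intro exI[of _ "J \<union> J'"]) (auto simp: Q_add)
    qed
    moreover have "P (c *\<^sub>C u)" if "P u" for c u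
      using that unfolding P_def by (metis Q_scale)
    ultimately show "csubspace {s. P s}"
      by (auto simp: complex_vector.subspace_def)
  next
    fix s assume "s \<in> (\<Union>i\<in>I. E i)"
    then obtain i where i: "i \<in> I" "s \<in> E i" by blast
    have "Q Y s = s" if Y: "finite Y" "{i} \<subseteq> Y" "Y \<subseteq> I" for Y
    proof -
      have "proj (E j) s = (if j = i then s else 0)" if "j \<in> Y" for j
        using that Y(3) i(2) orth[OF i(1), of j s]
        by (auto simp: proj_ident[OF E] intro!: proj_orthogonal[OF E] orthogonal_complementI)
      then show ?thesis
        using Y by (simp add: Q_def)
    qed
    then show "P s"
      unfolding P_def using i by (intro exI[of _ "{i}"]) auto
  qed
  show ?thesis
    unfolding has_sum_def
  proof (rule tendstoI)
    fix e :: real assume "0 < e"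
    then obtain s where s: "s \<in> cspan (\<Union>i\<in>I. E i)" "dist s x < e"
      using x unfolding M_eq closure_approachable by blast
    obtain J where J: "finite J" "J \<subseteq> I" "\<And>Y. finite Y
        \<Longrightarrow> J \<subseteq> Y \<Longrightarrow> Y \<subseteq> I
        \<Longrightarrow> Q Y s = s"
      using P_span[OF s(1)] unfolding P_def by metis
    have "dist (\<Sum>i\<in>Y. proj (E i) x) x < e" if Y: "finite Y" "J \<subseteq> Y" "Y
        \<subseteq> I" for Y
    proof -
      have "Q Y x = Q Y (x - s) + s"
        using Q_add[OF Y(3), of "x - s" s] J(3)[OF Y] by simp
      then have "norm (x - Q Y x) = norm ((x - s) - Q Y (x - s))"
        by (simp add: algebra_simps)
      also have "\<dots> \<le> norm (x - s)"
        by (rule norm_Q[OF Y(1,3)])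
      finally show ?thesis
        using s(2) by (simp add: Q_def dist_norm norm_minus_commute)
    qed
    then show "\<forall>\<^sub>F Y in finite_subsets_at_top I. dist (\<Sum>i\<in>Y. proj (E i) x)
        x < e"
      unfolding eventually_finite_subsets_at_top using J by blast
  qed
qed

text \<open>A bounded operator that agrees with the blocks is their direct sum, by continuity. This
  identifies the series in the theorem with \<open>T\<close> on \<open>H0\<close> and with
  \<open>P\<close> on \<open>H2\<close>.\<close>

lemma direct_sum_op_eq:
  assumes M: "orth_direct_sum I E M" and x: "x \<in> M" and A: "bounded_op UNIV UNIV A"
    and eq: "\<And>i y. i \<in> I \<Longrightarrow> y \<in> E i \<Longrightarrow> B i y = A y"
  shows "direct_sum_op I E B x = A x"
proof -
  have E: "closed_subspace (E i)" if "i \<in> I" for i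
    using M that by (simp add: orth_direct_sum_def)
  have "((\<lambda>i. A (proj (E i) x)) has_sum A x) I"
    using has_sum_bounded_linear[OF bounded_op_bounded_linear[OF A] orth_direct_sum_has_sum[OF M x]]
    by (simp add: comp_def)
  then have "((\<lambda>i. B i (proj (E i) x)) has_sum A x) I"
    by (subst has_sum_cong[where g = "\<lambda>i. A (proj (E i) x)"]) (simp_all add: eq proj_in E)
  then show ?thesis
    unfolding direct_sum_op_def by (rule infsumI)
qed

lemma countable_enumerates:
  assumes "countable L"
  shows "\<exists>n a. enumerates n a (complex_of_real ` L)"
proof (cases "finite L")
  case True
  then obtain h where h: "bij_betw h {1..card L} L"
    using ex_bij_betw_nat_finite_1 by blast
  have "indices (enat (card L)) = {1..card L}"
    by (auto simp: indices_def)
  then have "enumerates (enat (card L)) h (complex_of_real ` L)"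
    using h by (auto simp: enumerates_def bij_betw_def image_image[of complex_of_real h, symmetric])
  then show ?thesis by blast
next
  case False
  then have h: "bij_betw (from_nat_into L) UNIV L"
    using assms by (rule bij_betw_from_nat_into[rotated])
  \<comment> \<open>Indices start at 1 whereas \<open>from_nat_into\<close> counts from 0, hence the
    shift by one.\<close>
  have I: "indices \<infinity> = {1..}"
    by (auto simp: indices_def)
  have p: "bij_betw (\<lambda>i. i - 1) {1 :: nat..} UNIV"
    by (rule bij_betwI[where g = Suc]) auto
  have "bij_betw (\<lambda>i. from_nat_into L (i - 1)) {1 :: nat..} L"
    using bij_betw_trans[OF p h] by (simp add: comp_def)
  then have "enumerates \<infinity> (\<lambda>i. from_nat_into L (i - 1)) (complex_of_real ` L)"
    using image_image[of complex_of_real "\<lambda>i. from_nat_into L (i - 1)" "{1..}"]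
    by (simp add: enumerates_def bij_betw_def I)
  then show ?thesis by blast
qed

section \<open>Spectral subspaces\<close>

text \<open>For diagonalizable \<open>S\<close> this is the range of the spectral projection of
  \<open>X\<close>.\<close>

definition spectral_space :: "('a :: complex_hilbert \<Rightarrow> 'a) \<Rightarrow> real set
    \<Rightarrow> 'a set" where
  "spectral_space S X = closure (cspan (\<Union>r\<in>X. eigenspace S r))"

lemma closed_subspace_spectral_space: "closed_subspace (spectral_space S X)"
  unfolding spectral_space_def by (rule closed_subspace_closure_cspan)

lemma eigenspace_subset_spectral_space: "r \<in> X
    \<Longrightarrow> eigenspace S r \<subseteq> spectral_space S X"
  unfolding spectral_space_def by (rule order_trans[OF _ closure_cspan_superset]) auto

lemma closed_subspace_preimage:
  assumes A: "bounded_op UNIV UNIV A" and M: "closed_subspace M"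
  shows "closed_subspace {x. A x \<in> M}"
  unfolding closed_subspace_def
proof
  note sub = closed_subspace_csubspace[OF M]
  show "csubspace {x. A x \<in> M}"
    by (simp add: complex_vector.subspace_def bounded_op_zero[OF A] bounded_op_add[OF A]
        bounded_op_scaleC[OF A] csubspace_0[OF sub] csubspace_add[OF sub] csubspace_scale[OF sub])
  show "closed {x. A x \<in> M}"
    using continuous_closed_vimage[OF closed_subspace_closed[OF M], of A]
      linear_continuous_at[OF bounded_op_bounded_linear[OF A]]
    by (simp add: vimage_def)
qed

lemma spectral_space_invariant:
  assumes A: "bounded_op UNIV UNIV A"
    and inv: "\<And>r x. r \<in> X \<Longrightarrow> x \<in> eigenspace S r
        \<Longrightarrow> A x \<in> eigenspace S r"
    and x: "x \<in> spectral_space S X"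
  shows "A x \<in> spectral_space S X"
proof -
  have "(\<Union>r\<in>X. eigenspace S r) \<subseteq> {x. A x \<in> spectral_space S X}"
    using inv eigenspace_subset_spectral_space by blast
  from closure_cspan_minimal[OF closed_subspace_preimage[OF A closed_subspace_spectral_space] this]
  show ?thesis
    using x by (auto simp: spectral_space_def)
qed

lemma closed_subspace_zero: "closed_subspace {0}"
  by (simp add: closed_subspace_def)

lemma spectral_space_eq_zero:
  assumes "\<And>r. r \<in> X \<Longrightarrow> eigenspace S r = {0}"
  shows "spectral_space S X = {0}"
proof
  show "spectral_space S X \<subseteq> {0}"
    unfolding spectral_space_def using assms by (intro closure_cspan_minimal closed_subspace_zero)
        auto
  show "{0} \<subseteq> spectral_space S X"
    using csubspace_0[OF closed_subspace_csubspace[OF closed_subspace_spectral_space]] by auto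
qed

lemma spectral_spaces_orthogonal:
  assumes S: "selfadjoint S" and disj: "X \<inter> Y = {}"
    and x: "x \<in> spectral_space S X" and y: "y \<in> spectral_space S Y"
  shows "cinner x y = 0"
proof (rule cinner_closure_cspan_right[OF _ y[unfolded spectral_space_def]])
  fix b assume "b \<in> (\<Union>r\<in>Y. eigenspace S r)"
  then obtain s where s: "s \<in> Y" "b \<in> eigenspace S s" by blast
  have "cinner b x = 0"
  proof (rule cinner_closure_cspan_right[OF _ x[unfolded spectral_space_def]])
    fix a assume "a \<in> (\<Union>r\<in>X. eigenspace S r)"
    then obtain r where r: "r \<in> X" "a \<in> eigenspace S r" by blast
    then have "s \<noteq> r"
      using s(1) disj by auto
    then show "cinner b a = 0"
      using selfadjoint_eigenspaces_orthogonal[OF S _ s(2) r(2)] by simp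
  qed
  then show "cinner x b = 0"
    by (simp add: cinner_eq_0_commute)
qed

text \<open>Trivial eigenspaces add nothing, so \<open>X\<close> may be cut down to the eigenvalues
  it contains. The enumeration is arbitrary because the theorem speaks about every
  enumeration.\<close>

lemma spectral_space_orth_direct_sum:
  assumes S: "selfadjoint S" and enum: "enumerates n a (complex_of_real ` {r\<in>X. eigenspace S r
      \<noteq> {0}})"
  shows "a ` indices n = {r\<in>X. eigenspace S r \<noteq> {0}}"
    and "orth_direct_sum (indices n) (\<lambda>i. eigenspace S (a i)) (spectral_space S X)"
proof -
  define L where "L = {r\<in>X. eigenspace S r \<noteq> {0}}"
  have inj: "inj_on a (indices n)" and im: "complex_of_real ` (a ` indices n) = complex_of_real ` L"
    using enum by (simp_all add: enumerates_def L_def image_image)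
  have aL: "a ` indices n = L"
    using im by (simp add: inj_image_eq_iff[OF inj_of_real])
  then show "a ` indices n = {r\<in>X. eigenspace S r \<noteq> {0}}"
    by (simp add: L_def)
  note S' = selfadjoint_bounded_op[OF S]
  have "spectral_space S X = spectral_space S L"
  proof
    have "(\<Union>r\<in>X. eigenspace S r) \<subseteq> spectral_space S L"
    proof
      fix x assume "x \<in> (\<Union>r\<in>X. eigenspace S r)"
      then obtain r where r: "r \<in> X" "x \<in> eigenspace S r" by blast
      show "x \<in> spectral_space S L"
      proof (cases "eigenspace S r = {0}")
        case True
        then have "x = 0" using r by simp
        then show ?thesis
          by (simp add: csubspace_0 closed_subspace_csubspace closed_subspace_spectral_space)
      next
        case False
        then show ?thesis
          using r eigenspace_subset_spectral_space[of r L S] by (auto simp: L_def)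
      qed
    qed
    then show "spectral_space S X \<subseteq> spectral_space S L"
      unfolding spectral_space_def[of S X]
      by (intro closure_cspan_minimal closed_subspace_spectral_space)
    have "(\<Union>r\<in>L. eigenspace S r) \<subseteq> spectral_space S X"
      using eigenspace_subset_spectral_space[of _ X S] by (auto simp: L_def)
    then show "spectral_space S L \<subseteq> spectral_space S X"
      unfolding spectral_space_def[of S L]
      by (intro closure_cspan_minimal closed_subspace_spectral_space)
  qed
  also have "spectral_space S L = closure (cspan (\<Union>i\<in>indices n. eigenspace S (a i)))"
    unfolding spectral_space_def aL[symmetric] by (simp add: image_image)
  finally show "orth_direct_sum (indices n) (\<lambda>i. eigenspace S (a i)) (spectral_space S X)"
    unfolding orth_direct_sum_def orthogonal_sets_def
    using closed_subspace_eigenspace[OF S'] selfadjoint_eigenspaces_orthogonal[OF S] inj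
    by (metis inj_onD)
qed

lemma orth_decomp3_proj:
  assumes "orth_decomp3 M0 M1 M2"
  shows "x = proj M0 x + proj M1 x + proj M2 x"
proof -
  have cl: "closed_subspace M0" "closed_subspace M1" "closed_subspace M2"
    and orth: "\<And>x y. x \<in> M0 \<Longrightarrow> y \<in> M1
        \<Longrightarrow> cinner x y = 0" "\<And>x y. x \<in> M0
        \<Longrightarrow> y \<in> M2 \<Longrightarrow> cinner x y = 0"
      "\<And>x y. x \<in> M1 \<Longrightarrow> y \<in> M2 \<Longrightarrow> cinner x y = 0"
    and ex: "\<exists>x0\<in>M0. \<exists>x1\<in>M1. \<exists>x2\<in>M2. x = x0 + x1 + x2"
    using assms by (auto simp: orth_decomp3_def orthogonal_sets_def)
  have orth': "\<And>x y. x \<in> M0 \<Longrightarrow> y \<in> M1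
      \<Longrightarrow> cinner y x = 0" "\<And>x y. x \<in> M0
      \<Longrightarrow> y \<in> M2 \<Longrightarrow> cinner y x = 0"
      "\<And>x y. x \<in> M1 \<Longrightarrow> y \<in> M2 \<Longrightarrow> cinner y x = 0"
    using orth cinner_eq_0_commute by blast+
  obtain x0 x1 x2 where x: "x0 \<in> M0" "x1 \<in> M1" "x2 \<in> M2" "x = x0 + x1 + x2"
    using ex by blast
  have "proj M0 x = x0"
    using x orth' by (intro proj_eqI cl) (auto simp: cinner_add_left)
  moreover have "proj M1 x = x1"
    using x orth orth' by (intro proj_eqI cl) (auto simp: cinner_add_left)
  moreover have "proj M2 x = x2"
    using x orth by (intro proj_eqI cl) (auto simp: cinner_add_left)
  ultimately show ?thesis
    using x(4) by simp
qed

text \<open>Every eigenspace lies in one of the three subspaces, so what remains after projecting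
  onto them is orthogonal to all eigenspaces and vanishes by completeness.\<close>

lemma spectral_decomposition:
  assumes S: "selfadjoint S" and K: "compact_op (\<lambda>x. S x - \<alpha> *\<^sub>R x)"
  shows "orth_decomp3 (spectral_space S {\<alpha><..}) (eigenspace S \<alpha>) (spectral_space S
      {..<\<alpha>})"
proof -
  define H0 H1 H2 where "H0 = spectral_space S {\<alpha><..}"
      and "H1 = eigenspace S \<alpha>" and "H2 = spectral_space S {..<\<alpha>}"
  have cl: "closed_subspace H0" "closed_subspace H1" "closed_subspace H2"
    by (simp_all add: H0_def H1_def H2_def closed_subspace_spectral_space
        closed_subspace_eigenspace[OF selfadjoint_bounded_op[OF S]])
  have H1: "H1 \<subseteq> spectral_space S {\<alpha>}"
    unfolding H1_def by (rule eigenspace_subset_spectral_space) simp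
  have orth: "cinner x y = 0" if "x \<in> H0" "y \<in> H1" for x y
    using that H1 unfolding H0_def
    by (intro spectral_spaces_orthogonal[OF S, of "{\<alpha><..}" "{\<alpha>}"]) auto
  have orth2: "cinner x y = 0" if "x \<in> H0" "y \<in> H2" for x y
    using that unfolding H0_def H2_def
    by (intro spectral_spaces_orthogonal[OF S, of "{\<alpha><..}" "{..<\<alpha>}"]) auto
  have orth3: "cinner x y = 0" if "x \<in> H1" "y \<in> H2" for x y
    using that H1 unfolding H2_def
    by (intro spectral_spaces_orthogonal[OF S, of "{\<alpha>}" "{..<\<alpha>}"]) auto
  have "x = proj H0 x + proj H1 x + proj H2 x" for x
  proof -
    define z where "z = x - (proj H0 x + proj H1 x + proj H2 x)"
    note p = proj_in[OF cl(1), of x] proj_in[OF cl(2), of x] proj_in[OF cl(3), of x]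
    have z0: "cinner z w = 0" if "w \<in> H0" for w
      using that orth[OF that p(2)] orth2[OF that p(3)]
      by (simp add: z_def cinner_diff_left cinner_add_left cinner_proj_left[OF cl(1)]
          cinner_eq_0_commute[of w])
    have z1: "cinner z w = 0" if "w \<in> H1" for w
      using that orth[OF p(1) that] orth3[OF that p(3)]
      by (simp add: z_def cinner_diff_left cinner_add_left cinner_proj_left[OF cl(2)]
          cinner_eq_0_commute[of w])
    have z2: "cinner z w = 0" if "w \<in> H2" for w
      using that orth2[OF p(1) that] orth3[OF p(2) that]
      by (simp add: z_def cinner_diff_left cinner_add_left cinner_proj_left[OF cl(3)])
    have "z = 0"
    proof (rule eigenspaces_complete[OF S K])
      fix r
      have "eigenspace S r \<subseteq> H0 \<or> eigenspace S r \<subseteq> H1 \<or> eigenspace S r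
          \<subseteq> H2"
        using eigenspace_subset_spectral_space[of r "{\<alpha><..}" S]
            eigenspace_subset_spectral_space[of r "{..<\<alpha>}" S]
        unfolding H0_def H1_def H2_def by (cases r \<alpha> rule: linorder_cases) auto
      then show "z \<in> orthogonal_complement (eigenspace S r)"
        using z0 z1 z2 by (auto intro!: orthogonal_complementI)
    qed
    then show ?thesis
      by (simp add: z_def)
  qed
  then have "\<exists>x0\<in>H0. \<exists>x1\<in>H1. \<exists>x2\<in>H2. x = x0 + x1 + x2" for x
    using proj_in[OF cl(1), of x] proj_in[OF cl(2), of x] proj_in[OF cl(3), of x] by blast
  then show ?thesis
    using cl orth orth2 orth3
    unfolding orth_decomp3_def orthogonal_sets_def H0_def[symmetric] H1_def[symmetric]
        H2_def[symmetric]
    by blast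
qed

section \<open>Hyponormal adjoints\<close>

context
  fixes T Ta P Q :: "'a :: complex_hilbert \<Rightarrow> 'a" and c :: real
  assumes T: "bounded_op UNIV UNIV T" and Ta: "bounded_op UNIV UNIV Ta"
    and adj: "\<And>x y. cinner (T x) y = cinner x (Ta y)"
    and P: "\<And>x. P x = T (Ta x)" and Q: "\<And>x. Q x = Ta (T x)"
    and hyp: "\<And>x. norm (T x) \<le> norm (Ta x)"
    and c: "0 \<le> c" and K: "compact_op (\<lambda>x. P x - c *\<^sub>R x)"
begin

private lemma adj': "cinner (Ta x) y = cinner x (T y)"
  by (metis adj cinner_commute)

private lemma P_form: "Re (cinner (P x) x) = (norm (Ta x))\<^sup>2"
  by (simp add: P adj Re_cinner_self)

private lemma Q_form: "Re (cinner (Q x) x) = (norm (T x))\<^sup>2"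
  by (simp add: Q adj' Re_cinner_self)

private lemma selfadjoint_P: "selfadjoint P"
  using bounded_op_compose[OF T Ta] unfolding selfadjoint_def fun_eq_iff
  by (simp add: P[abs_def] adj adj')

private lemma selfadjoint_Q: "selfadjoint Q"
  using bounded_op_compose[OF Ta T] unfolding selfadjoint_def fun_eq_iff
  by (simp add: Q[abs_def] adj adj')

text \<open>\<open>Ta\<close> intertwines \<open>P\<close> with \<open>Q\<close> because
  \<open>Ta (T (Ta x))\<close> can be bracketed either way; the next lemma is the same for
  \<open>T\<close>.\<close>

lemma adjoint_maps_eigenspace: "x \<in> eigenspace P r \<Longrightarrow> Ta x \<in> eigenspace Q r"
  by (simp add: in_eigenspace_iff Q bounded_op_scaleR[OF Ta] flip: P)

lemma maps_eigenspace: "x \<in> eigenspace Q r \<Longrightarrow> T x \<in> eigenspace P r"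
  by (simp add: in_eigenspace_iff P bounded_op_scaleR[OF T] flip: Q)

text \<open>For an eigenvector \<open>x\<close> of \<open>Q\<close> hyponormality gives
  \<open>cinner (P x) x\<close> at least \<open>p\<close> times the squared norm, while
  \<open>p\<close> bounds the form on \<open>M\<close>. The maximum is attained at \<open>x\<close>,
  and invariance of \<open>M\<close> under \<open>P\<close> turns this into an eigenvector
  equation.\<close>

private lemma form_le_imp_eigenvector:
  assumes M: "csubspace M" and bound: "\<And>w. w \<in> M
      \<Longrightarrow> (norm (Ta w))\<^sup>2 \<le> p * (norm w)\<^sup>2"
    and inv: "\<And>w. w \<in> M \<Longrightarrow> P w \<in> M" and x: "x \<in> M" "x \<in>
        eigenspace Q p"
  shows "x \<in> eigenspace P p"
proof -
  define G where "G = (\<lambda>x. (-1) *\<^sub>R (P x - p *\<^sub>R x))"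
  have G: "selfadjoint G"
    unfolding G_def by (intro selfadjoint_scaleR selfadjoint_diff_scaleR selfadjoint_P)
  have ReG: "Re (cinner (G w) w) = p * (norm w)\<^sup>2 - (norm (Ta w))\<^sup>2" for w
    by (simp add: G_def cinner_simps P_form Re_cinner_self)
  have "p * (norm x)\<^sup>2 = (norm (T x))\<^sup>2"
    using Q_form[of x] x(2) by (simp add: in_eigenspace_iff cinner_simps Re_cinner_self)
  also have "\<dots> \<le> (norm (Ta x))\<^sup>2"
    by (intro power_mono hyp) simp
  finally have "Re (cinner (G x) x) \<le> 0"
    by (simp add: ReG)
  moreover have "0 \<le> Re (cinner (G w) w)" if "w \<in> M" for w
    using bound[OF that] by (simp add: ReG)
  moreover have "G x \<in> M"
    unfolding G_def by (intro csubspace_scaleR csubspace_diff M inv x)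
  ultimately have "cinner (G x) (G x) = 0"
    by (intro csubspace_form_null[OF G M _ x(1)])
  then show ?thesis
    by (simp add: G_def in_eigenspace_iff)
qed

text \<open>If \<open>p > c\<close> is the top of the spectrum of \<open>P\<close> on the
    orthogonal complement of the eigenspaces
  known to agree, then \<open>Q \<le> P\<close> puts the eigenspace of \<open>Q\<close> inside
      that of \<open>P\<close>; since \<open>Ta\<close> maps the
  latter, which is finite dimensional, injectively into the former, the two agree.\<close>

private lemma eigenspaces_agree_aux:
  fixes D :: "real set"
  defines "D \<equiv> {r. c < r \<and> eigenspace P r = eigenspace Q r}"
  defines "M \<equiv> orthogonal_complement (\<Union>r\<in>D. eigenspace P r)"
  assumes x: "x \<in> M"
  shows "(norm (Ta x))\<^sup>2 \<le> c * (norm x)\<^sup>2"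
proof (rule ccontr)
  assume neg: "\<not> ?thesis"
  note P' = selfadjoint_bounded_op[OF selfadjoint_P]
  define L where "L = (\<lambda>x. P x - c *\<^sub>R x)"
  have L: "selfadjoint L" "compact_op L"
    unfolding L_def using K by (auto intro: selfadjoint_diff_scaleR selfadjoint_P)
  have ReL: "Re (cinner (L w) w) = (norm (Ta w))\<^sup>2 - c * (norm w)\<^sup>2" for w
    by (simp add: L_def cinner_simps P_form Re_cinner_self)
  have M: "closed_subspace M"
    unfolding M_def by (rule closed_subspace_orthogonal_complement)
  note sub = closed_subspace_csubspace[OF M]
  have PM: "P w \<in> M" if "w \<in> M" for w
    using that unfolding M_def orthogonal_complement_def
    by (auto simp: selfadjoint_cinner[OF selfadjoint_P] in_eigenspace_iff cinner_scaleR_right)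
  have LM: "L w \<in> M" if "w \<in> M" for w
    unfolding L_def by (intro csubspace_diff csubspace_scaleR sub PM that)
  have "0 < Re (cinner (L x) x)"
    using neg by (simp add: ReL)
  from compact_selfadjoint_eigenvector[OF L M LM x this]
  obtain q e where q: "q > 0" and e: "e \<in> M" "e \<noteq> 0" "L e = q *\<^sub>R e"
    and top: "\<And>w. w \<in> M \<Longrightarrow> Re (cinner (L w) w) \<le> q * (norm w)\<^sup>2"
    by blast
  define p where "p = c + q"
  have p: "c < p" using q by (simp add: p_def)
  have eP: "e \<in> eigenspace P p"
    using e(3) by (simp add: L_def in_eigenspace_iff p_def algebra_simps)
  have "p \<notin> D"
  proof
    assume "p \<in> D"
    then have "cinner e e = 0"
      using e(1) eP by (auto simp: M_def orthogonal_complement_def)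
    with e(2) show False by simp
  qed
  \<comment> \<open>Eigenspaces of \<open>Q\<close> are mutually orthogonal, and those with index in
    \<open>D\<close> are eigenspaces of \<open>P\<close>; this is why \<open>D\<close> collects the
    values where the two agree.\<close>
  have QpM: "eigenspace Q p \<subseteq> M"
  proof
    fix w assume w: "w \<in> eigenspace Q p"
    show "w \<in> M"
      unfolding M_def
    proof (rule orthogonal_complementI)
      fix b assume "b \<in> (\<Union>r\<in>D. eigenspace P r)"
      then obtain s where s: "s \<in> D" "b \<in> eigenspace P s" by blast
      then have "b \<in> eigenspace Q s" "p \<noteq> s"
        using \<open>p \<notin> D\<close> unfolding D_def by auto
      then show "cinner w b = 0"
        using selfadjoint_eigenspaces_orthogonal[OF selfadjoint_Q _ w] by simp
    qed
  qed
  have bound: "(norm (Ta w))\<^sup>2 \<le> p * (norm w)\<^sup>2" if "w \<in> M" for w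
    using top[OF that] by (simp add: ReL p_def algebra_simps)
  have QP: "eigenspace Q p \<subseteq> eigenspace P p"
    using form_le_imp_eigenvector[OF sub bound PM] QpM by blast
  have cl: "closed_subspace (eigenspace P p)"
    by (rule closed_subspace_eigenspace[OF P'])
  \<comment> \<open>\<open>p > c\<close> lies off the essential spectrum, so \<open>P - p\<close> is
    Fredholm.\<close>
  have fd: "finite_dim (eigenspace P p)"
    using fredholm_off_essential[OF selfadjoint_P K, of "complex_of_real p"] p
    by (simp add: fredholm_def eigenspace_def scaleC_of_real)
  have "Ta ` eigenspace P p = eigenspace P p"
  proof (rule finite_dim_surj_on[OF Ta closed_subspace_csubspace[OF cl] fd])
    show "Ta w \<in> eigenspace P p" if "w \<in> eigenspace P p" for w
      using adjoint_maps_eigenspace[OF that] QP by blast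
    show "w = 0" if "w \<in> eigenspace P p" "Ta w = 0" for w
      using that p c by (simp add: in_eigenspace_iff P bounded_op_zero[OF T])
  qed
  then have "eigenspace P p \<subseteq> eigenspace Q p"
    using adjoint_maps_eigenspace[of _ p] by (metis imageE subsetI)
  then have "p \<in> D"
    using QP p by (simp add: D_def subset_antisym)
  with \<open>p \<notin> D\<close> show False ..
qed

text \<open>If the two differ, the eigenspace of \<open>P\<close> is orthogonal to all agreeing
  ones, where the form of \<open>P\<close> is at most \<open>c < r\<close>; so it is 0. Then
  \<open>T\<close> kills the eigenspace of \<open>Q\<close>, which is 0 too since
  \<open>r > 0\<close>.\<close>

lemma eigenspaces_agree:
  assumes r: "c < r"
  shows "eigenspace P r = eigenspace Q r"
proof (rule ccontr)
  assume neq: "eigenspace P r \<noteq> eigenspace Q r"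
  define D where "D = {r. c < r \<and> eigenspace P r = eigenspace Q r}"
  have "w = 0" if w: "w \<in> eigenspace P r" for w
  proof -
    have "w \<in> orthogonal_complement (\<Union>r\<in>D. eigenspace P r)"
    proof (rule orthogonal_complementI)
      fix b assume "b \<in> (\<Union>r\<in>D. eigenspace P r)"
      then obtain s where s: "s \<in> D" "b \<in> eigenspace P s" by blast
      then have "r \<noteq> s"
        using neq by (auto simp: D_def)
      then show "cinner w b = 0"
        using selfadjoint_eigenspaces_orthogonal[OF selfadjoint_P _ w s(2)] by blast
    qed
    then have "(norm (Ta w))\<^sup>2 \<le> c * (norm w)\<^sup>2"
      unfolding D_def by (rule eigenspaces_agree_aux)
    moreover have "(norm (Ta w))\<^sup>2 = r * (norm w)\<^sup>2"
      using w P_form[of w] by (simp add: in_eigenspace_iff cinner_simps Re_cinner_self)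
    ultimately have "(r - c) * (norm w)\<^sup>2 \<le> 0"
      by (simp add: algebra_simps)
    then show "w = 0"
      using r by (simp add: mult_le_0_iff)
  qed
  then have P0: "eigenspace P r = {0}"
    using zero_in_eigenspace[OF selfadjoint_bounded_op[OF selfadjoint_P]] by auto
  have "w = 0" if w: "w \<in> eigenspace Q r" for w
  proof -
    have "T w = 0"
      using maps_eigenspace[OF w] P0 by simp
    then have "r *\<^sub>R w = 0"
      using w by (simp add: in_eigenspace_iff Q bounded_op_zero[OF Ta])
    then show ?thesis
      using r c by simp
  qed
  then have "eigenspace Q r = {0}"
    using zero_in_eigenspace[OF selfadjoint_bounded_op[OF selfadjoint_Q]] by auto
  with neq P0 show False by simp
qed

text \<open>\<open>Ta x\<close> is an eigenvector of \<open>Q\<close> for \<open>c\<close>, and it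
  is orthogonal to the agreeing eigenspaces because \<open>T\<close> maps these into eigenspaces of
  \<open>P\<close> orthogonal to \<open>x\<close>. On that complement \<open>c\<close> is the top of
  \<open>P\<close>, so the maximum argument applies without any dimension count.\<close>

lemma adjoint_maps_essential_eigenspace:
  assumes x: "x \<in> eigenspace P c"
  shows "Ta x \<in> eigenspace P c"
proof -
  define D where "D = {r. c < r \<and> eigenspace P r = eigenspace Q r}"
  define M where "M = orthogonal_complement (\<Union>r\<in>D. eigenspace P r)"
  have M: "csubspace M"
    unfolding M_def by (rule csubspace_orthogonal_complement)
  show ?thesis
  proof (rule form_le_imp_eigenvector[OF M])
    show "(norm (Ta w))\<^sup>2 \<le> c * (norm w)\<^sup>2" if "w \<in> M" for w
      using that unfolding M_def D_def by (rule eigenspaces_agree_aux)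
    show "P w \<in> M" if "w \<in> M" for w
      using that unfolding M_def orthogonal_complement_def
      by (auto simp: selfadjoint_cinner[OF selfadjoint_P] in_eigenspace_iff cinner_scaleR_right)
    show "Ta x \<in> eigenspace Q c"
      by (rule adjoint_maps_eigenspace[OF x])
    show "Ta x \<in> M"
      unfolding M_def
    proof (rule orthogonal_complementI)
      fix b assume "b \<in> (\<Union>r\<in>D. eigenspace P r)"
      then obtain s where s: "s \<in> D" "b \<in> eigenspace Q s"
        by (auto simp: D_def)
      have "cinner x (T b) = 0"
        using selfadjoint_eigenspaces_orthogonal[OF selfadjoint_P _ x maps_eigenspace[OF s(2)]] s(1)
        by (auto simp: D_def)
      then show "cinner (Ta x) b = 0"
        by (simp add: adj')
    qed
  qed
qed

end

text \<open>For \<open>r > 0\<close> the operator \<open>S + r\<close> is positive definite, so it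
  can be cancelled from \<open>S\<^sup>2 - r\<^sup>2\<close>; for \<open>r = 0\<close> symmetry
  gives \<open>norm (S x) = 0\<close>.\<close>

lemma eigenspace_sqrt:
  assumes S: "selfadjoint S" "\<And>x. 0 \<le> Re (cinner (S x) x)" and P:
      "\<And>x. S (S x) = P x" and r: "0 \<le> r"
  shows "eigenspace S r = eigenspace P (r\<^sup>2)"
proof (intro set_eqI iffI)
  note S' = selfadjoint_bounded_op[OF S(1)]
  fix x
  show "x \<in> eigenspace P (r\<^sup>2)" if "x \<in> eigenspace S r"
    using that by (simp add: in_eigenspace_iff bounded_op_scaleR[OF S'] power2_eq_square flip: P)
  show "x \<in> eigenspace S r" if x: "x \<in> eigenspace P (r\<^sup>2)"
  proof (cases "r = 0")
    case True
    then have "cinner (S x) (S x) = 0"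
      using x by (simp add: in_eigenspace_iff selfadjoint_cinner[OF S(1), of x] P)
    then show ?thesis
      using True by (simp add: in_eigenspace_iff)
  next
    case False
    define y where "y = S x - r *\<^sub>R x"
    have "S y + r *\<^sub>R y = 0"
      using x by (simp add: y_def in_eigenspace_iff bounded_op_diff[OF S'] bounded_op_scaleR[OF
          S'] P
          power2_eq_square algebra_simps)
    then have "Re (cinner (S y + r *\<^sub>R y) y) = 0"
      by simp
    then have "Re (cinner (S y) y) + r * (norm y)\<^sup>2 = 0"
      by (simp add: cinner_simps Re_cinner_self)
    moreover have "0 \<le> r * (norm y)\<^sup>2"
      using r by simp
    ultimately have "r * (norm y)\<^sup>2 = 0"
      using S(2)[of y] by linarith
    then show ?thesis
      using False by (simp add: y_def in_eigenspace_iff)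
  qed
qed

section \<open>Restrictions to subspaces and the block decomposition\<close>

lemma bounded_op_restrict:
  "bounded_op UNIV UNIV A \<Longrightarrow> (\<And>x. x \<in> M
      \<Longrightarrow> A x \<in> N) \<Longrightarrow> bounded_op M N A"
  unfolding bounded_op_def by (intro conjI) auto

lemma bounded_op_cong:
  assumes "csubspace M" and eq: "\<And>x. x \<in> M
      \<Longrightarrow> A x = B x" and B: "bounded_op M N B"
  shows "bounded_op M N A"
  using B eq csubspace_add[OF assms(1)] csubspace_scale[OF assms(1)] by (simp add: bounded_op_def)

lemma adj_compression:
  assumes M: "closed_subspace M" and N: "closed_subspace N"
    and adj: "\<And>x y. cinner (T x) y = cinner x (Ta y)" and y: "y \<in> N"
  shows "adj M (\<lambda>x. proj N (T x)) y = proj M (Ta y)"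
  by (rule adj_eqI) (simp_all add: closed_subspace_csubspace M proj_in cinner_proj_left[OF N y]
      cinner_proj_right[OF M] adj)

lemma adj_restrict:
  assumes M: "closed_subspace M" and adj: "\<And>x y. cinner (T x) y = cinner x (Ta y)"
  shows "adj M T y = proj M (Ta y)"
  by (rule adj_eqI) (simp_all add: closed_subspace_csubspace M proj_in cinner_proj_right[OF M] adj)

theorem corollary4p6:
  fixes T :: "'a :: complex_hilbert \<Rightarrow>\<^sub>L 'a"
    and Tadj absTadj :: "'a \<Rightarrow> 'a"
  defines "Tadj \<equiv> adj UNIV (blinfun_apply T)"
  defines "absTadj \<equiv> abs_op Tadj"
  assumes "\<not> finite_dim (UNIV :: 'a set)"
    and "T \<in> closure AN"
    and "hyponormal Tadj"
  shows "\<exists>H0 H1 H2 S0 S1 A1 B1 (\<alpha> :: real).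
    orth_decomp3 H0 H1 H2 \<and>
    bounded_op H0 H0 S0 \<and> bounded_op H1 H1 S1 \<and> bounded_op H1 H2 A1 \<and> bounded_op H2 H2 B1 \<and>
    (\<forall>x0\<in>H0. \<forall>x1\<in>H1. \<forall>x2\<in>H2.
       blinfun_apply T (x0 + x1 + x2) = S0 x0 + \<alpha> *\<^sub>R S1 x1 + (A1 x1 + B1 x2)) \<and>
    ess_spectrum absTadj = {complex_of_real \<alpha>} \<and> 0 \<le> \<alpha> \<and>
    \<comment> \<open>(i)\<close>
    (\<exists>n a. enumerates n a (complex_of_real ` {\<alpha><..norm T} \<inter> spectrum absTadj)) \<and>
    (\<forall>n a. enumerates n a (complex_of_real ` {\<alpha><..norm T} \<inter> spectrum absTadj) \<longrightarrow>
       orth_direct_sum (indices n) (\<lambda>i. eigenspace absTadj (a i)) H0 \<and>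
       (\<exists>U. (\<forall>i\<in>indices n. unitary_on (eigenspace absTadj (a i)) (U i)) \<and>
            (\<forall>x\<in>H0. S0 x =
               direct_sum_op (indices n) (\<lambda>i. eigenspace absTadj (a i)) (\<lambda>i y. a i *\<^sub>R U i y) x))) \<and>
    (\<alpha> = norm T \<longrightarrow> H0 = {0}) \<and>
    \<comment> \<open>(ii)\<close>
    (H1 \<noteq> {0} \<longrightarrow> co_isometry_on H1 S1) \<and>
    (H1 = {0} \<longrightarrow> (\<forall>x\<in>H1. S1 x = 0)) \<and>
    \<comment> \<open>(iii)\<close>
    (\<forall>y\<in>H2. S1 (adj H1 A1 y) = 0) \<and>
    (\<exists>m b. enumerates m b (complex_of_real ` {min_modulus Tadj..<\<alpha>} \<inter> spectrum absTadj)) \<and>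
    (\<forall>m b. enumerates m b (complex_of_real ` {min_modulus Tadj..<\<alpha>} \<inter> spectrum absTadj) \<longrightarrow>
       orth_direct_sum (indices m) (\<lambda>j. eigenspace absTadj (b j)) H2 \<and>
       (\<forall>y\<in>H2. A1 (adj H1 A1 y) + B1 (adj H2 B1 y) =
          direct_sum_op (indices m) (\<lambda>j. eigenspace absTadj (b j)) (\<lambda>j z. (b j)\<^sup>2 *\<^sub>R z) y) \<and>
       op_le_on H2 (\<lambda>y. adj H2 B1 (B1 y))
         (direct_sum_op (indices m) (\<lambda>j. eigenspace absTadj (b j)) (\<lambda>j z. (b j)\<^sup>2 *\<^sub>R z))) \<and>
    (\<alpha> = min_modulus Tadj \<longrightarrow> H2 = {0}) \<and>
    (norm T = \<alpha> \<and> \<alpha> = min_modulus Tadj \<longrightarrow> (\<forall>x. blinfun_apply T x = norm T *\<^sub>R S1 x))"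
proof -
  note T = bounded_op_closure_AN[OF assms(4)]
  have Ta: "bounded_op UNIV UNIV Tadj"
    unfolding Tadj_def by (rule bounded_op_adj[OF T])
  have adj: "cinner (T x) y = cinner x (Tadj y)" and adj': "cinner (Tadj x) y = cinner x (T y)"
      for x y
    unfolding Tadj_def by (simp_all add: cinner_adj_right[OF T] cinner_adj_left[OF T])
  have adj_Tadj: "Defs.adj UNIV Tadj = T"
    unfolding Tadj_def by (rule adj_adj[OF T])
  have hyp: "norm (T x) \<le> norm (Tadj x)" for x
  proof -
    have "0 \<le> Re (cinner (T (Tadj x) - Tadj (T x)) x)"
      using assms(5) by (simp add: hyponormal_def positive_on_def adj_Tadj)
    then have "(norm (T x))\<^sup>2 \<le> (norm (Tadj x))\<^sup>2"
      by (simp add: cinner_diff_left adj[of "Tadj x" x] adj'[of "T x" x] Re_cinner_self)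
    then show ?thesis
      by (rule power2_le_imp_le) simp
  qed
  define S where "S = absTadj"
  have S: "selfadjoint S" and S_nonneg: "\<And>x. 0 \<le> Re (cinner (S x) x)"
    and SS: "\<And>x. S (S x) = T (Tadj x)" and norm_S: "\<And>x. norm (S x) = norm (Tadj x)"
    using selfadjoint_abs_op[OF Ta] abs_op_nonneg[OF Ta] abs_op_abs_op[OF Ta] norm_abs_op[OF Ta]
    by (simp_all add: S_def absTadj_def adj_Tadj)
  note S' = selfadjoint_bounded_op[OF S]
  define P where "P = (\<lambda>x. T (Tadj x))"
  define Q where "Q = (\<lambda>x. Tadj (T x))"
  have P: "bounded_op UNIV UNIV P"
    unfolding P_def by (rule bounded_op_compose[OF T Ta])
  have Q: "bounded_op UNIV UNIV Q"
    unfolding Q_def by (rule bounded_op_compose[OF Ta T])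
  obtain \<alpha> where \<alpha>: "0 \<le> \<alpha>" and KP: "compact_op (\<lambda>x. P x -
      \<alpha>\<^sup>2 *\<^sub>R x)"
    using closure_AN_hyponormal_compact[OF assms(4)] hyp unfolding Tadj_def P_def by blast
  have K: "compact_op (\<lambda>x. S x - \<alpha> *\<^sub>R x)"
    using compact_op_sqrt[OF S S_nonneg \<alpha>] KP by (simp add: SS P_def)
  have eig_P: "eigenspace S r = eigenspace P (r\<^sup>2)" if "0 \<le> r" for r
    by (rule eigenspace_sqrt[OF S S_nonneg _ that]) (simp add: P_def SS)
  have PQ: "P x = T (Tadj x)" "Q x = Tadj (T x)" for x
    by (simp_all add: P_def Q_def)
  note hypo = T Ta adj PQ hyp zero_le_power2 KP
  have eig_Q: "eigenspace S r = eigenspace Q (r\<^sup>2)" if "\<alpha> < r" for r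
    using eigenspaces_agree[OF hypo, of "r\<^sup>2"] eig_P[of r] that \<alpha>
        power_strict_mono[of \<alpha> r 2] by simp
  have T_eig: "T x \<in> eigenspace S r" and Ta_eig: "Tadj x \<in> eigenspace S r"
    if "\<alpha> < r" "x \<in> eigenspace S r" for r x
    using maps_eigenspace[OF hypo, of x "r\<^sup>2"] adjoint_maps_eigenspace[OF hypo, of x
        "r\<^sup>2"]
      eig_P[of r] eig_Q[of r] that \<alpha> by auto
  \<comment> \<open>These bounds allow the bounded intervals of the theorem to be replaced by the
    half-lines above and below \<alpha>.\<close>
  have eig_bounds: "0 \<le> r" "r \<le> norm T" "min_modulus Tadj \<le> r"
      if "eigenspace S r \<noteq> {0}" for r
  proof -
    have "\<exists>x. x \<in> eigenspace S r \<and> x \<noteq> 0"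
      using that zero_in_eigenspace[OF S', of r] by auto
    then obtain x where x: "x \<in> eigenspace S r" "x \<noteq> 0" by blast
    define u where "u = (1 / norm x) *\<^sub>R x"
    have u: "norm u = 1" "S u = r *\<^sub>R u"
      using x by (simp_all add: u_def in_eigenspace_iff bounded_op_scaleR[OF S'])
    show r0: "0 \<le> r"
      using S_nonneg[of u] u by (simp add: cinner_simps Re_cinner_self)
    have nu: "norm (Tadj u) = r"
      using norm_S[of u] u r0 by simp
    show "r \<le> norm T"
      using norm_adj_le[OF T, of "norm T" u] norm_blinfun[of T] nu u(1) by (simp add: Tadj_def)
    have "min_modulus Tadj \<le> norm (Tadj u)"
      unfolding min_modulus_def using u(1)
      by (intro cINF_lower bdd_belowI2[of _ 0]) auto
    then show "min_modulus Tadj \<le> r"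
      by (simp add: nu)
  qed

  define H0 H1 H2 where "H0 = spectral_space S {\<alpha><..}" and "H1 = eigenspace S \<alpha>"
    and "H2 = spectral_space S {..<\<alpha>}"
  have decomp: "orth_decomp3 H0 H1 H2"
    unfolding H0_def H1_def H2_def by (rule spectral_decomposition[OF S K])
  have cl: "closed_subspace H0" "closed_subspace H1" "closed_subspace H2"
    and orth: "\<And>x y. x \<in> H0 \<Longrightarrow> y \<in> H1
        \<Longrightarrow> cinner x y = 0" "\<And>x y. x \<in> H0
        \<Longrightarrow> y \<in> H2 \<Longrightarrow> cinner x y = 0"
      "\<And>x y. x \<in> H1 \<Longrightarrow> y \<in> H2 \<Longrightarrow> cinner x y = 0"
    using decomp by (auto simp: orth_decomp3_def orthogonal_sets_def)
  note sub = cl[THEN closed_subspace_csubspace]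
  have split: "x = proj H0 x + proj H1 x + proj H2 x" for x
    by (rule orth_decomp3_proj[OF decomp])
  have orthI: "x \<in> orthogonal_complement H0" if "x \<in> H1 \<or> x \<in> H2" for x
    using that orth cinner_eq_0_commute[of x] by (auto intro!: orthogonal_complementI)
  have split12: "x = proj H1 x + proj H2 x" if "x \<in> orthogonal_complement H0" for x
    using split[of x] proj_orthogonal[OF cl(1) that] by simp
  have T0: "T x \<in> H0" and Ta0: "Tadj x \<in> H0" if "x \<in> H0" for x
    using that spectral_space_invariant[OF T, of "{\<alpha><..}" S] spectral_space_invariant[OF
        Ta, of "{\<alpha><..}" S]
      T_eig Ta_eig by (auto simp: H0_def)
  have T_orth: "T x \<in> orthogonal_complement H0" and Ta_orth: "Tadj x \<in>
      orthogonal_complement H0"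
    if "x \<in> orthogonal_complement H0" for x
    using that T0 Ta0 by (auto simp: orthogonal_complement_def adj adj')
  have Ta1: "Tadj x \<in> H1" if "x \<in> H1" for x
    using adjoint_maps_essential_eigenspace[OF hypo, of x] that eig_P[OF \<alpha>]
        by (simp add: H1_def)
  \<comment> \<open>Dual to the invariance of \<open>H1\<close> under \<open>Tadj\<close>:
    \<open>T x\<close> is orthogonal to \<open>H1\<close>, and also to \<open>H0\<close>, which
    reduces \<open>T\<close>.\<close>
  have T2: "T x \<in> H2" if "x \<in> H2" for x
  proof -
    have "T x \<in> orthogonal_complement H1"
      using that Ta1 orth(3) cinner_eq_0_commute[of x]
      by (auto intro!: orthogonal_complementI simp: adj)
    then have "T x = proj H2 (T x)"
      using split12[OF T_orth[OF orthI]] that proj_orthogonal[OF cl(2)] by fastforce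
    then show ?thesis
      using proj_in[OF cl(3)] by metis
  qed
  have P2: "P x \<in> H2" if "x \<in> H2" for x
    unfolding H2_def
  proof (rule spectral_space_invariant[OF P _ that[unfolded H2_def]])
    show "P w \<in> eigenspace S r" if "w \<in> eigenspace S r" for w r
      using that by (simp add: in_eigenspace_iff P_def bounded_op_scaleR[OF S'] flip: SS)
  qed
  have H2_0: "H2 = {0}" if "\<alpha> = 0 \<or> \<alpha> = min_modulus Tadj"
    unfolding H2_def using eig_bounds that by (intro spectral_space_eq_zero) force
  have H0_0: "H0 = {0}" if "\<alpha> = norm T"
    unfolding H0_def using eig_bounds(2) that by (intro spectral_space_eq_zero) force
  have norm_Ta1: "norm (Tadj x) = \<alpha> * norm x" if "x \<in> H1" for x
    using that \<alpha> norm_S[of x] by (simp add: H1_def in_eigenspace_iff)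

  \<comment> \<open>For \<alpha> equal to 0 the middle block is 0 whatever \<open>S1\<close> is; the
    identity serves as a co-isometry.\<close>
  define S1 where "S1 = (\<lambda>x. if \<alpha> = 0 then x else (1 / \<alpha>) *\<^sub>R proj H1
      (T x))"
  define A1 where "A1 = (\<lambda>x. proj H2 (T x))"
  have S1_bounded: "bounded_op H1 H1 S1"
  proof (cases "\<alpha> = 0")
    case True
    then show ?thesis
      using bounded_op_restrict[OF selfadjoint_bounded_op[OF selfadjoint_id], of H1 H1]
      by (simp add: S1_def)
  next
    case False
    have "bounded_op UNIV UNIV (\<lambda>x. (1 / \<alpha>) *\<^sub>R proj H1 (T x))"
      by (rule bounded_op_scaleR_fun[OF bounded_op_compose[OF bounded_op_proj[OF cl(2)] T]])
    from bounded_op_restrict[OF this, of H1 H1] show ?thesis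
      using False proj_in[OF cl(2)] csubspace_scaleR[OF sub(2)] by (simp add: S1_def)
  qed
  have A1_bounded: "bounded_op H1 H2 A1"
    unfolding A1_def
    by (rule bounded_op_restrict[OF bounded_op_compose[OF bounded_op_proj[OF cl(3)] T]])
       (rule proj_in[OF cl(3)])
  have S1_eq: "\<alpha> *\<^sub>R S1 x = proj H1 (T x)" if "x \<in> H1" for x
  proof (cases "\<alpha> = 0")
    case True
    then have "T x = 0"
      using hyp[of x] norm_Ta1[OF that] by simp
    then show ?thesis
      using True by (simp add: proj_ident csubspace_0 sub cl)
  qed (simp add: S1_def)
  \<comment> \<open>Only values on the respective subspace matter, so \<open>T\<close> itself serves
    as \<open>S0\<close> and as \<open>B1\<close>.\<close>
  have block: "T (x0 + x1 + x2) = T x0 + \<alpha> *\<^sub>R S1 x1 + (A1 x1 + T x2)"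
      if "x1 \<in> H1" for x0 x1 x2
    using split12[OF T_orth[OF orthI]] that
    by (simp add: bounded_op_add[OF T] S1_eq A1_def add.assoc)
  have S1_coisom: "co_isometry_on H1 S1"
  proof -
    \<comment> \<open>Since \<open>Tadj\<close> preserves \<open>H1\<close>, no projection appears
      in the adjoint, and \<open>norm_Ta1\<close> makes it an isometry.\<close>
    have adjS1: "Defs.adj H1 S1 y = (if \<alpha> = 0 then y else (1 / \<alpha>) *\<^sub>R Tadj y)"
        if "y \<in> H1" for y
      using that Ta1[OF that] csubspace_scaleR[OF sub(2)]
      by (intro adj_eqI sub) (auto simp: S1_def cinner_simps cinner_proj_left[OF cl(2)] adj)
    have "bounded_op H1 H1 (\<lambda>y. if \<alpha> = 0 then y else (1 / \<alpha>) *\<^sub>R Tadj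
        y)"
    proof (cases "\<alpha> = 0")
      case True
      then show ?thesis
        using bounded_op_restrict[OF selfadjoint_bounded_op[OF selfadjoint_id], of H1 H1] by simp
    next
      case False
      then show ?thesis
        using bounded_op_restrict[OF bounded_op_scaleR_fun[OF Ta, of "1 / \<alpha>"], of H1 H1]
          Ta1 csubspace_scaleR[OF sub(2)] by simp
    qed
    then have "bounded_op H1 H1 (Defs.adj H1 S1)"
      by (rule bounded_op_cong[OF sub(2), rotated]) (rule adjS1)
    moreover have "norm (Defs.adj H1 S1 y) = norm y" if "y \<in> H1" for y
      using \<alpha> by (simp add: adjS1[OF that] norm_Ta1[OF that])
    ultimately show ?thesis
      using S1_bounded by (simp add: co_isometry_on_def isometry_on_def)
  qed
  have adjA1: "Defs.adj H1 A1 y = proj H1 (Tadj y)" if "y \<in> H2" for y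
    unfolding A1_def by (rule adj_compression[OF cl(2,3) adj that])
  have adjB1: "Defs.adj H2 T y = proj H2 (Tadj y)" for y
    by (rule adj_restrict[OF cl(3) adj])
  have TA: "T (proj H1 (Tadj y)) + T (proj H2 (Tadj y)) = P y" if "y \<in> H2" for y
    using split12[OF Ta_orth[OF orthI], of y] that by (simp add: P_def flip: bounded_op_add[OF T])
  \<comment> \<open>Both \<open>P y\<close> and \<open>T\<close> of the \<open>H2\<close> part of
    \<open>Tadj y\<close> lie in \<open>H2\<close>, so \<open>T\<close> of the \<open>H1\<close>
    part does as well. Its component in \<open>H1\<close> is \<alpha> times \<open>S1\<close>
    applied to the adjoint of \<open>A1\<close> at \<open>y\<close>, which must vanish.\<close>
  have TA2: "T (proj H1 (Tadj y)) \<in> H2" if "y \<in> H2" for y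
    using TA[OF that] csubspace_diff[OF sub(3) P2[OF that] T2[OF proj_in[OF cl(3)]], of "Tadj y"]
    by (simp add: eq_diff_eq[symmetric])
  have S1A1: "S1 (Defs.adj H1 A1 y) = 0" if y: "y \<in> H2" for y
  proof (cases "\<alpha> = 0")
    case True
    then have "y = 0"
      using H2_0 y by simp
    then show ?thesis
      using True adjA1[OF y] by (simp add: S1_def bounded_op_zero[OF Ta] proj_ident csubspace_0
          sub cl)
  next
    case False
    have "T (proj H1 (Tadj y)) \<in> orthogonal_complement H1"
      using TA2[OF y] orth(3) by (auto intro!: orthogonal_complementI simp: cinner_eq_0_commute)
    then show ?thesis
      using False adjA1[OF y] by (simp add: S1_def proj_orthogonal[OF cl(2)])
  qed
  have AABB: "A1 (Defs.adj H1 A1 y) + T (Defs.adj H2 T y) = P y" if "y \<in> H2" for y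
    unfolding adjA1[OF that] adjB1 using TA[OF that]
    by (simp add: A1_def proj_ident[OF cl(3) TA2[OF that]])

  have spec0: "complex_of_real ` {\<alpha><..norm T} \<inter> spectrum S =
      complex_of_real ` {r\<in>{\<alpha><..}. eigenspace S r \<noteq> {0}}"
    using eigenvalue_iff_spectrum[OF S K] eig_bounds(2) by (auto simp: image_iff) blast+
  have spec2: "complex_of_real ` {min_modulus Tadj..<\<alpha>} \<inter> spectrum S =
      complex_of_real ` {r\<in>{..<\<alpha>}. eigenspace S r \<noteq> {0}}"
    using eigenvalue_iff_spectrum[OF S K] eig_bounds(3) by (auto simp: image_iff) blast+
  have countable: "countable {r\<in>X. eigenspace S r \<noteq> {0}}" if "\<alpha> \<notin> X" for X
    using that by (intro countable_subset[OF _ countable_eigenvalues[OF S K]]) auto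
  have ex0: "\<exists>n a. enumerates n a (complex_of_real ` {\<alpha><..norm T} \<inter> spectrum
      S)"
    unfolding spec0 by (intro countable_enumerates countable) simp
  have ex2: "\<exists>m b. enumerates m b (complex_of_real ` {min_modulus Tadj..<\<alpha>}
      \<inter> spectrum S)"
    unfolding spec2 by (intro countable_enumerates countable) simp
  have i: "orth_direct_sum (indices n) (\<lambda>i. eigenspace S (a i)) H0 \<and>
      (\<exists>U. (\<forall>i\<in>indices n. unitary_on (eigenspace S (a i)) (U i)) \<and>
        (\<forall>x\<in>H0. T x = direct_sum_op (indices n) (\<lambda>i. eigenspace S (a i))
            (\<lambda>i y. a i *\<^sub>R U i y) x))"
    if "enumerates n a (complex_of_real ` {\<alpha><..norm T} \<inter> spectrum S)" for n a
  \<comment> \<open>The unitary parts are \<open>T\<close> divided by the eigenvalue.\<close>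
  proof (intro conjI exI[of _ "\<lambda>i x. (1 / a i) *\<^sub>R T x"] ballI)
    note enum = spectral_space_orth_direct_sum[OF S that[unfolded spec0]]
    show sum: "orth_direct_sum (indices n) (\<lambda>i. eigenspace S (a i)) H0"
      unfolding H0_def by (rule enum(2))
    have a: "\<alpha> < a i" if "i \<in> indices n" for i
      using enum(1) that by auto
    then have a0: "a i > 0" if "i \<in> indices n" for i
      using \<alpha> that by force
    show "unitary_on (eigenspace S (a i)) (\<lambda>x. (1 / a i) *\<^sub>R T x)" if i: "i \<in>
        indices n" for i
    proof -
      define E where "E = eigenspace S (a i)"
      have E: "csubspace E"
        unfolding E_def by (intro closed_subspace_csubspace closed_subspace_eigenspace S')
      have TE: "T x \<in> E" "Tadj x \<in> E" if "x \<in> E" for x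
        using T_eig[OF a[OF i]] Ta_eig[OF a[OF i]] that by (auto simp: E_def)
      \<comment> \<open>Above \<alpha> the eigenspaces of \<open>P\<close> and \<open>Q\<close>
        coincide, so \<open>T\<close> scaled by \<open>1 / a i\<close> has a two-sided inverse given
        by its adjoint.\<close>
      have PE: "T (Tadj x) = (a i)\<^sup>2 *\<^sub>R x" and QE: "Tadj (T x) = (a i)\<^sup>2
          *\<^sub>R x" if "x \<in> E" for x
      proof -
        have "x \<in> eigenspace P ((a i)\<^sup>2)" "x \<in> eigenspace Q ((a i)\<^sup>2)"
          using that eig_P[of "a i"] eig_Q[OF a[OF i]] a0[OF i] by (simp_all add: E_def)
        then show "T (Tadj x) = (a i)\<^sup>2 *\<^sub>R x" "Tadj (T x) = (a i)\<^sup>2 *\<^sub>R x"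
          by (simp_all add: in_eigenspace_iff PQ)
      qed
      have adjU: "Defs.adj E (\<lambda>x. (1 / a i) *\<^sub>R T x) y = (1 / a i) *\<^sub>R Tadj y"
          if "y \<in> E" for y
        by (intro adj_eqI E csubspace_scaleR TE that) (simp add: cinner_simps adj)
      have "bounded_op E E (\<lambda>x. (1 / a i) *\<^sub>R T x)"
        by (rule bounded_op_restrict[OF bounded_op_scaleR_fun[OF T]])
           (rule csubspace_scaleR[OF E TE(1)])
      moreover have "Defs.adj E (\<lambda>x. (1 / a i) *\<^sub>R T x) ((1 / a i) *\<^sub>R T x) =
          x" if "x \<in> E" for x
        using a0[OF i] that
        by (simp add: adjU csubspace_scaleR[OF E] TE bounded_op_scaleR[OF Ta] QE power2_eq_square)
      moreover have "(1 / a i) *\<^sub>R T (Defs.adj E (\<lambda>x. (1 / a i) *\<^sub>R T x) x) =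
          x" if "x \<in> E" for x
        using a0[OF i] that by (simp add: adjU bounded_op_scaleR[OF T] PE power2_eq_square)
      ultimately show ?thesis
        by (simp add: unitary_on_def E_def)
    qed
    show "T x = direct_sum_op (indices n) (\<lambda>i. eigenspace S (a i)) (\<lambda>i y. a i
        *\<^sub>R (1 / a i) *\<^sub>R T y) x"
      if "x \<in> H0" for x
      using a0 by (intro direct_sum_op_eq[OF sum that T, symmetric]) fastforce
  qed
  have iii: "orth_direct_sum (indices m) (\<lambda>j. eigenspace S (b j)) H2 \<and>
      (\<forall>y\<in>H2. A1 (Defs.adj H1 A1 y) + T (Defs.adj H2 T y) =
        direct_sum_op (indices m) (\<lambda>j. eigenspace S (b j)) (\<lambda>j z. (b j)\<^sup>2
            *\<^sub>R z) y) \<and>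
      op_le_on H2 (\<lambda>y. Defs.adj H2 T (T y))
        (direct_sum_op (indices m) (\<lambda>j. eigenspace S (b j)) (\<lambda>j z. (b j)\<^sup>2
            *\<^sub>R z))"
    if "enumerates m b (complex_of_real ` {min_modulus Tadj..<\<alpha>} \<inter> spectrum S)"
        for m b
  proof (intro conjI ballI)
    show sum: "orth_direct_sum (indices m) (\<lambda>j. eigenspace S (b j)) H2"
      unfolding H2_def by (rule spectral_space_orth_direct_sum(2)[OF S that[unfolded spec2]])
    have dsum: "direct_sum_op (indices m) (\<lambda>j. eigenspace S (b j)) (\<lambda>j z. (b
        j)\<^sup>2 *\<^sub>R z) y = P y"
      if "y \<in> H2" for y
    proof (rule direct_sum_op_eq[OF sum that P])
      show "(b j)\<^sup>2 *\<^sub>R z = P z" if "z \<in> eigenspace S (b j)" for j z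
        using that by (simp add: P_def in_eigenspace_iff bounded_op_scaleR[OF S'] power2_eq_square
            flip: SS)
    qed
    then show "A1 (Defs.adj H1 A1 y) + T (Defs.adj H2 T y) =
        direct_sum_op (indices m) (\<lambda>j. eigenspace S (b j)) (\<lambda>j z. (b j)\<^sup>2
            *\<^sub>R z) y" if "y \<in> H2" for y
      using that AABB by simp
    \<comment> \<open>The adjoint of \<open>T\<close> on \<open>H2\<close> is the compression of
      \<open>Tadj\<close>, so the product of that adjoint with \<open>T\<close> is the compression
      of \<open>Q\<close>. The form of \<open>D\<close> on \<open>H2\<close> is the difference of
      the squared norms of \<open>Tadj x\<close> and \<open>T x\<close>, nonnegative by
      hyponormality.\<close>
    define D where "D = (\<lambda>y. P y - proj H2 (Q y))"
    have eq: "direct_sum_op (indices m) (\<lambda>j. eigenspace S (b j)) (\<lambda>j z. (b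
        j)\<^sup>2 *\<^sub>R z) y -
        Defs.adj H2 T (T y) = D y" if "y \<in> H2" for y
      by (simp add: dsum[OF that] adjB1 D_def Q_def)
    obtain k l where kl: "\<And>x. norm (P x) \<le> k * norm x"
        "\<And>x. norm (Q x) \<le> l * norm x"
      using P Q by (auto simp: bounded_op_UNIV_iff)
    have "bounded_op UNIV UNIV D"
      unfolding bounded_op_UNIV_iff
    proof (intro conjI allI exI)
      show "D (x + y) = D x + D y" for x y
        by (simp add: D_def bounded_op_add[OF P] bounded_op_add[OF Q] proj_add[OF cl(3)])
      show "D (z *\<^sub>C x) = z *\<^sub>C D x" for z x
        by (simp add: D_def bounded_op_scaleC[OF P] bounded_op_scaleC[OF Q] proj_scaleC[OF cl(3)]
            scaleC_diff_right)
      show "norm (D x) \<le> (k + l) * norm x" for x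
        using norm_triangle_ineq4[of "P x" "proj H2 (Q x)"] norm_proj_le[OF cl(3), of "Q x"] kl[of
            x]
        by (simp add: D_def algebra_simps)
    qed
    then have "bounded_op H2 H2 D"
      by (rule bounded_op_restrict) (simp add: D_def csubspace_diff[OF sub(3)] P2 proj_in[OF cl(3)])
    moreover have "cinner (D x) x \<in> \<real> \<and> 0 \<le> Re (cinner (D x) x)"
        if "x \<in> H2" for x
    proof -
      have "cinner (D x) x = complex_of_real ((norm (Tadj x))\<^sup>2 - (norm (T x))\<^sup>2)"
        by (simp add: D_def cinner_diff_left cinner_proj_left[OF cl(3) that] P_def Q_def
            adj[of "Tadj x" x] adj'[of "T x" x] cinner_self)
      moreover have "(norm (T x))\<^sup>2 \<le> (norm (Tadj x))\<^sup>2"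
        by (intro power_mono hyp) simp
      ultimately show ?thesis
        by (simp only: Reals_of_real Re_complex_of_real diff_ge_0_iff_ge)
    qed
    ultimately show "op_le_on H2 (\<lambda>y. Defs.adj H2 T (T y))
        (direct_sum_op (indices m) (\<lambda>j. eigenspace S (b j)) (\<lambda>j z. (b j)\<^sup>2
            *\<^sub>R z))"
      unfolding op_le_on_def positive_on_def
      using bounded_op_cong[OF sub(3) eq] by (simp add: eq)
  qed
  \<comment> \<open>Both outer subspaces are 0 here, so \<open>H1\<close> is the whole
    space.\<close>
  have last: "T x = norm T *\<^sub>R S1 x" if "norm T = \<alpha>" "\<alpha> = min_modulus Tadj"
      for x
  proof -
    have "H0 = {0}" "H2 = {0}"
      using H0_0 H2_0 that by auto
    then have "proj H0 y = 0" "proj H2 y = 0" for y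
      using proj_in[OF cl(1), of y] proj_in[OF cl(3), of y] by auto
    then have x: "x \<in> H1" "T x = proj H1 (T x)"
      using split[of x] split[of "T x"] proj_in[OF cl(2), of x] by auto
    then show ?thesis
      using S1_eq[OF x(1)] that(1) by simp
  qed
  have S1_0: "S1 x = 0" if "H1 = {0}" "x \<in> H1" for x
    using that S1_bounded by (auto simp: bounded_op_def)
  show ?thesis
    unfolding S_def[symmetric]
  proof (rule exI[of _ H0], rule exI[of _ H1], rule exI[of _ H2], rule exI[of _ "blinfun_apply T"],
      rule exI[of _ S1], rule exI[of _ A1], rule exI[of _ "blinfun_apply T"], rule exI[of _
          \<alpha>], intro conjI)
    show "bounded_op H0 H0 T"
      by (rule bounded_op_restrict[OF T T0])
    show "bounded_op H2 H2 T"
      by (rule bounded_op_restrict[OF T T2])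
    show "ess_spectrum S = {complex_of_real \<alpha>}"
      by (rule ess_spectrum_eq[OF S K assms(3)])
  qed (use decomp S1_bounded A1_bounded block \<alpha> ex0 i H0_0 S1_coisom S1_0 S1A1 ex2 iii H2_0
      last in \<open>simp_all\<close>)
qed

end
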